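(* For every $n\in\mathbb{N}$, the space $\mathfrak{X}_{0,1}^n$ is quasi-minimal, i.e. any two infinite dimensional closed subspaces of $\mathfrak{X}_{0,1}^n$ have further infinite dimensional closed subspaces which are isomorphic to each other.
   Context: $c_{00}$ is the space of finitely supported real sequences with unit vector basis $\{e_i\}_{i\in\mathbb{N}}$; $E<F$ for finite sets means $\max E<\min F$, and $f<g$ for vectors means $\operatorname{supp}f<\operatorname{supp}g$. Schreier families: $\mathcal{S}_0=\{\{m\}:m\in\mathbb{N}\}$, $\mathcal{S}_1=\{F\subset\mathbb{N}:\#F\leqslant\min F\}$, and $\mathcal{S}_{m+1}=\{F_1\cup\cdots\cup F_k: F_1<\cdots<F_k\in\mathcal{S}_m,\ k\leqslant\min F_1\}$. The space $\mathfrak{X}_{0,1}^n$ ($n\geqslant1$): For $G\subset c_{00}$, an $\alpha$-average in $G$ is a vector $\alpha\in G$ of the form $\alpha=\frac1\ell\sum_{q=1}^d f_q$ with $f_1<\cdots<f_d\in G$, $d\leqslant\ell$, $\ell\geqslant2$; its size is $s(\alpha)=\ell$ (an $\alpha$-average is considered together with such a representation). A sequence $\{\alpha_q\}_{q=1}^d$ of $\alpha$-averages is $\mathcal{S}_k$-admissible if $\alpha_1<\cdots<\alpha_d$ and $\{\min\operatorname{supp}\alpha_q:q=1,\ldots,d\}\in\mathcal{S}_k$; a (finite or infinite) sequence of $\alpha$-averages is very fast growing if $\alpha_1<\alpha_2<\cdots$, $s(\alpha_1)<s(\alpha_2)<\cdots$ and $s(\alpha_q)>\max\operatorname{supp}\alpha_{q-1}$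 for $q>1$. Set $W_0=\{\pm e_i\}_{i\in\mathbb{N}}$ and $W_{m+1}=W_m\cup W^\alpha_{m+1}\cup W^S_{m+1}$, where $W^\alpha_{m+1}=\{\frac1\ell\sum_{q=1}^d f_q: f_1<\cdots<f_d\in W_m,\ \ell\geqslant2,\ \ell\geqslant d\}$ and $W^S_{m+1}=\{\sum_{q=1}^d\alpha_q:\{\alpha_q\}_{q=1}^d\subset W_m$ an $\mathcal{S}_n$-admissible and very fast growing sequence of $\alpha$-averages$\}$. Let $W=\bigcup_m W_m$, acting on $c_{00}$ by the usual duality, $\|x\|=\sup\{f(x):f\in W\}$, and $\mathfrak{X}_{0,1}^n$ the completion of $(c_{00},\|\cdot\|)$. *)

theory Defs
  imports "HOL-Analysis.Analysis" "HOL-Probability.Discrete_Topology"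
begin

text \<open>
  Real sequences are functions \<open>nat \<Rightarrow> real\<close>. The index set is \<open>{1, 2, 3, \<dots>}\<close>, as the Schreier
  families require; the coordinate 0 of every vector is 0.
\<close>

definition supp :: "(nat \<Rightarrow> real) \<Rightarrow> nat set" where
  "supp x = {i. x i \<noteq> 0}"

definition c00 :: "(nat \<Rightarrow> real) set" where
  "c00 = {x. finite (supp x) \<and> x 0 = 0}"

definition unit_vec :: "nat \<Rightarrow> nat \<Rightarrow> real" where
  "unit_vec i = (\<lambda>j. if j = i then 1 else 0)"

text \<open>Maxima and minima are only taken of nonempty finite sets, so \<open>E < F\<close> includes nonemptiness.\<close>

definition set_before :: "nat set \<Rightarrow> nat set \<Rightarrow> bool" where
  "set_before E F \<longleftrightarrow>
     finite E \<and> E \<noteq> {} \<and> finite F \<and> F \<noteq> {} \<and> Max E < Min F"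

definition vec_before :: "(nat \<Rightarrow> real) \<Rightarrow> (nat \<Rightarrow> real) \<Rightarrow> bool" where
  "vec_before f g \<longleftrightarrow> set_before (supp f) (supp g)"

text \<open>
  Only the nonempty members of the Schreier families are listed; the empty set would not contribute
  anything below, since all the sequences considered have at least one term.
\<close>

fun schreier :: "nat \<Rightarrow> nat set set" where
  "schreier 0 = {{m} | m. 1 \<le> m}"
| "schreier (Suc 0) = {F. finite F \<and> F \<noteq> {} \<and> card F \<le> Min F}"
| "schreier (Suc (Suc m)) =
     {\<Union> (set Fs) | Fs. Fs \<noteq> [] \<and> set Fs \<subseteq> schreier (Suc m) \<and>
        sorted_wrt set_before Fs \<and> length Fs \<le> Min (hd Fs)}"

definition vec_sum :: "(nat \<Rightarrow> real) list \<Rightarrow> nat \<Rightarrow> real" where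
  "vec_sum fs = (\<lambda>i. \<Sum>f\<leftarrow>fs. f i)"

text \<open>
  \<open>averages G l\<close>: the vectors \<open>1/l \<cdot> (f\<^sub>1 + \<dots> + f\<^sub>d)\<close> with \<open>f\<^sub>1 < \<dots> < f\<^sub>d\<close> in \<open>G\<close>,
  \<open>1 \<le> d \<le> l\<close> and \<open>2 \<le> l\<close>.
\<close>

definition averages :: "(nat \<Rightarrow> real) set \<Rightarrow> nat \<Rightarrow> (nat \<Rightarrow> real) set" where
  "averages G l =
     {(\<lambda>i. vec_sum fs i / real l) | fs. fs \<noteq> [] \<and> set fs \<subseteq> G \<and>
        sorted_wrt vec_before fs \<and> length fs \<le> l \<and> 2 \<le> l}"

text \<open>
  A vector may be an \<open>\<alpha>\<close>-average in several ways, with different sizes. An \<open>\<alpha>\<close>-average is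
  therefore handled as a pair \<open>(a, l)\<close> of the vector and the size of a chosen representation.
\<close>

definition alpha_average :: "(nat \<Rightarrow> real) set \<Rightarrow> (nat \<Rightarrow> real) \<times> nat \<Rightarrow> bool" where
  "alpha_average G p \<longleftrightarrow> fst p \<in> G \<and> fst p \<in> averages G (snd p)"

definition admissible :: "nat \<Rightarrow> ((nat \<Rightarrow> real) \<times> nat) list \<Rightarrow> bool" where
  "admissible k ps \<longleftrightarrow>
     sorted_wrt vec_before (map fst ps) \<and> (\<lambda>p. Min (supp (fst p))) ` set ps \<in> schreier k"

definition very_fast_growing :: "((nat \<Rightarrow> real) \<times> nat) list \<Rightarrow> bool" where
  "very_fast_growing ps \<longleftrightarrow>
     sorted_wrt vec_before (map fst ps) \<and> sorted_wrt (<) (map snd ps) \<and>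
     (\<forall>q. Suc q < length ps \<longrightarrow> snd (ps ! Suc q) > Max (supp (fst (ps ! q))))"

fun Wm :: "nat \<Rightarrow> nat \<Rightarrow> (nat \<Rightarrow> real) set" where
  "Wm n 0 = {unit_vec i | i. 1 \<le> i} \<union> {(\<lambda>j. - unit_vec i j) | i. 1 \<le> i}"
| "Wm n (Suc m) = Wm n m
     \<union> (\<Union>l. averages (Wm n m) l)
     \<union> {vec_sum (map fst ps) | ps. ps \<noteq> [] \<and> (\<forall>p\<in>set ps. alpha_average (Wm n m) p) \<and>
          admissible n ps \<and> very_fast_growing ps}"

definition W :: "nat \<Rightarrow> (nat \<Rightarrow> real) set" where
  "W n = (\<Union>m. Wm n m)"

definition pairing :: "(nat \<Rightarrow> real) \<Rightarrow> (nat \<Rightarrow> real) \<Rightarrow> real" where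
  "pairing f x = (\<Sum>i\<in>supp x. f i * x i)"

definition norm_W :: "nat \<Rightarrow> (nat \<Rightarrow> real) \<Rightarrow> real" where
  "norm_W n x = (SUP f\<in>W n. pairing f x)"

text \<open>
  \<open>is_X01 n X\<close>: \<open>X\<close> is a completion of \<open>c00\<close> with the norm \<open>norm_W n\<close>, realised as a closed
  subspace of some Banach space (\<open>X = UNIV\<close> is allowed). The parameter \<open>n\<close> cannot occur in a type,
  so the completion is a set; completions are unique up to isometric isomorphism, and existence is
  shown in \<open>is_X01_exists\<close> below.
\<close>

definition is_X01 :: "nat \<Rightarrow> 'a::banach set \<Rightarrow> bool" where
  "is_X01 n X \<longleftrightarrow> (\<exists>J :: (nat \<Rightarrow> real) \<Rightarrow> 'a.
     (\<forall>x\<in>c00. \<forall>y\<in>c00. J (\<lambda>i. x i + y i) = J x + J y) \<and>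
     (\<forall>c. \<forall>x\<in>c00. J (\<lambda>i. c * x i) = c *\<^sub>R J x) \<and>
     (\<forall>x\<in>c00. norm (J x) = norm_W n x) \<and>
     X = closure (J ` c00))"

definition inf_dim_closed_subspace :: "'a::real_normed_vector set \<Rightarrow> bool" where
  "inf_dim_closed_subspace Y \<longleftrightarrow>
     subspace Y \<and> closed Y \<and> \<not> (\<exists>B. finite B \<and> Y \<subseteq> span B)"

definition isomorphic_subspaces :: "'a::real_normed_vector set \<Rightarrow> 'a set \<Rightarrow> bool" where
  "isomorphic_subspaces Y Z \<longleftrightarrow> (\<exists>T S.
     (\<forall>x\<in>Y. \<forall>y\<in>Y. T (x + y) = T x + T y) \<and> (\<forall>c. \<forall>x\<in>Y. T (c *\<^sub>R x) = c *\<^sub>R T x) \<and>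
     homeomorphism Y Z T S)"

definition quasi_minimal :: "'a::real_normed_vector set \<Rightarrow> bool" where
  "quasi_minimal X \<longleftrightarrow> (\<forall>Y Z.
     inf_dim_closed_subspace Y \<and> Y \<subseteq> X \<and> inf_dim_closed_subspace Z \<and> Z \<subseteq> X \<longrightarrow>
     (\<exists>Y' Z'. inf_dim_closed_subspace Y' \<and> Y' \<subseteq> Y \<and>
        inf_dim_closed_subspace Z' \<and> Z' \<subseteq> Z \<and> isomorphic_subspaces Y' Z'))"


subsection \<open>Existence of the completion\<close>

lemma vec_before_disjoint: "vec_before f g \<Longrightarrow> f i = 0 \<or> g i = 0"
  unfolding vec_before_def set_before_def
  by (metis (mono_tags) Max_ge Min_le leD le_trans mem_Collect_eq supp_def)

lemma vec_sum_le_one: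
  assumes "sorted_wrt vec_before fs" "\<forall>f\<in>set fs. \<bar>f i\<bar> \<le> 1"
  shows "\<bar>vec_sum fs i\<bar> \<le> 1"
  using assms
proof (induction fs)
  case Nil
  then show ?case by (simp add: vec_sum_def)
next
  case (Cons f fs)
  show ?case
  proof (cases "f i = 0")
    case True
    with Cons show ?thesis by (simp add: vec_sum_def)
  next
    case False
    with Cons.prems have "\<forall>g\<in>set fs. g i = 0"
      using vec_before_disjoint by fastforce
    then have "map (\<lambda>g. g i) fs = map (\<lambda>g. 0) fs" by simp
    then have "(\<Sum>g\<leftarrow>fs. g i) = 0" by (metis sum_list_0)
    with Cons.prems show ?thesis by (simp add: vec_sum_def)
  qed
qed

lemma averages_le_one:
  assumes "f \<in> averages G l" "\<forall>g\<in>G. \<bar>g i\<bar> \<le> 1"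
  shows "\<bar>f i\<bar> \<le> 1"
proof -
  obtain fs where fs: "f = (\<lambda>i. vec_sum fs i / real l)" "set fs \<subseteq> G"
    "sorted_wrt vec_before fs" "2 \<le> l"
    using assms(1) unfolding averages_def by blast
  have "\<bar>vec_sum fs i\<bar> \<le> 1"
    by (rule vec_sum_le_one) (use fs assms in auto)
  then show ?thesis using fs by (simp add: field_simps)
qed

lemma Wm_le_one: "f \<in> Wm n m \<Longrightarrow> \<bar>f i\<bar> \<le> 1"
proof (induction m arbitrary: f)
  case 0
  then show ?case by (auto simp: unit_vec_def)
next
  case (Suc m)
  from Suc.prems consider "f \<in> Wm n m" | l where "f \<in> averages (Wm n m) l"
    | ps where "f = vec_sum (map fst ps)" "\<forall>p\<in>set ps. alpha_average (Wm n m) p" "admissible n ps"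
    by auto
  then show ?case
  proof cases
    case 1
    then show ?thesis by (rule Suc.IH)
  next
    case 2
    then show ?thesis using Suc.IH averages_le_one by blast
  next
    case 3
    then have "\<bar>vec_sum (map fst ps) i\<bar> \<le> 1"
      by (intro vec_sum_le_one) (auto intro: Suc.IH simp: admissible_def alpha_average_def)
    with 3 show ?thesis by simp
  qed
qed

lemma supp_uminus: "supp (\<lambda>i. - f i) = supp f"
  by (simp add: supp_def)

lemma vec_sum_uminus: "vec_sum (map (\<lambda>f i. - f i) fs) = (\<lambda>i. - vec_sum fs i)"
  by (induction fs) (auto simp: vec_sum_def fun_eq_iff)

lemma sorted_uminus:
  "sorted_wrt vec_before (map (\<lambda>f i. - f i) fs) = sorted_wrt vec_before fs"
  by (simp add: sorted_wrt_map vec_before_def[abs_def] supp_uminus)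

lemma averages_uminus:
  assumes "f \<in> averages G l" "\<And>g. g \<in> G \<Longrightarrow> (\<lambda>i. - g i) \<in> G"
  shows "(\<lambda>i. - f i) \<in> averages G l"
proof -
  obtain fs where fs: "f = (\<lambda>i. vec_sum fs i / real l)" "fs \<noteq> []" "set fs \<subseteq> G"
    "sorted_wrt vec_before fs" "length fs \<le> l" "2 \<le> l"
    using assms(1) unfolding averages_def by blast
  show ?thesis
    unfolding averages_def mem_Collect_eq
    by (rule exI[of _ "map (\<lambda>f i. - f i) fs"])
       (use fs assms(2) in \<open>auto simp: vec_sum_uminus sorted_uminus\<close>)
qed

lemma Wm_uminus: "f \<in> Wm n m \<Longrightarrow> (\<lambda>i. - f i) \<in> Wm n m"
proof (induction m arbitrary: f)
  case 0
  then show ?case by auto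
next
  case (Suc m)
  from Suc.prems consider "f \<in> Wm n m" | l where "f \<in> averages (Wm n m) l"
    | ps where "f = vec_sum (map fst ps)" "ps \<noteq> []" "\<forall>p\<in>set ps. alpha_average (Wm n m) p"
        "admissible n ps" "very_fast_growing ps"
    by auto
  then show ?case
  proof cases
    case 1
    then show ?thesis using Suc.IH by simp
  next
    case 2
    then have "(\<lambda>i. - f i) \<in> averages (Wm n m) l"
      using averages_uminus Suc.IH by blast
    then show ?thesis by auto
  next
    case 3
    define qs where "qs = map (\<lambda>p. ((\<lambda>i. - fst p i), snd p)) ps"
    have fst_qs: "map fst qs = map (\<lambda>f i. - f i) (map fst ps)"
      and snd_qs: "map snd qs = map snd ps"
      by (simp_all add: qs_def)
    have "(\<lambda>i. - f i) = vec_sum (map fst qs)"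
      unfolding 3(1) fst_qs vec_sum_uminus ..
    moreover have "qs \<noteq> []" using 3 by (simp add: qs_def)
    moreover have "\<forall>q\<in>set qs. alpha_average (Wm n m) q"
      using 3 Suc.IH averages_uminus
      by (fastforce simp: qs_def alpha_average_def)
    moreover have "admissible n qs"
      using 3(4) unfolding admissible_def fst_qs sorted_uminus
      by (simp add: qs_def image_image supp_uminus)
    moreover have "very_fast_growing qs"
      using 3(5) unfolding very_fast_growing_def fst_qs snd_qs sorted_uminus
      by (auto simp: qs_def supp_uminus)
    ultimately show ?thesis by auto
  qed
qed

lemma W_le_one: "f \<in> W n \<Longrightarrow> \<bar>f i\<bar> \<le> 1"
  using Wm_le_one by (auto simp: W_def)

lemma W_uminus: "f \<in> W n \<Longrightarrow> (\<lambda>i. - f i) \<in> W n"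
  using Wm_uminus by (auto simp: W_def)

lemma W_nonempty: "W n \<noteq> {}"
proof -
  have "unit_vec 1 \<in> Wm n 0" by auto
  then show ?thesis unfolding W_def by blast
qed

lemma pairing_bound:
  assumes "f \<in> W n"
  shows "\<bar>pairing f x\<bar> \<le> (\<Sum>i\<in>supp x. \<bar>x i\<bar>)"
proof -
  have "\<bar>pairing f x\<bar> \<le> (\<Sum>i\<in>supp x. \<bar>f i * x i\<bar>)"
    unfolding pairing_def by (rule sum_abs)
  also have "\<dots> \<le> (\<Sum>i\<in>supp x. \<bar>x i\<bar>)"
    using W_le_one[OF assms] by (intro sum_mono) (simp add: abs_mult mult_left_le_one_le)
  finally show ?thesis .
qed

lemma pairing_le_norm_W:
  assumes "f \<in> W n"
  shows "\<bar>pairing f x\<bar> \<le> norm_W n x"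
proof -
  have bdd: "bdd_above ((\<lambda>f. pairing f x) ` W n)"
    unfolding bdd_above_def
    by (rule exI[of _ "\<Sum>i\<in>supp x. \<bar>x i\<bar>"]) (use pairing_bound abs_le_D1 in fastforce)
  have "pairing f x \<le> norm_W n x"
    unfolding norm_W_def by (rule cSUP_upper[OF assms bdd])
  moreover have "pairing (\<lambda>i. - f i) x \<le> norm_W n x"
    unfolding norm_W_def by (rule cSUP_upper[OF W_uminus[OF assms] bdd])
  moreover have "pairing (\<lambda>i. - f i) x = - pairing f x"
    by (simp add: pairing_def sum_negf)
  ultimately show ?thesis by linarith
qed

lemma pairing_superset:
  assumes "finite A" "supp x \<subseteq> A"
  shows "pairing f x = (\<Sum>i\<in>A. f i * x i)"
  unfolding pairing_def
  by (rule sum.mono_neutral_left) (use assms in \<open>auto simp: supp_def\<close>)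

lemma pairing_add:
  assumes "x \<in> c00" "y \<in> c00"
  shows "pairing f (\<lambda>i. x i + y i) = pairing f x + pairing f y"
proof -
  let ?A = "supp x \<union> supp y"
  have fin: "finite ?A" using assms by (simp add: c00_def)
  have "supp (\<lambda>i. x i + y i) \<subseteq> ?A" by (auto simp: supp_def)
  then show ?thesis
    using pairing_superset[OF fin, of "\<lambda>i. x i + y i" f] pairing_superset[OF fin, of x f]
      pairing_superset[OF fin, of y f]
    by (simp add: distrib_left sum.distrib)
qed

lemma pairing_scale:
  assumes "x \<in> c00"
  shows "pairing f (\<lambda>i. c * x i) = c * pairing f x"
proof -
  have fin: "finite (supp x)" using assms by (simp add: c00_def)
  have "supp (\<lambda>i. c * x i) \<subseteq> supp x" by (auto simp: supp_def)
  from pairing_superset[OF fin this] show ?thesis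
    by (simp add: pairing_def sum_distrib_left mult.left_commute)
qed

instance bcontfun :: (metric_space, banach) banach ..

theorem is_X01_exists: "\<exists>X :: ((nat \<Rightarrow> real) discrete \<Rightarrow>\<^sub>C real) set. is_X01 n X"
proof -
  define v where "v x d = (if of_discrete d \<in> W n then pairing (of_discrete d) x else 0)"
    for x and d :: "(nat \<Rightarrow> real) discrete"
  define J where "J x = Bcontfun (v x)" for x
  have norm_W_nonneg: "0 \<le> norm_W n x" for x
    using W_nonempty[of n] pairing_le_norm_W[of _ n x] by (meson abs_ge_zero ex_in_conv order_trans)
  have v_bound: "\<bar>v x d\<bar> \<le> norm_W n x" for x d
    using pairing_le_norm_W norm_W_nonneg by (auto simp: v_def)
  have "v x \<in> bcontfun" for x
    by (rule bcontfun_normI[of _ "norm_W n x"])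
       (auto simp: v_bound continuous_on_open_vimage open_discrete)
  then have app: "apply_bcontfun (J x) = v x" for x
    by (simp add: J_def Bcontfun_inverse)
  have "J (\<lambda>i. x i + y i) = J x + J y" if "x \<in> c00" "y \<in> c00" for x y
    by (rule bcontfun_eqI) (simp add: app v_def pairing_add that)
  moreover have "J (\<lambda>i. c * x i) = c *\<^sub>R J x" if "x \<in> c00" for c x
    by (rule bcontfun_eqI) (simp add: app v_def pairing_scale that)
  moreover have "norm (J x) = norm_W n x" for x
  proof (rule antisym)
    show "norm (J x) \<le> norm_W n x"
      by (rule norm_bound) (simp add: app v_bound)
    have "pairing f x \<le> norm (J x)" if "f \<in> W n" for f
    proof -
      have "pairing f x = v x (discrete f)" using that by (simp add: v_def discrete_inverse)
      also have "\<dots> \<le> norm (J x)" using norm_bounded[of "J x" "discrete f"] by (simp add: app)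
      finally show ?thesis .
    qed
    then show "norm_W n x \<le> norm (J x)"
      unfolding norm_W_def using W_nonempty by (intro cSUP_least)
  qed
  ultimately have "is_X01 n (closure (J ` c00))"
    unfolding is_X01_def by blast
  then show ?thesis by blast
qed

end

(*
  Let Y and Z be subspaces. By small perturbations both may be treated as if they contained, arbitrarily
  far out, finitely supported vectors.

  Step 1. Y contains vectors u of norm at most 1, arbitrarily far out, on which alpha-averages of
  arbitrarily large size are bounded below. Otherwise averages of large size are uniformly small on all
  far vectors of Y. Taking averages of rapidly increasing sequences then yields vectors, not small in norm,
  on which all S_{n-1}-admissible very fast growing sums are small. A rapidly increasing sequence of such
  vectors behaves like the basis of c_0, and its long sums are vectors u as wanted.

  Step 2. Averaging the u's n-1 times gives vectors v which admit lower estimates by S_{n-1}-admissible sums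
  while S_{n-2}-admissible sums are controlled. Let y_k = (v_{k,1} + ... + v_{k,N_k}) / N_k and similarly
  z_k in Z, where v_{k,i} and its counterpart in Z are supported in the same cell of the integers.

  Step 3. (z_k) dominates (y_k) and vice versa. For a functional f and a combination of the y_k one constructs
  by recursion on f a functional g for the z_k, such that every point of the support of g lies strictly
  between two points of the support of f. This keeps g admissible and very fast growing. It costs only the
  first and the last cell touched by f, which is negligible, since each y_k is an average over many cells.
*)
theory Submission
  imports Defs
begin

text \<open>The stages of \<open>W\<close> are unboundedly deep, so the error in Step 3 must not
  grow along the recursion. It is kept at \<open>eps k\<close>, that is 8^-k, where \<open>k\<close>
  is the first block met by the functional. In an average at most one summand meets this block and a
  later one, and every other summand has error at most \<open>eps k / 8\<close>; so averaging leaves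
  9/16 of the error. The margin pays for what is discarded in a very fast growing sum: a block is
  charged to the first member that meets it, the sizes of all later members exceeding the start of
  the block. Only the first block may be met by several members that matter. They are replaced by
  one functional \<open>h\<close> of \<open>W\<close>, which enters the new sum as
  \<open>h / 2\<close>, an average of size 2; hence the factor 2 / c. In Step 1 the danger is that
  averages become small in norm. Each stage is a dichotomy: either there are vectors with the same
  lower bound in norm that are small on S_(j+1) sums, or all far vectors admit S_(j+1) sums bounded
  below, and these, joined, keep the averages large.\<close>

text \<open>The notions of the theorem use sorted lists, whereas the arguments form subsets, unions
  and images. This lemma and \<open>sorted_wrt_key\<close> translate between the two. The strictly
  increasing \<open>key\<close> makes up for transitivity of \<open>R\<close>; it will be the
  minimum of a set or of a support.\<close>

lemma ex_sorted_wrt_list: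
  fixes key :: "'b \<Rightarrow> nat"
  assumes fin: "finite A" and chain: "\<And>a b. a \<in> A \<Longrightarrow> b \<in> A \<Longrightarrow> a \<noteq> b \<Longrightarrow> R a b \<or> R b a"
    and key: "\<And>a b. a \<in> A \<Longrightarrow> b \<in> A \<Longrightarrow> R a b \<Longrightarrow> key a < key b"
  obtains xs where "set xs = A" "distinct xs" "sorted_wrt R xs"
proof -
  have inj: "inj_on key A"
    using chain key by (metis inj_onI less_irrefl)
  define g where "g = the_inv_into A key"
  define xs where "xs = map g (sorted_list_of_set (key ` A))"
  have g: "g (key a) = a" if "a \<in> A" for a
    unfolding g_def using inj that by (simp add: the_inv_into_f_f)
  have "set xs = A"
    using fin g by (force simp: xs_def image_image)
  moreover have "distinct xs"
    unfolding xs_def using fin inj g by (auto simp: distinct_map intro!: inj_onI)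
  moreover have "sorted_wrt R xs"
  proof -
    have "sorted_wrt (<) (sorted_list_of_set (key ` A))" by simp
    then have "sorted_wrt (\<lambda>s t. R (g s) (g t)) (sorted_list_of_set (key ` A))"
    proof (rule sorted_wrt_mono_rel[rotated])
      fix s t assume st: "s \<in> set (sorted_list_of_set (key ` A))"
        "t \<in> set (sorted_list_of_set (key ` A))" "s < t"
      then obtain a b where "a \<in> A" "b \<in> A" "s = key a" "t = key b" using fin by auto
      then show "R (g s) (g t)" using st(3) chain[of a b] key[of b a] g by auto
    qed
    then show ?thesis by (simp add: xs_def sorted_wrt_map)
  qed
  ultimately show thesis by (rule that)
qed

lemma sorted_wrt_key:
  fixes key :: "'b \<Rightarrow> nat"
  assumes "sorted_wrt R xs" and "\<And>a b. R a b \<Longrightarrow> key a < key b"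
  shows "distinct xs" and "\<And>a b. a \<in> set xs \<Longrightarrow> b \<in> set xs \<Longrightarrow> a \<noteq> b \<Longrightarrow> R a b \<or> R b a"
  using assms by (induction xs) fastforce+

section \<open>Schreier families\<close>

lemma set_before_Min: "set_before A B \<Longrightarrow> Min A < Min B"
  unfolding set_before_def by (meson Max_ge Min_in le_less_trans)

lemma set_beforeD: "set_before A B \<Longrightarrow> a \<in> A \<Longrightarrow> b \<in> B \<Longrightarrow> a < b"
  unfolding set_before_def by (meson Max_ge Min_le le_less_trans less_le_trans)

lemma set_beforeI:
  "finite A \<Longrightarrow> A \<noteq> {} \<Longrightarrow> finite B \<Longrightarrow> B \<noteq> {} \<Longrightarrow> (\<And>a b. a \<in> A \<Longrightarrow> b \<in> B \<Longrightarrow> a < b) \<Longrightarrow> set_before A B"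
  by (simp add: set_before_def)

lemma schreier_props: "F \<in> schreier j \<Longrightarrow> finite F \<and> F \<noteq> {} \<and> (\<forall>x\<in>F. 1 \<le> x)"
proof (induction j arbitrary: F rule: schreier.induct)
  case 1
  then show ?case by auto
next
  case 2
  then have F: "finite F" "F \<noteq> {}" "card F \<le> Min F" by auto
  then have "0 < card F" by (simp add: card_gt_0_iff)
  then have "1 \<le> Min F" using F(3) by linarith
  then show ?case using F(1,2) by simp
next
  case (3 m)
  then obtain Fs where Fs: "F = \<Union> (set Fs)" "Fs \<noteq> []" "set Fs \<subseteq> schreier (Suc m)" by auto
  have *: "finite A \<and> A \<noteq> {} \<and> (\<forall>x\<in>A. 1 \<le> x)" if "A \<in> set Fs" for A
    using 3(1) Fs(3) that by blast
  have "hd Fs \<in> set Fs" using Fs(2) by simp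
  then have "\<Union> (set Fs) \<noteq> {}" using * by blast
  with * show ?case unfolding Fs(1) by blast
qed

definition sets_chain :: "nat set set \<Rightarrow> bool" where
  "sets_chain \<G> \<longleftrightarrow> (\<forall>A\<in>\<G>. \<forall>B\<in>\<G>. A \<noteq> B \<longrightarrow> set_before A B \<or> set_before B A)"

lemma Min_Union_sorted:
  assumes "sorted_wrt set_before Fs" "Fs \<noteq> []" "\<forall>A\<in>set Fs. finite A \<and> A \<noteq> {}"
  shows "Min (\<Union> (set Fs)) = Min (hd Fs)"
proof -
  obtain A As where Fs: "Fs = A # As" using assms by (cases Fs) auto
  show ?thesis
  proof (rule Min_eqI)
    show "finite (\<Union> (set Fs))" using assms by auto
    show "Min (hd Fs) \<in> \<Union> (set Fs)" using Fs assms by auto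
    fix y assume "y \<in> \<Union> (set Fs)"
    then obtain B where B: "B \<in> set Fs" "y \<in> B" by auto
    show "Min (hd Fs) \<le> y"
    proof (cases "B = A")
      case True
      then show ?thesis using B Fs assms by auto
    next
      case False
      then have "set_before A B" using B Fs assms by auto
      moreover have "Min A \<in> A" using Fs assms by auto
      ultimately have "Min A < y" using B(2) by (rule set_beforeD)
      then show ?thesis using Fs by simp
    qed
  qed
qed

text \<open>The passage from S_0 to S_1 is defined by cardinality. Cutting a set into singletons
  shows that it obeys the recursion of the higher steps, so later inductions on the level are
  uniform.\<close>

lemma schreier_Suc_lists:
  "F \<in> schreier (Suc j) \<longleftrightarrow>
     (\<exists>Fs. Fs \<noteq> [] \<and> set Fs \<subseteq> schreier j \<and> sorted_wrt set_before Fs \<and>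
        length Fs \<le> Min (hd Fs) \<and> F = \<Union> (set Fs))"
proof (cases j)
  case 0
  show ?thesis
  proof
    assume "F \<in> schreier (Suc j)"
    then have F: "finite F" "F \<noteq> {}" "card F \<le> Min F" using 0 by auto
    have F1: "\<forall>x\<in>F. 1 \<le> x" using schreier_props[OF \<open>F \<in> schreier (Suc j)\<close>] by blast
    define Fs where "Fs = map (\<lambda>x. {x}) (sorted_list_of_set F)"
    have ne: "Fs \<noteq> []" using F by (simp add: Fs_def)
    have U: "F = \<Union> (set Fs)" using F by (auto simp: Fs_def)
    have sorted: "sorted_wrt set_before Fs"
      using F by (auto simp: Fs_def sorted_wrt_map set_before_def)
    have "Min (hd Fs) = Min F"
      using Min_Union_sorted[OF sorted ne] F unfolding U[symmetric] by (simp add: Fs_def)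
    moreover have "length Fs = card F" by (simp add: Fs_def)
    moreover have "set Fs \<subseteq> schreier j" using F F1 0 by (auto simp: Fs_def)
    ultimately show "\<exists>Fs. Fs \<noteq> [] \<and> set Fs \<subseteq> schreier j \<and> sorted_wrt set_before Fs \<and>
        length Fs \<le> Min (hd Fs) \<and> F = \<Union> (set Fs)"
      using F(3) ne U sorted by (intro exI[of _ Fs] conjI) simp_all
  next
    assume "\<exists>Fs. Fs \<noteq> [] \<and> set Fs \<subseteq> schreier j \<and> sorted_wrt set_before Fs \<and>
        length Fs \<le> Min (hd Fs) \<and> F = \<Union> (set Fs)"
    then obtain Fs where Fs: "Fs \<noteq> []" "set Fs \<subseteq> schreier 0" "sorted_wrt set_before Fs"
        "length Fs \<le> Min (hd Fs)" "F = \<Union> (set Fs)" using 0 by auto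
    have fin: "\<forall>A\<in>set Fs. finite A \<and> A \<noteq> {}" using Fs schreier_props by blast
    have "card F \<le> (\<Sum>A\<in>set Fs. card A)" unfolding Fs(5) using fin by (intro card_Union_le_sum_card)
    also have "\<dots> = (\<Sum>A\<in>set Fs. 1)" using Fs(2) by (intro sum.cong) auto
    also have "\<dots> \<le> length Fs" by (simp add: card_length)
    also have "\<dots> \<le> Min F" using Min_Union_sorted[OF Fs(3,1) fin] Fs by simp
    finally show "F \<in> schreier (Suc j)"
      using 0 Fs fin by (auto simp: neq_Nil_conv)
  qed
next
  case (Suc m)
  then show ?thesis by auto
qed

text \<open>Order-free form of the recursion: pairwise comparable pieces determine their own order,
  and the minimum of the first piece is the minimum of the union.\<close>

lemma schreier_Suc:
  "F \<in> schreier (Suc j) \<longleftrightarrow>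
     (\<exists>\<G>. finite \<G> \<and> \<G> \<noteq> {} \<and> \<G> \<subseteq> schreier j \<and> sets_chain \<G> \<and>
        card \<G> \<le> Min (\<Union>\<G>) \<and> F = \<Union>\<G>)"
proof
  assume "F \<in> schreier (Suc j)"
  then obtain Fs where Fs: "Fs \<noteq> []" "set Fs \<subseteq> schreier j" "sorted_wrt set_before Fs"
      "length Fs \<le> Min (hd Fs)" "F = \<Union> (set Fs)" unfolding schreier_Suc_lists by auto
  have fin: "\<forall>A\<in>set Fs. finite A \<and> A \<noteq> {}" using Fs schreier_props by blast
  have "sets_chain (set Fs)"
    unfolding sets_chain_def using sorted_wrt_key(2)[OF Fs(3), of Min] set_before_Min by blast
  moreover have "card (set Fs) \<le> Min (\<Union> (set Fs))"
    using Min_Union_sorted[OF Fs(3,1) fin] Fs(4) card_length[of Fs] by linarith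
  ultimately show "\<exists>\<G>. finite \<G> \<and> \<G> \<noteq> {} \<and> \<G> \<subseteq> schreier j \<and> sets_chain \<G> \<and>
        card \<G> \<le> Min (\<Union>\<G>) \<and> F = \<Union>\<G>" using Fs by (intro exI[of _ "set Fs"]) auto
next
  assume "\<exists>\<G>. finite \<G> \<and> \<G> \<noteq> {} \<and> \<G> \<subseteq> schreier j \<and> sets_chain \<G> \<and>
        card \<G> \<le> Min (\<Union>\<G>) \<and> F = \<Union>\<G>"
  then obtain \<G> where G: "finite \<G>" "\<G> \<noteq> {}" "\<G> \<subseteq> schreier j" "sets_chain \<G>"
      "card \<G> \<le> Min (\<Union>\<G>)" "F = \<Union>\<G>" by auto
  have fin: "\<forall>A\<in>\<G>. finite A \<and> A \<noteq> {}" using G schreier_props by blast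
  obtain Fs where Fs: "set Fs = \<G>" "distinct Fs" "sorted_wrt set_before Fs"
  proof (rule ex_sorted_wrt_list[OF G(1), of set_before Min])
    show "set_before A B \<or> set_before B A" if "A \<in> \<G>" "B \<in> \<G>" "A \<noteq> B" for A B
      using G(4) that unfolding sets_chain_def by blast
  qed (use set_before_Min in auto)
  have "Fs \<noteq> []" using Fs G by auto
  moreover from Min_Union_sorted[OF Fs(3) this] have "length Fs \<le> Min (hd Fs)"
    using fin Fs G(5) by (simp add: distinct_card[symmetric])
  ultimately show "F \<in> schreier (Suc j)" unfolding schreier_Suc_lists using Fs G by auto
qed

lemma schreier_singleton: "1 \<le> m \<Longrightarrow> {m} \<in> schreier j"
proof (induction j)
  case (Suc j)
  then show ?case unfolding schreier_Suc
    by (intro exI[of _ "{{m}}"]) (auto simp: sets_chain_def)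
qed auto

lemma schreier_mono: "F \<in> schreier j \<Longrightarrow> j \<le> k \<Longrightarrow> F \<in> schreier k"
proof (induction k)
  case (Suc k)
  show ?case
  proof (cases "j = Suc k")
    case False
    then have F: "F \<in> schreier k" using Suc by simp
    then have "1 \<le> Min F" using schreier_props[OF F] by auto
    with F show ?thesis unfolding schreier_Suc
      by (intro exI[of _ "{F}"]) (auto simp: sets_chain_def)
  qed (use Suc in auto)
qed auto

text \<open>Heredity and spreading in one statement. Pushing points to the right keeps the pieces of
  a decomposition successive, does not increase their number and does not decrease the
  minimum.\<close>

lemma schreier_spread:
  assumes "F \<in> schreier j" "G \<subseteq> F" "G \<noteq> {}" "strict_mono_on G \<phi>" "\<And>x. x \<in> G \<Longrightarrow> x \<le> \<phi> x"
  shows "\<phi> ` G \<in> schreier j"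
  using assms
proof (induction j arbitrary: F G)
  case 0
  then obtain m where "F = {m}" "1 \<le> m" by auto
  with 0 have "G = {m}" "1 \<le> \<phi> m" by (auto simp: subset_singleton_iff intro: order.trans)
  then show ?case by auto
next
  case (Suc j)
  obtain \<G> where g: "finite \<G>" "\<G> \<noteq> {}" "\<G> \<subseteq> schreier j" "sets_chain \<G>"
      "card \<G> \<le> Min (\<Union>\<G>)" "F = \<Union>\<G>" using Suc.prems(1) unfolding schreier_Suc by auto
  have fin: "\<forall>A\<in>\<G>. finite A \<and> A \<noteq> {}" using g schreier_props by blast
  \<comment> \<open>Pieces missing \<open>G\<close> are dropped, as the families contain nonempty
    sets only.\<close>
  define \<H> where "\<H> = (\<lambda>A. \<phi> ` (A \<inter> G)) ` {A \<in> \<G>. A \<inter> G \<noteq> {}}"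
  have U: "\<Union>\<H> = \<phi> ` G" using g(6) Suc.prems(2) by (auto simp: \<H>_def)
  have finF: "finite F" and finG: "finite G"
    using schreier_props Suc.prems(1,2) finite_subset by blast+
  have "\<H> \<noteq> {}" using U Suc.prems(3) by auto
  moreover have "finite \<H>" using g by (simp add: \<H>_def)
  moreover have "\<H> \<subseteq> schreier j"
  proof
    fix B assume "B \<in> \<H>"
    then obtain A where A: "A \<in> \<G>" "A \<inter> G \<noteq> {}" "B = \<phi> ` (A \<inter> G)" by (auto simp: \<H>_def)
    show "B \<in> schreier j" unfolding A(3)
      by (rule Suc.IH[of A]) (use A g Suc.prems in \<open>auto simp: strict_mono_on_def\<close>)
  qed
  moreover have "sets_chain \<H>"
    unfolding sets_chain_def
  proof (intro ballI impI)
    fix X Y assume XY: "X \<in> \<H>" "Y \<in> \<H>" "X \<noteq> Y"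
    then obtain A B where A: "A \<in> \<G>" "A \<inter> G \<noteq> {}" "X = \<phi> ` (A \<inter> G)"
      and B: "B \<in> \<G>" "B \<inter> G \<noteq> {}" "Y = \<phi> ` (B \<inter> G)" by (auto simp: \<H>_def)
    have *: "set_before (\<phi> ` (C \<inter> G)) (\<phi> ` (D \<inter> G))" if "set_before C D"
      "C \<inter> G \<noteq> {}" "D \<inter> G \<noteq> {}" for C D
    proof (rule set_beforeI)
      fix a b assume "a \<in> \<phi> ` (C \<inter> G)" "b \<in> \<phi> ` (D \<inter> G)"
      then show "a < b" using set_beforeD[OF that(1)] Suc.prems(4)
        by (auto simp: strict_mono_on_def)
    qed (use that finG in auto)
    show "set_before X Y \<or> set_before Y X"
      using *[of A B] *[of B A] A B XY g(4) unfolding sets_chain_def by metis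
  qed
  moreover have "card \<H> \<le> Min (\<Union>\<H>)"
  proof -
    have "card \<H> \<le> card {A \<in> \<G>. A \<inter> G \<noteq> {}}" unfolding \<H>_def using g by (intro card_image_le) auto
    also have "\<dots> \<le> card \<G>" using g by (intro card_mono) auto
    also have "\<dots> \<le> Min F" using g by simp
    also have "Min F \<le> Min (\<phi> ` G)"
    proof (rule Min.boundedI)
      fix y assume "y \<in> \<phi> ` G"
      then obtain x where "x \<in> G" "y = \<phi> x" by auto
      then show "Min F \<le> y" using Suc.prems(2,5) finF by (metis Min_le order.trans subsetD)
    qed (use finG Suc.prems in auto)
    finally show ?thesis unfolding U .
  qed
  ultimately show ?case unfolding schreier_Suc U[symmetric] by blast
qed

text \<open>Spreading in the form used for functionals: \<open>\<theta> q\<close> is the first index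
  of an old member and \<open>\<mu> q\<close> that of the functional replacing it.\<close>

lemma schreier_spread_rel:
  fixes \<theta> \<mu> :: "'b \<Rightarrow> nat"
  assumes F: "F \<in> schreier j" and Q: "Q \<noteq> {}" "inj_on \<theta> Q" "\<And>q. q \<in> Q \<Longrightarrow> \<theta> q \<in> F"
    "\<And>q. q \<in> Q \<Longrightarrow> \<theta> q \<le> \<mu> q"
    and mono: "\<And>q q'. q \<in> Q \<Longrightarrow> q' \<in> Q \<Longrightarrow> \<theta> q < \<theta> q' \<Longrightarrow> \<mu> q < \<mu> q'"
  shows "\<mu> ` Q \<in> schreier j"
proof -
  define \<phi> where "\<phi> = \<mu> \<circ> the_inv_into Q \<theta>"
  have phi: "\<phi> (\<theta> q) = \<mu> q" if "q \<in> Q" for q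
    using that Q by (simp add: \<phi>_def the_inv_into_f_f)
  have "\<phi> ` (\<theta> ` Q) \<in> schreier j"
    by (rule schreier_spread[OF F]) (use Q mono phi in \<open>auto simp: strict_mono_on_def\<close>)
  also have "\<phi> ` (\<theta> ` Q) = \<mu> ` Q" using phi by (auto simp: image_image intro!: image_cong)
  finally show ?thesis .
qed

lemma schreier_subset: "F \<in> schreier j \<Longrightarrow> G \<subseteq> F \<Longrightarrow> G \<noteq> {} \<Longrightarrow> G \<in> schreier j"
  using schreier_spread[of F j G "\<lambda>x. x"] by (auto simp: strict_mono_on_def)

section \<open>The norming set\<close>

text \<open>Very fast growth as a relation between any two members instead of consecutive ones, so
  that it passes to subsets at once.\<close>

definition prec :: "(nat \<Rightarrow> real) \<times> nat \<Rightarrow> (nat \<Rightarrow> real) \<times> nat \<Rightarrow> bool" where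
  "prec p q \<longleftrightarrow> vec_before (fst p) (fst q) \<and> snd p < snd q \<and> Max (supp (fst p)) < snd q"

definition vec_chain :: "('b \<Rightarrow> nat \<Rightarrow> real) \<Rightarrow> 'b set \<Rightarrow> bool" where
  "vec_chain v A \<longleftrightarrow> (\<forall>a\<in>A. \<forall>b\<in>A. a \<noteq> b \<longrightarrow> vec_before (v a) (v b) \<or> vec_before (v b) (v a))"

definition first_index :: "(nat \<Rightarrow> real) \<times> nat \<Rightarrow> nat" where
  "first_index p = Min (supp (fst p))"

definition family_sum :: "((nat \<Rightarrow> real) \<times> nat) set \<Rightarrow> nat \<Rightarrow> real" where
  "family_sum P = (\<lambda>i. \<Sum>p\<in>P. fst p i)"

text \<open>An S_j-admissible very fast growing sequence, kept as a set of pairs of average and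
  size. The level \<open>j\<close> is separate from \<open>n\<close> because the proof measures
  vectors by sums of lower levels.\<close>

definition family :: "(nat \<Rightarrow> real) set \<Rightarrow> nat \<Rightarrow> ((nat \<Rightarrow> real) \<times> nat) set \<Rightarrow> bool" where
  "family G j P \<longleftrightarrow> finite P \<and> P \<noteq> {} \<and> (\<forall>p\<in>P. alpha_average G p) \<and>
     (\<forall>p\<in>P. \<forall>q\<in>P. p \<noteq> q \<longrightarrow> prec p q \<or> prec q p) \<and> first_index ` P \<in> schreier j"

lemma familyD:
  assumes "family G j P"
  shows "finite P" "P \<noteq> {}" "\<And>p. p \<in> P \<Longrightarrow> fst p \<in> G" "\<And>p. p \<in> P \<Longrightarrow> fst p \<in> averages G (snd p)"
    "\<And>p q. p \<in> P \<Longrightarrow> q \<in> P \<Longrightarrow> p \<noteq> q \<Longrightarrow> prec p q \<or> prec q p" "first_index ` P \<in> schreier j"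
  using assms by (simp_all add: family_def alpha_average_def)

lemma vec_before_Min: "vec_before f g \<Longrightarrow> Min (supp f) < Min (supp g)"
  unfolding vec_before_def by (rule set_before_Min)

lemma vec_beforeD: "vec_before f g \<Longrightarrow> i \<in> supp f \<Longrightarrow> j \<in> supp g \<Longrightarrow> i < j"
  unfolding vec_before_def by (rule set_beforeD)

lemma vec_beforeI:
  "finite (supp f) \<Longrightarrow> supp f \<noteq> {} \<Longrightarrow> finite (supp g) \<Longrightarrow> supp g \<noteq> {} \<Longrightarrow>
   (\<And>i j. i \<in> supp f \<Longrightarrow> j \<in> supp g \<Longrightarrow> i < j) \<Longrightarrow> vec_before f g"
  unfolding vec_before_def by (rule set_beforeI)

lemma prec_first_index: "prec p q \<Longrightarrow> first_index p < first_index q"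
  unfolding prec_def first_index_def using vec_before_Min by blast

lemma averages_iff:
  "f \<in> averages G l \<longleftrightarrow> (\<exists>A. finite A \<and> A \<noteq> {} \<and> A \<subseteq> G \<and> vec_chain (\<lambda>g. g) A \<and> card A \<le> l \<and> 2 \<le> l \<and>
     f = (\<lambda>i. (\<Sum>g\<in>A. g i) / real l))"
proof
  assume "f \<in> averages G l"
  then obtain fs where fs: "f = (\<lambda>i. vec_sum fs i / real l)" "fs \<noteq> []" "set fs \<subseteq> G"
    "sorted_wrt vec_before fs" "length fs \<le> l" "2 \<le> l"
    unfolding averages_def by blast
  note k = sorted_wrt_key[OF fs(4), of "\<lambda>f. Min (supp f)", OF vec_before_Min]
  have "vec_sum fs i = (\<Sum>g\<in>set fs. g i)" for i
    unfolding vec_sum_def using k(1) by (simp add: sum_list_distinct_conv_sum_set)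
  moreover have "vec_chain (\<lambda>g. g) (set fs)" unfolding vec_chain_def using k(2) by blast
  ultimately show "\<exists>A. finite A \<and> A \<noteq> {} \<and> A \<subseteq> G \<and> vec_chain (\<lambda>g. g) A \<and> card A \<le> l \<and> 2 \<le> l \<and>
     f = (\<lambda>i. (\<Sum>g\<in>A. g i) / real l)"
    using fs card_length[of fs] by (intro exI[of _ "set fs"]) auto
next
  assume "\<exists>A. finite A \<and> A \<noteq> {} \<and> A \<subseteq> G \<and> vec_chain (\<lambda>g. g) A \<and> card A \<le> l \<and> 2 \<le> l \<and>
     f = (\<lambda>i. (\<Sum>g\<in>A. g i) / real l)"
  then obtain A where A: "finite A" "A \<noteq> {}" "A \<subseteq> G" "vec_chain (\<lambda>g. g) A" "card A \<le> l" "2 \<le> l"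
     "f = (\<lambda>i. (\<Sum>g\<in>A. g i) / real l)" by blast
  obtain fs where fs: "set fs = A" "distinct fs" "sorted_wrt vec_before fs"
  proof (rule ex_sorted_wrt_list[OF A(1), of vec_before "\<lambda>f. Min (supp f)"])
    show "vec_before a b \<or> vec_before b a" if "a \<in> A" "b \<in> A" "a \<noteq> b" for a b
      using A(4) that unfolding vec_chain_def by blast
  qed (use vec_before_Min in auto)
  have "vec_sum fs i = (\<Sum>g\<in>A. g i)" for i
    unfolding vec_sum_def using fs by (simp add: sum_list_distinct_conv_sum_set)
  moreover have "length fs = card A" using fs by (simp add: distinct_card[symmetric])
  ultimately show "f \<in> averages G l"
    unfolding averages_def mem_Collect_eq using A fs by (intro exI[of _ fs]) auto
qed

text \<open>The condition on consecutive members passes to arbitrary pairs since the sizes increase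
  along the sequence.\<close>

lemma very_fast_growing_iff:
  "sorted_wrt prec ps \<longleftrightarrow> very_fast_growing ps"
proof
  assume s: "sorted_wrt prec ps"
  have "sorted_wrt (\<lambda>p q. vec_before (fst p) (fst q)) ps" "sorted_wrt (\<lambda>p q. snd p < snd q) ps"
    by (rule sorted_wrt_mono_rel[OF _ s]; simp add: prec_def)+
  then show "very_fast_growing ps"
    using s unfolding very_fast_growing_def sorted_wrt_map
    by (auto simp: sorted_wrt_iff_nth_less prec_def)
next
  assume v: "very_fast_growing ps"
  show "sorted_wrt prec ps"
    unfolding sorted_wrt_iff_nth_less
  proof (intro allI impI)
    fix i j assume ij: "i < j" "j < length ps"
    have *: "snd (ps ! i) < snd (ps ! j)" if "i < j" "j < length ps" for i j
      using v that unfolding very_fast_growing_def sorted_wrt_iff_nth_less by auto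
    have "Max (supp (fst (ps ! i))) < snd (ps ! Suc i)"
      using v ij unfolding very_fast_growing_def by auto
    also have "\<dots> \<le> snd (ps ! j)"
      using *[of "Suc i" j] ij by (cases "Suc i = j") auto
    finally show "prec (ps ! i) (ps ! j)"
      using v ij *[of i j] unfolding prec_def very_fast_growing_def
      by (auto simp: sorted_wrt_iff_nth_less)
  qed
qed

lemma family_list:
  assumes "family G j P"
  obtains ps where "set ps = P" "distinct ps" "very_fast_growing ps" "admissible j ps" "ps \<noteq> []"
    "family_sum P = vec_sum (map fst ps)"
proof -
  have P: "finite P" "P \<noteq> {}" using assms by (auto simp: family_def)
  obtain ps where ps: "set ps = P" "distinct ps" "sorted_wrt prec ps"
  proof (rule ex_sorted_wrt_list[OF P(1), of prec first_index])
    show "prec a b \<or> prec b a" if "a \<in> P" "b \<in> P" "a \<noteq> b" for a b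
      using familyD(5)[OF assms] that by blast
  qed (use prec_first_index in auto)
  then have v: "very_fast_growing ps" by (simp add: very_fast_growing_iff)
  show thesis
  proof (rule that[of ps])
    show "admissible j ps"
      using v assms ps(1) unfolding admissible_def very_fast_growing_def family_def first_index_def[abs_def] by auto
    show "family_sum P = vec_sum (map fst ps)"
      unfolding family_sum_def vec_sum_def using ps
      by (auto simp: sum_list_distinct_conv_sum_set o_def)
  qed (use ps v P in auto)
qed

lemma family_set:
  assumes "ps \<noteq> []" "\<forall>p\<in>set ps. alpha_average G p" "admissible j ps" "very_fast_growing ps"
  shows "family G j (set ps)" "family_sum (set ps) = vec_sum (map fst ps)"
proof -
  have s: "sorted_wrt prec ps" using assms by (simp add: very_fast_growing_iff)
  note k = sorted_wrt_key[OF s, of first_index, OF prec_first_index]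
  show "family G j (set ps)"
    using assms k(2) unfolding family_def admissible_def first_index_def[abs_def] by auto
  show "family_sum (set ps) = vec_sum (map fst ps)"
    unfolding family_sum_def vec_sum_def using k(1)
    by (auto simp: sum_list_distinct_conv_sum_set o_def)
qed

lemma Wm_Suc:
  "f \<in> Wm n (Suc m) \<longleftrightarrow> f \<in> Wm n m \<or> (\<exists>l. f \<in> averages (Wm n m) l) \<or>
     (\<exists>P. family (Wm n m) n P \<and> f = family_sum P)"
proof -
  have "(\<exists>ps. f = vec_sum (map fst ps) \<and> ps \<noteq> [] \<and> (\<forall>p\<in>set ps. alpha_average (Wm n m) p) \<and>
          admissible n ps \<and> very_fast_growing ps) \<longleftrightarrow> (\<exists>P. family (Wm n m) n P \<and> f = family_sum P)"
  proof
    assume "\<exists>P. family (Wm n m) n P \<and> f = family_sum P"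
    then obtain P where P: "family (Wm n m) n P" "f = family_sum P" by blast
    from family_list[OF P(1)] obtain ps where "set ps = P" "very_fast_growing ps" "admissible n ps"
      "ps \<noteq> []" "family_sum P = vec_sum (map fst ps)" by metis
    then show "\<exists>ps. f = vec_sum (map fst ps) \<and> ps \<noteq> [] \<and> (\<forall>p\<in>set ps. alpha_average (Wm n m) p) \<and>
          admissible n ps \<and> very_fast_growing ps"
      using P by (auto simp: family_def)
  qed (use family_set in metis)
  then show ?thesis by auto
qed

lemma averages_mono: "G \<subseteq> H \<Longrightarrow> f \<in> averages G l \<Longrightarrow> f \<in> averages H l"
  unfolding averages_def by blast

lemma family_mono: "G \<subseteq> H \<Longrightarrow> family G j P \<Longrightarrow> family H j P"
  unfolding family_def alpha_average_def by (meson averages_mono subsetD)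

lemma family_mono_schreier: "family G j P \<Longrightarrow> j \<le> k \<Longrightarrow> family G k P"
  unfolding family_def by (meson schreier_mono)

lemma family_subset:
  assumes P: "family G j P" and Q: "Q \<subseteq> P" "Q \<noteq> {}"
  shows "family G j Q"
proof -
  have "first_index ` Q \<in> schreier j"
    by (rule schreier_subset[OF familyD(6)[OF P]]) (use Q in auto)
  then show ?thesis
    using P Q finite_subset unfolding family_def by (meson subsetD)
qed

lemma Wm_mono: "m \<le> m' \<Longrightarrow> Wm n m \<subseteq> Wm n m'"
  by (rule lift_Suc_mono_le[of "Wm n"]) auto

text \<open>The stages increase, so finitely many functionals share a stage. This is what makes
  \<open>W\<close> itself closed under averages and admissible sums.\<close>

lemma finite_subset_W:
  assumes "finite A" "A \<subseteq> W n"
  obtains m where "A \<subseteq> Wm n m"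
  using assms
proof (induction A arbitrary: thesis)
  case (insert f A)
  obtain m where m: "A \<subseteq> Wm n m" using insert by auto
  obtain k where k: "f \<in> Wm n k" using insert by (auto simp: W_def)
  show ?case
    using insert.prems(1)[of "max m k"] m k Wm_mono[of m "max m k" n] Wm_mono[of k "max m k" n] by auto
qed auto

lemma averages_W: "f \<in> averages (W n) l \<Longrightarrow> f \<in> W n"
proof -
  assume "f \<in> averages (W n) l"
  then obtain A where A: "finite A" "A \<noteq> {}" "A \<subseteq> W n" "vec_chain (\<lambda>g. g) A" "card A \<le> l" "2 \<le> l"
     "f = (\<lambda>i. (\<Sum>g\<in>A. g i) / real l)" unfolding averages_iff by blast
  obtain m where "A \<subseteq> Wm n m" using finite_subset_W A by blast
  then have "f \<in> averages (Wm n m) l" unfolding averages_iff using A by blast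
  then have "f \<in> Wm n (Suc m)" unfolding Wm_Suc by blast
  then show ?thesis unfolding W_def by blast
qed

lemma alpha_average_W: "alpha_average (W n) p \<longleftrightarrow> fst p \<in> averages (W n) (snd p)"
  using averages_W by (auto simp: alpha_average_def)

lemma family_sum_W:
  assumes "family (W n) n P"
  shows "family_sum P \<in> W n"
proof -
  have avg: "\<exists>A. finite A \<and> A \<noteq> {} \<and> A \<subseteq> W n \<and> vec_chain (\<lambda>g. g) A \<and> card A \<le> snd p \<and> 2 \<le> snd p \<and>
     fst p = (\<lambda>i. (\<Sum>g\<in>A. g i) / real (snd p))" if "p \<in> P" for p
    using familyD(4)[OF assms that] unfolding averages_iff .
  then obtain A where A: "\<And>p. p \<in> P \<Longrightarrow> finite (A p) \<and> A p \<noteq> {} \<and> A p \<subseteq> W n \<and>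
     vec_chain (\<lambda>g. g) (A p) \<and> card (A p) \<le> snd p \<and> 2 \<le> snd p \<and>
     fst p = (\<lambda>i. (\<Sum>g\<in>A p. g i) / real (snd p))" by metis
  have "finite (fst ` P \<union> (\<Union>p\<in>P. A p))" using A assms by (auto simp: family_def)
  moreover have "fst ` P \<union> (\<Union>p\<in>P. A p) \<subseteq> W n"
    using A assms by (auto simp: family_def alpha_average_def)
  ultimately obtain m where m: "fst ` P \<union> (\<Union>p\<in>P. A p) \<subseteq> Wm n m"
    by (rule finite_subset_W)
  have "alpha_average (Wm n m) p" if "p \<in> P" for p
    unfolding alpha_average_def averages_iff using m A[OF that] that
    by (intro conjI exI[of _ "A p"]) auto
  then have "family (Wm n m) n P" using assms by (simp add: family_def)
  then have "family_sum P \<in> Wm n (Suc m)" unfolding Wm_Suc by blast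
  then show ?thesis unfolding W_def by blast
qed

lemma family_sum_W_le: "family (W n) j P \<Longrightarrow> j \<le> n \<Longrightarrow> family_sum P \<in> W n"
  using family_sum_W family_mono_schreier by blast

lemma unit_vec_W: "1 \<le> i \<Longrightarrow> unit_vec i \<in> W n"
proof -
  assume "1 \<le> i"
  then have "unit_vec i \<in> Wm n 0" by auto
  then show ?thesis unfolding W_def by blast
qed

text \<open>Induction on the stage, with the stages hidden. The hypothesis is attached to the set
  from which averages and families are drawn; for a sum it is therefore available for the members
  and also for the summands of these averages.\<close>

lemma W_induct [consumes 1, case_names unit neg_unit average sum]:
  assumes f: "f \<in> W n"
    and unit: "\<And>i. 1 \<le> i \<Longrightarrow> Q (unit_vec i)" "\<And>i. 1 \<le> i \<Longrightarrow> Q (\<lambda>j. - unit_vec i j)"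
    and avg: "\<And>f l. f \<in> averages {g \<in> W n. Q g} l \<Longrightarrow> Q f"
    and sum: "\<And>P. family {g \<in> W n. Q g} n P \<Longrightarrow> Q (family_sum P)"
  shows "Q f"
proof -
  have "\<forall>f\<in>Wm n m. Q f" for m
  proof (induction m)
    case 0
    then show ?case using unit by auto
  next
    case (Suc m)
    then have sub: "Wm n m \<subseteq> {g \<in> W n. Q g}" by (auto simp: W_def)
    show ?case
    proof
      fix f assume "f \<in> Wm n (Suc m)"
      then consider "f \<in> Wm n m" | l where "f \<in> averages (Wm n m) l"
        | P where "family (Wm n m) n P" "f = family_sum P" unfolding Wm_Suc by blast
      then show "Q f"
      proof cases
        case 1
        then show ?thesis using Suc by blast
      next
        case 2
        then show ?thesis using averages_mono[OF sub] avg by blast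
      next
        case 3
        then show ?thesis using family_mono[OF sub] sum by blast
      qed
    qed
  qed
  then show ?thesis using f by (auto simp: W_def)
qed

text \<open>Disjoint supports rule out cancellation.\<close>

lemma supp_sum_chain:
  assumes "finite A" "vec_chain v A"
  shows "supp (\<lambda>i. \<Sum>a\<in>A. v a i) = (\<Union>a\<in>A. supp (v a))"
proof
  show "supp (\<lambda>i. \<Sum>a\<in>A. v a i) \<subseteq> (\<Union>a\<in>A. supp (v a))"
    by (auto simp: supp_def intro: ccontr)
  show "(\<Union>a\<in>A. supp (v a)) \<subseteq> supp (\<lambda>i. \<Sum>a\<in>A. v a i)"
  proof
    fix i assume "i \<in> (\<Union>a\<in>A. supp (v a))"
    then obtain a where a: "a \<in> A" "v a i \<noteq> 0" by (auto simp: supp_def)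
    have "v b i = 0" if "b \<in> A - {a}" for b
    proof -
      have "vec_before (v a) (v b) \<or> vec_before (v b) (v a)"
        using assms(2) that a(1) unfolding vec_chain_def by blast
      then show ?thesis using vec_before_disjoint a(2) by blast
    qed
    then have "(\<Sum>b\<in>A. v b i) = v a i"
      using assms(1) a(1) by (simp add: sum.remove)
    with a show "i \<in> supp (\<lambda>i. \<Sum>a\<in>A. v a i)" by (simp add: supp_def)
  qed
qed

lemma supp_divide: "c \<noteq> 0 \<Longrightarrow> supp (\<lambda>i. f i / c) = supp f" for c :: real
  by (simp add: supp_def)

lemma supp_average:
  assumes "finite A" "vec_chain (\<lambda>g. g) A" "2 \<le> l"
  shows "supp (\<lambda>i. (\<Sum>g\<in>A. g i) / real l) = (\<Union>g\<in>A. supp g)"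
  using supp_sum_chain[OF assms(1,2)] assms(3) by (simp add: supp_divide)

lemma family_chain: "family G j P \<Longrightarrow> vec_chain fst P"
  using familyD(5)[of G j P] unfolding vec_chain_def prec_def by blast

lemma supp_family_sum: "family G j P \<Longrightarrow> supp (family_sum P) = (\<Union>p\<in>P. supp (fst p))"
  unfolding family_sum_def by (rule supp_sum_chain[OF _ family_chain]) (auto simp: family_def)

lemma W_c00: "f \<in> W n \<Longrightarrow> f \<in> c00 \<and> supp f \<noteq> {}"
proof (induction rule: W_induct)
  case (average f l)
  then obtain A where A: "finite A" "A \<noteq> {}" "A \<subseteq> {g \<in> W n. g \<in> c00 \<and> supp g \<noteq> {}}"
    "vec_chain (\<lambda>g. g) A" "2 \<le> l" and f: "f = (\<lambda>i. (\<Sum>g\<in>A. g i) / real l)"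
    unfolding averages_iff by blast
  have "finite (\<Union>g\<in>A. supp g)" using A by (auto simp: c00_def)
  moreover have "f 0 = 0" unfolding f using A(3) by (auto simp: c00_def intro!: sum.neutral)
  moreover have "(\<Union>g\<in>A. supp g) \<noteq> {}" using A by blast
  ultimately show ?case unfolding c00_def mem_Collect_eq
    using supp_average[OF A(1,4,5)] f by simp
next
  case (sum P)
  have P: "finite P" "P \<noteq> {}" "\<And>p. p \<in> P \<Longrightarrow> fst p \<in> c00 \<and> supp (fst p) \<noteq> {}"
    using sum by (auto simp: family_def alpha_average_def)
  have "finite (\<Union>p\<in>P. supp (fst p))" using P by (auto simp: c00_def)
  moreover have "family_sum P 0 = 0" unfolding family_sum_def using P(3) by (auto simp: c00_def intro!: sum.neutral)
  moreover have "(\<Union>p\<in>P. supp (fst p)) \<noteq> {}" using P by blast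
  ultimately show ?case unfolding c00_def using supp_family_sum[OF sum] by simp
qed (auto simp: c00_def supp_def unit_vec_def)

lemma W_supp: "f \<in> W n \<Longrightarrow> finite (supp f)" "f \<in> W n \<Longrightarrow> supp f \<noteq> {}" "f \<in> W n \<Longrightarrow> 0 \<notin> supp f"
  using W_c00 by (auto simp: c00_def supp_def)

section \<open>Restriction of functionals to sets of coordinates\<close>

definition restr :: "nat set \<Rightarrow> (nat \<Rightarrow> real) \<Rightarrow> nat \<Rightarrow> real" where
  "restr E f = (\<lambda>i. if i \<in> E then f i else 0)"

lemma supp_restr [simp]: "supp (restr E f) = supp f \<inter> E"
  by (auto simp: supp_def restr_def)

lemma restr_zero: "supp f \<inter> E = {} \<Longrightarrow> restr E f = (\<lambda>i. 0)"
  by (auto simp: supp_def restr_def fun_eq_iff)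

lemma vec_before_restr:
  "vec_before f g \<Longrightarrow> supp f \<inter> E \<noteq> {} \<Longrightarrow> supp g \<inter> E \<noteq> {} \<Longrightarrow> vec_before (restr E f) (restr E g)"
  using vec_beforeD[of f g] by (intro vec_beforeI) (auto simp: vec_before_def set_before_def)

text \<open>The size survives although summands may disappear: a size only has to bound the number
  of summands.\<close>

lemma restr_average:
  assumes f: "f \<in> averages G l" and E: "supp f \<inter> E \<noteq> {}"
    and H: "\<And>g. g \<in> G \<Longrightarrow> supp g \<inter> E \<noteq> {} \<Longrightarrow> restr E g \<in> H"
  shows "restr E f \<in> averages H l"
proof -
  obtain A where A: "finite A" "A \<noteq> {}" "A \<subseteq> G" "vec_chain (\<lambda>g. g) A" "card A \<le> l" "2 \<le> l"
     "f = (\<lambda>i. (\<Sum>g\<in>A. g i) / real l)" using f unfolding averages_iff by blast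
  define A1 where "A1 = {g \<in> A. supp g \<inter> E \<noteq> {}}"
  have fin: "finite A1" and sub: "A1 \<subseteq> A" using A by (auto simp: A1_def)
  have ch: "vec_before (restr E g) (restr E h) \<or> vec_before (restr E h) (restr E g)"
    if "g \<in> A1" "h \<in> A1" "g \<noteq> h" for g h
    using that A(4) vec_before_restr unfolding vec_chain_def A1_def by blast
  then have inj: "inj_on (restr E) A1" unfolding inj_on_def using vec_before_Min by (metis less_irrefl)
  show ?thesis unfolding averages_iff
  proof (intro exI[of _ "restr E ` A1"] conjI)
    have "supp f = (\<Union>g\<in>A. supp g)" unfolding A(7) using supp_average A by blast
    then show "restr E ` A1 \<noteq> {}" using E by (auto simp: A1_def)
    show "restr E ` A1 \<subseteq> H" using H A(3) by (auto simp: A1_def)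
    show "vec_chain (\<lambda>g. g) (restr E ` A1)" unfolding vec_chain_def using ch by blast
    show "card (restr E ` A1) \<le> l"
      using card_image_le[OF fin, of "restr E"] card_mono[OF A(1) sub] A(5) by linarith
    show "restr E f = (\<lambda>i. (\<Sum>g\<in>restr E ` A1. g i) / real l)"
    proof
      fix i
      have "(\<Sum>g\<in>restr E ` A1. g i) = (\<Sum>g\<in>A1. restr E g i)" by (simp add: sum.reindex[OF inj])
      also have "\<dots> = (\<Sum>g\<in>A. restr E g i)"
        using A(1) by (intro sum.mono_neutral_left) (auto simp: A1_def restr_zero)
      finally show "restr E f i = (\<Sum>g\<in>restr E ` A1. g i) / real l" by (simp add: A(7) restr_def)
    qed
  qed (use fin A in auto)
qed

text \<open>Restriction moves first indices to the right, which is admissible by spreading, and can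
  only lower the maxima that the sizes must exceed.\<close>

lemma restr_fam:
  assumes P: "family G j P" and G: "G \<subseteq> W n"
    and H: "\<And>g. g \<in> G \<Longrightarrow> supp g \<inter> E \<noteq> {} \<Longrightarrow> restr E g \<in> H"
    and P1: "P1 = (\<lambda>p. (restr E (fst p), snd p)) ` {p \<in> P. supp (fst p) \<inter> E \<noteq> {}}" and ne: "P1 \<noteq> {}"
  shows "family H j P1" and "family_sum P1 = restr E (family_sum P)"
proof -
  define r where "r = (\<lambda>p :: (nat \<Rightarrow> real) \<times> nat. (restr E (fst p), snd p))"
  define Q where "Q = {p \<in> P. supp (fst p) \<inter> E \<noteq> {}}"
  have P1: "P1 = r ` Q" by (simp add: P1 r_def Q_def)
  have fin: "finite Q" "finite P" using P by (auto simp: Q_def family_def)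
  have fs: "finite (supp (fst p))" if "p \<in> P" for p
    using familyD(3)[OF P that] G W_supp(1) by blast
  have pr: "prec (r p) (r q)" if "p \<in> Q" "q \<in> Q" "prec p q" for p q
  proof -
    have "Max (supp (fst p) \<inter> E) \<le> Max (supp (fst p))"
      using that fs by (intro Max_mono) (auto simp: Q_def)
    then show ?thesis using that vec_before_restr[of "fst p" "fst q" E]
      unfolding prec_def r_def Q_def by auto
  qed
  have ch: "prec p q \<or> prec q p" if "p \<in> Q" "q \<in> Q" "p \<noteq> q" for p q
    using familyD(5)[OF P] that unfolding Q_def by blast
  have inj: "inj_on r Q"
    using ch pr prec_first_index unfolding inj_on_def by (metis less_irrefl)
  have injm: "inj_on first_index Q"
    using ch prec_first_index unfolding inj_on_def by (metis less_irrefl)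
  have "(first_index \<circ> r) ` Q \<in> schreier j"
  proof (rule schreier_spread_rel[of "first_index ` P" j Q first_index])
    show "first_index ` P \<in> schreier j" using P by (simp add: family_def)
    show "first_index q \<le> (first_index \<circ> r) q" if "q \<in> Q" for q
      using that fs by (auto simp: first_index_def r_def Q_def intro!: Min_antimono)
    show "(first_index \<circ> r) p < (first_index \<circ> r) q" if "p \<in> Q" "q \<in> Q" "first_index p < first_index q" for p q
      using ch[of p q] pr prec_first_index that by fastforce
  qed (use ne P1 injm in \<open>auto simp: Q_def\<close>)
  moreover have "alpha_average H (r p)" if "p \<in> Q" for p
    using that P H restr_average[of "fst p" G "snd p" E H]
    unfolding alpha_average_def family_def Q_def r_def by auto
  ultimately show "family H j P1"
    unfolding family_def P1 using fin ne P1 ch pr by (auto simp: image_comp) metis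
  show "family_sum P1 = restr E (family_sum P)"
  proof
    fix i
    have "family_sum P1 i = (\<Sum>p\<in>Q. restr E (fst p) i)"
      unfolding family_sum_def P1 sum.reindex[OF inj] by (simp add: r_def)
    also have "\<dots> = (\<Sum>p\<in>P. restr E (fst p) i)"
      using fin by (intro sum.mono_neutral_left) (auto simp: Q_def restr_zero)
    finally show "family_sum P1 i = restr E (family_sum P) i" by (simp add: family_sum_def restr_def)
  qed
qed

lemma restr_W: "f \<in> W n \<Longrightarrow> supp f \<inter> E \<noteq> {} \<Longrightarrow> restr E f \<in> W n"
proof (induction rule: W_induct)
  case (unit i)
  then have "restr E (unit_vec i) = unit_vec i"
    by (auto simp: restr_def unit_vec_def supp_def fun_eq_iff split: if_splits)
  then show ?case using unit unit_vec_W by simp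
next
  case (neg_unit i)
  then have "restr E (\<lambda>j. - unit_vec i j) = (\<lambda>j. - unit_vec i j)"
    by (auto simp: restr_def unit_vec_def supp_def fun_eq_iff split: if_splits)
  then show ?case using neg_unit unit_vec_W W_uminus by metis
next
  case (average f l)
  have "restr E f \<in> averages (W n) l" by (rule restr_average[OF average]) auto
  then show ?case by (rule averages_W)
next
  case (sum P)
  let ?P1 = "(\<lambda>p. (restr E (fst p), snd p)) ` {p \<in> P. supp (fst p) \<inter> E \<noteq> {}}"
  have "\<exists>p\<in>P. supp (fst p) \<inter> E \<noteq> {}" using sum(2) unfolding supp_family_sum[OF sum(1)] by blast
  then have "?P1 \<noteq> {}" by blast
  have sub: "{g \<in> W n. supp g \<inter> E \<noteq> {} \<longrightarrow> restr E g \<in> W n} \<subseteq> W n" by blast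
  have A: "family (W n) n ?P1" by (rule restr_fam(1)[OF sum(1) sub _ refl \<open>?P1 \<noteq> {}\<close>]) blast
  have B: "family_sum ?P1 = restr E (family_sum P)"
    by (rule restr_fam(2)[OF sum(1) sub _ refl \<open>?P1 \<noteq> {}\<close>, of "W n"]) blast
  show ?case using family_sum_W[OF A] unfolding B .
qed

section \<open>Estimates for averages of successive vectors\<close>

definition lin_comb :: "'b set \<Rightarrow> ('b \<Rightarrow> real) \<Rightarrow> ('b \<Rightarrow> nat \<Rightarrow> real) \<Rightarrow> nat \<Rightarrow> real" where
  "lin_comb J c x = (\<lambda>i. \<Sum>j\<in>J. c j * x j i)"

lemma supp_lin_comb: "supp (lin_comb J c x) \<subseteq> (\<Union>j\<in>J. supp (x j))"
  by (auto simp: supp_def lin_comb_def intro: ccontr)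

lemma lin_comb_c00: "finite J \<Longrightarrow> (\<And>j. j \<in> J \<Longrightarrow> x j \<in> c00) \<Longrightarrow> lin_comb J c x \<in> c00"
  using finite_subset[OF supp_lin_comb[of J c x]] by (auto simp: c00_def) (auto simp: lin_comb_def)

lemma pairing_sum_left: "pairing (\<lambda>i. \<Sum>a\<in>A. v a i) x = (\<Sum>a\<in>A. pairing (v a) x)"
  unfolding pairing_def by (subst sum.swap) (simp add: sum_distrib_right)

lemma pairing_divide_left: "pairing (\<lambda>i. f i / c) x = pairing f x / c"
  unfolding pairing_def by (simp add: sum_divide_distrib)

lemma pairing_uminus_left: "pairing (\<lambda>i. - f i) x = - pairing f x"
  unfolding pairing_def by (simp add: sum_negf)

lemma pairing_family_sum: "pairing (family_sum P) x = (\<Sum>p\<in>P. pairing (fst p) x)"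
  unfolding family_sum_def by (rule pairing_sum_left)

lemma pairing_zero [simp]: "pairing (\<lambda>i. 0) x = 0" "pairing f (\<lambda>i. 0) = 0"
  by (simp_all add: pairing_def supp_def)

lemma pairing_lin_comb:
  assumes "finite J" "\<And>j. j \<in> J \<Longrightarrow> x j \<in> c00"
  shows "pairing f (lin_comb J c x) = (\<Sum>j\<in>J. c j * pairing f (x j))"
  using assms
proof (induction J rule: finite_induct)
  case empty
  then show ?case by (simp add: lin_comb_def)
next
  case (insert j J)
  have "lin_comb (insert j J) c x = (\<lambda>i. c j * x j i + lin_comb J c x i)"
    using insert by (simp add: lin_comb_def)
  moreover have "(\<lambda>i. c j * x j i) \<in> c00"
  proof -
    have "(\<lambda>i. c j * x j i) = lin_comb {j} c x" by (simp add: lin_comb_def)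
    then show ?thesis using lin_comb_c00[of "{j}" x c] insert by simp
  qed
  moreover have "lin_comb J c x \<in> c00" using insert by (intro lin_comb_c00) auto
  ultimately show ?case using insert by (simp add: pairing_add pairing_scale)
qed

lemma pairing_disjoint: "supp f \<inter> supp x = {} \<Longrightarrow> pairing f x = 0"
  unfolding pairing_def by (intro sum.neutral) (auto simp: supp_def)

lemma pairing_restr: "supp x \<subseteq> E \<Longrightarrow> pairing (restr E f) x = pairing f x"
  unfolding pairing_def by (intro sum.cong) (auto simp: restr_def)

lemma norm_W_leI: "(\<And>f. f \<in> W n \<Longrightarrow> pairing f x \<le> c) \<Longrightarrow> norm_W n x \<le> c"
  unfolding norm_W_def using W_nonempty by (intro cSUP_least)

lemma pairing_le_norm: "f \<in> W n \<Longrightarrow> pairing f x \<le> norm_W n x"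
  using pairing_le_norm_W[of f n x] by simp

lemma norm_W_nonneg: "0 \<le> norm_W n x"
  using W_nonempty[of n] pairing_le_norm_W[of _ n x] by (meson abs_ge_zero ex_in_conv order_trans)

lemma less_norm_W:
  assumes "c < norm_W n x"
  obtains f where "f \<in> W n" "c < pairing f x"
proof -
  have "\<not> (\<forall>f\<in>W n. pairing f x \<le> c)"
    using norm_W_leI[of n x c] assms by fastforce
  then show thesis using that by (auto simp: not_le)
qed

lemma norm_W_lin_comb:
  assumes "finite J" "\<And>j. j \<in> J \<Longrightarrow> x j \<in> c00"
  shows "norm_W n (lin_comb J c x) \<le> (\<Sum>j\<in>J. \<bar>c j\<bar> * norm_W n (x j))"
proof (rule norm_W_leI)
  fix f assume f: "f \<in> W n"
  have "c j * pairing f (x j) \<le> \<bar>c j\<bar> * norm_W n (x j)" for j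
  proof -
    have "c j * pairing f (x j) \<le> \<bar>c j\<bar> * \<bar>pairing f (x j)\<bar>"
      by (metis abs_ge_self abs_mult)
    also have "\<dots> \<le> \<bar>c j\<bar> * norm_W n (x j)"
      using pairing_le_norm_W[OF f] by (intro mult_left_mono) auto
    finally show ?thesis .
  qed
  then show "pairing f (lin_comb J c x) \<le> (\<Sum>j\<in>J. \<bar>c j\<bar> * norm_W n (x j))"
    using assms by (simp add: pairing_lin_comb sum_mono)
qed

lemma norm_W_average_le:
  assumes "\<And>i. i < N \<Longrightarrow> x i \<in> c00 \<and> norm_W n (x i) \<le> 1"
  shows "norm_W n (lin_comb {..<N} (\<lambda>_. 1 / real N) x) \<le> 1"
proof -
  have "norm_W n (lin_comb {..<N} (\<lambda>_. 1 / real N) x) \<le> (\<Sum>i<N. \<bar>1 / real N\<bar> * norm_W n (x i))"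
    by (rule norm_W_lin_comb) (use assms in auto)
  also have "\<dots> \<le> (\<Sum>i<N. (1 / real N) * 1)"
    using assms norm_W_nonneg by (intro sum_mono mult_mono) auto
  also have "\<dots> \<le> 1" by (cases "N = 0") auto
  finally show ?thesis .
qed

lemma pairing_unit_vec:
  assumes "x \<in> c00"
  shows "pairing (unit_vec i) x = x i"
proof -
  have "pairing (unit_vec i) x = (\<Sum>j\<in>insert i (supp x). unit_vec i j * x j)"
    by (rule pairing_superset) (use assms in \<open>auto simp: c00_def\<close>)
  also have "\<dots> = (\<Sum>j\<in>{i}. unit_vec i j * x j)"
    by (rule sum.mono_neutral_right) (use assms in \<open>auto simp: c00_def unit_vec_def\<close>)
  finally show ?thesis by (simp add: unit_vec_def)
qed

lemma coord_le_norm_W: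
  assumes "x \<in> c00"
  shows "\<bar>x i\<bar> \<le> norm_W n x"
proof (cases "i = 0")
  case True
  then show ?thesis using assms norm_W_nonneg by (simp add: c00_def)
next
  case False
  then have "unit_vec i \<in> W n" by (simp add: unit_vec_W)
  from pairing_le_norm_W[OF this, of x] show ?thesis using assms by (simp add: pairing_unit_vec)
qed

text \<open>In contrast to \<open>vec_before\<close>, this tolerates vectors with empty
  support.\<close>

definition successive :: "nat set \<Rightarrow> (nat \<Rightarrow> nat \<Rightarrow> real) \<Rightarrow> bool" where
  "successive I x \<longleftrightarrow> (\<forall>i\<in>I. \<forall>i'\<in>I. i < i' \<longrightarrow> (\<forall>u\<in>supp (x i). \<forall>v\<in>supp (x i'). u < v))"

lemma successiveD:
  "successive I x \<Longrightarrow> i \<in> I \<Longrightarrow> i' \<in> I \<Longrightarrow> i < i' \<Longrightarrow> u \<in> supp (x i) \<Longrightarrow> v \<in> supp (x i') \<Longrightarrow> u < v"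
  unfolding successive_def by blast

text \<open>Two successive sequences interlace, so their incidences form a staircase rather than a
  full rectangle.\<close>

lemma incidence_count:
  assumes A: "finite A" "vec_chain (\<lambda>g. g) A" and x: "successive {..<N} x"
    and T: "T = {(g, i). g \<in> A \<and> i < N \<and> supp g \<inter> supp (x i) \<noteq> {}}"
  shows "finite T \<and> card T \<le> card A + N"
proof -
  \<comment> \<open>Charge an incidence to the vector if the functional goes on to a later vector,
    otherwise to the functional. A functional has one last vector, and of the functionals meeting
    \<open>x i\<close> at most one continues beyond it.\<close>
  define \<phi> where "\<phi> = (\<lambda>(g, i). if \<exists>i'>i. (g, i') \<in> T then Inr i else Inl g)"
  have "\<phi> t \<in> A <+> {..<N}" if "t \<in> T" for t
    using that unfolding \<phi>_def T by (simp split: prod.splits) (blast intro: InlI InrI)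
  then have "\<phi> ` T \<subseteq> A <+> {..<N}" by blast
  moreover have "inj_on \<phi> T"
  proof (rule inj_onI)
    fix s t assume st: "s \<in> T" "t \<in> T" "\<phi> s = \<phi> t"
    obtain g i h k where s: "s = (g, i)" and t: "t = (h, k)" by (cases s, cases t)
    show "s = t"
    proof (cases "\<exists>i'>i. (g, i') \<in> T")
      case False
      then have "g = h" "\<not> (\<exists>i'>k. (h, i') \<in> T)"
        using st by (auto simp: \<phi>_def s t split: if_splits)
      with False st show ?thesis unfolding s t by (metis linorder_neqE_nat)
    next
      case True
      then have k: "i = k" and tk: "\<exists>i'>i. (h, i') \<in> T"
        using st by (auto simp: \<phi>_def s t split: if_splits)
      have no: False if gh: "vec_before a b" "(a, i) \<in> T" "(b, i) \<in> T" "\<exists>i'>i. (a, i') \<in> T" for a b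
      proof -
        obtain i' u v where "i' > i" "i' < N" "u \<in> supp a" "u \<in> supp (x i')" "v \<in> supp b" "v \<in> supp (x i)" "i < N"
          using gh by (auto simp: T)
        then have "v < u" using successiveD[OF x, of i i' v u] by auto
        moreover have "u < v" using vec_beforeD gh(1) \<open>u \<in> supp a\<close> \<open>v \<in> supp b\<close> by blast
        ultimately show False by simp
      qed
      have "g = h"
      proof (rule ccontr)
        assume "g \<noteq> h"
        then have "vec_before g h \<or> vec_before h g"
          using A(2) st unfolding vec_chain_def s t by (auto simp: T)
        then show False using no[of g h] no[of h g] st True tk k unfolding s t by blast
      qed
      then show ?thesis using k s t by simp
    qed
  qed
  moreover have "finite (A <+> {..<N})" using A by simp
  ultimately have "card T \<le> card (A <+> {..<N})" by (intro card_inj_on_le)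
  moreover have "finite T"
    by (rule finite_subset[of _ "A \<times> {..<N}"]) (use A T in auto)
  ultimately show ?thesis using A by (simp add: card_Plus)
qed

text \<open>There are at most \<open>s + N\<close> incidences, each contributing at most 1 / (s
  N).\<close>

lemma average_on_average:
  assumes \<alpha>: "\<alpha> \<in> averages (W n) s" and N: "1 \<le> N"
    and x: "\<And>i. i < N \<Longrightarrow> x i \<in> c00 \<and> norm_W n (x i) \<le> 1" and succ: "successive {..<N} x"
  shows "\<bar>pairing \<alpha> (lin_comb {..<N} (\<lambda>_. 1 / real N) x)\<bar> \<le> 1 / real s + 1 / real N"
proof -
  obtain A where A: "finite A" "A \<noteq> {}" "A \<subseteq> W n" "vec_chain (\<lambda>g. g) A" "card A \<le> s" "2 \<le> s"
     "\<alpha> = (\<lambda>i. (\<Sum>g\<in>A. g i) / real s)" using \<alpha> unfolding averages_iff by blast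
  define T where "T = {(g, i). g \<in> A \<and> i < N \<and> supp g \<inter> supp (x i) \<noteq> {}}"
  have T: "finite T" "card T \<le> card A + N" using incidence_count[OF A(1,4) succ T_def] by auto
  have "pairing \<alpha> (lin_comb {..<N} (\<lambda>_. 1 / real N) x) =
      (\<Sum>g\<in>A. \<Sum>i<N. (1 / real N) * pairing g (x i)) / real s"
  proof -
    have "pairing g (lin_comb {..<N} (\<lambda>_. 1 / real N) x) = (\<Sum>i<N. (1 / real N) * pairing g (x i))" for g
      by (rule pairing_lin_comb) (use x in auto)
    then show ?thesis by (simp add: A(7) pairing_divide_left pairing_sum_left)
  qed
  also have "(\<Sum>g\<in>A. \<Sum>i<N. (1 / real N) * pairing g (x i)) =
      (\<Sum>(g, i)\<in>A \<times> {..<N}. (1 / real N) * pairing g (x i))"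
    by (simp add: sum.cartesian_product)
  also have "\<dots> = (\<Sum>(g, i)\<in>T. (1 / real N) * pairing g (x i))"
    using A(1) by (intro sum.mono_neutral_right) (auto simp: T_def pairing_disjoint)
  finally have eq: "pairing \<alpha> (lin_comb {..<N} (\<lambda>_. 1 / real N) x) =
      (\<Sum>(g, i)\<in>T. (1 / real N) * pairing g (x i)) / real s" .
  have "\<bar>\<Sum>(g, i)\<in>T. (1 / real N) * pairing g (x i)\<bar> \<le> (\<Sum>(g, i)\<in>T. 1 / real N)"
  proof (rule order_trans[OF sum_abs], rule sum_mono)
    fix t assume t: "t \<in> T"
    obtain g i where gi: "t = (g, i)" by (cases t)
    have "\<bar>pairing g (x i)\<bar> \<le> 1"
      using pairing_le_norm_W[of g n "x i"] x[of i] A(3) t by (auto simp: T_def gi)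
    then show "\<bar>case t of (g, i) \<Rightarrow> 1 / real N * pairing g (x i)\<bar> \<le> (case t of (g, i) \<Rightarrow> 1 / real N)"
      by (simp add: gi abs_mult divide_right_mono)
  qed
  also have "\<dots> = real (card T) / real N" by (simp add: case_prod_beta)
  also have "\<dots> \<le> real (s + N) / real N"
    using T A(5) by (intro divide_right_mono) auto
  finally have "\<bar>pairing \<alpha> (lin_comb {..<N} (\<lambda>_. 1 / real N) x)\<bar> \<le> real (s + N) / real N / real s"
    unfolding eq abs_divide abs_of_nat by (rule divide_right_mono) simp
  also have "\<dots> = 1 / real s + 1 / real N" using A(6) N by (simp add: field_simps)
  finally show ?thesis .
qed

lemma family_supp:
  assumes "family (W n) j P" "p \<in> P"
  shows "finite (supp (fst p))" "supp (fst p) \<noteq> {}"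
  using W_supp familyD(3)[OF assms] by blast+

text \<open>The first indices of \<open>P\<close> split into S_j sets, at most as many as their
  minimum and hence at most \<open>r\<close>. Each of these cuts out of \<open>Q\<close> an S_j
  family, which contributes at most \<open>\<epsilon>\<close>.\<close>

lemma family_tail:
  assumes P: "family (W n) (Suc j) P" and Q: "Q \<subseteq> P" and r: "Min (first_index ` P) \<le> r" and \<epsilon>: "0 \<le> \<epsilon>"
    and x: "\<And>R. family (W n) j R \<Longrightarrow> \<forall>p\<in>R. l < snd p \<Longrightarrow> \<bar>pairing (family_sum R) x\<bar> \<le> \<epsilon>"
    and size: "\<forall>p\<in>Q. l < snd p"
  shows "\<bar>\<Sum>p\<in>Q. pairing (fst p) x\<bar> \<le> real r * \<epsilon>"
proof -
  obtain \<G> where g: "finite \<G>" "\<G> \<noteq> {}" "\<G> \<subseteq> schreier j" "sets_chain \<G>"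
      "card \<G> \<le> Min (\<Union>\<G>)" "first_index ` P = \<Union>\<G>" using familyD(6)[OF P] unfolding schreier_Suc by auto
  define R where "R G = {p \<in> Q. first_index p \<in> G}" for G
  have fin: "finite Q" using Q familyD(1)[OF P] finite_subset by blast
  have U: "Q = (\<Union>G\<in>\<G>. R G)"
  proof
    show "Q \<subseteq> (\<Union>G\<in>\<G>. R G)"
    proof
      fix p assume p: "p \<in> Q"
      then have "first_index p \<in> \<Union>\<G>" using Q unfolding g(6)[symmetric] by blast
      then show "p \<in> (\<Union>G\<in>\<G>. R G)" using p by (auto simp: R_def)
    qed
  qed (auto simp: R_def)
  have "(\<Sum>p\<in>Q. pairing (fst p) x) = (\<Sum>G\<in>\<G>. \<Sum>p\<in>R G. pairing (fst p) x)"
  proof (subst U, rule sum.UNION_disjoint)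
    show "\<forall>G\<in>\<G>. \<forall>H\<in>\<G>. G \<noteq> H \<longrightarrow> R G \<inter> R H = {}"
    proof (intro ballI impI equals0I)
      fix G H p assume "G \<in> \<G>" "H \<in> \<G>" "G \<noteq> H" "p \<in> R G \<inter> R H"
      then have "set_before G H \<or> set_before H G" "first_index p \<in> G" "first_index p \<in> H"
        using g(4) by (auto simp: sets_chain_def R_def)
      then show False using set_beforeD by blast
    qed
  qed (use g fin in \<open>auto simp: R_def\<close>)
  also have "\<bar>\<dots>\<bar> \<le> (\<Sum>G\<in>\<G>. \<epsilon>)"
  proof (rule order_trans[OF sum_abs], rule sum_mono)
    fix G assume G: "G \<in> \<G>"
    show "\<bar>\<Sum>p\<in>R G. pairing (fst p) x\<bar> \<le> \<epsilon>"
    proof (cases "R G = {}")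
      case True
      then show ?thesis using \<epsilon> by simp
    next
      case False
      have sub: "R G \<subseteq> P" using Q by (auto simp: R_def)
      have "first_index ` R G \<in> schreier j"
        by (rule schreier_subset[of G]) (use g G False in \<open>auto simp: R_def\<close>)
      then have "family (W n) j (R G)"
        using family_subset[OF P sub False] by (simp add: family_def)
      from x[OF this] show ?thesis using size by (simp add: pairing_family_sum R_def)
    qed
  qed
  also have "\<dots> = real (card \<G>) * \<epsilon>" by simp
  also have "\<dots> \<le> real r * \<epsilon>"
    using g r \<epsilon> by (intro mult_right_mono) auto
  finally show ?thesis .
qed

text \<open>All members of \<open>Q\<close> that touch \<open>x\<close>, except the first one, have size larger than \<open>Min (supp x)\<close>.\<close>

lemma family_on_vector:
  assumes P: "family (W n) (Suc j) P" and Q: "Q \<subseteq> P" and r: "Min (first_index ` P) \<le> r"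
    and \<epsilon>: "0 \<le> \<epsilon>" and \<tau>: "0 \<le> \<tau>" and x0: "x \<in> c00"
    and x: "\<And>R. family (W n) j R \<Longrightarrow> \<forall>p\<in>R. Min (supp x) < snd p \<Longrightarrow> \<bar>pairing (family_sum R) x\<bar> \<le> \<epsilon>"
    and first: "\<And>p. p \<in> Q \<Longrightarrow> \<bar>pairing (fst p) x\<bar> \<le> \<tau>"
  shows "\<bar>\<Sum>p\<in>Q. pairing (fst p) x\<bar> \<le> \<tau> + real r * \<epsilon>"
proof -
  define T where "T = {p \<in> Q. supp (fst p) \<inter> supp x \<noteq> {}}"
  have fin: "finite Q" using Q familyD(1)[OF P] finite_subset by blast
  have eq: "(\<Sum>p\<in>Q. pairing (fst p) x) = (\<Sum>p\<in>T. pairing (fst p) x)"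
    using fin by (intro sum.mono_neutral_right) (auto simp: T_def pairing_disjoint)
  show ?thesis
  proof (cases "T = {}")
    case True
    then show ?thesis using eq \<tau> \<epsilon> by simp
  next
    case False
    have finT: "finite T" using fin by (simp add: T_def)
    obtain p0 where p0: "p0 \<in> T" "\<And>p. p \<in> T \<Longrightarrow> first_index p0 \<le> first_index p"
      using False finT by (metis arg_min_if_finite(1) arg_min_least)
    obtain u where u: "u \<in> supp (fst p0)" "u \<in> supp x" using p0 by (auto simp: T_def)
    \<comment> \<open>By very fast growth the size of \<open>p\<close> exceeds the maximum of the
      support of \<open>p0\<close>, which is at or beyond the point \<open>u\<close> of
      \<open>supp x\<close>.\<close>
    have "\<forall>p\<in>T - {p0}. Min (supp x) < snd p"
    proof
      fix p assume p: "p \<in> T - {p0}"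
      then have "prec p0 p"
        using familyD(5)[OF P, of p0 p] p0 Q prec_first_index[of p p0] unfolding T_def by fastforce
      moreover have "u \<le> Max (supp (fst p0))"
        using family_supp(1)[OF P, of p0] u p0 Q by (auto simp: T_def)
      moreover have "Min (supp x) \<le> u" using u x0 by (auto simp: c00_def)
      ultimately show "Min (supp x) < snd p" unfolding prec_def by linarith
    qed
    then have "\<bar>\<Sum>p\<in>T - {p0}. pairing (fst p) x\<bar> \<le> real r * \<epsilon>"
      using Q by (intro family_tail[OF P _ r \<epsilon> x]) (auto simp: T_def)
    moreover have "(\<Sum>p\<in>T. pairing (fst p) x) = pairing (fst p0) x + (\<Sum>p\<in>T - {p0}. pairing (fst p) x)"
      using finT p0 by (simp add: sum.remove)
    moreover have "\<bar>pairing (fst p0) x\<bar> \<le> \<tau>" using first p0 by (auto simp: T_def)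
    ultimately show ?thesis unfolding eq by linarith
  qed
qed

text \<open>Any point already met by the functional bounds the number of its S_j pieces; this
  supplies \<open>r\<close> in the two preceding estimates.\<close>

lemma Min_first_index_le:
  assumes P: "family (W n) j P" and u: "u \<in> supp (family_sum P)"
  shows "Min (first_index ` P) \<le> u"
proof -
  obtain p where p: "p \<in> P" "u \<in> supp (fst p)" using u supp_family_sum[OF P] by auto
  have "Min (first_index ` P) \<le> first_index p" using p familyD(1)[OF P] by auto
  also have "\<dots> \<le> u" using p family_supp(1)[OF P] by (auto simp: first_index_def)
  finally show ?thesis .
qed

text \<open>Averaging gains control of one more Schreier level. The first vector met costs its norm,
  that is 1 / N. A point \<open>u\<close> of its support bounds the number of S_j pieces of
  \<open>P\<close>, which is harmless on later vectors because their \<open>\<epsilon> i\<close> is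
  small against 1 / u. On each later vector \<open>\<tau>\<close> pays for the first member.\<close>

lemma family_on_average:
  assumes P: "family (W n) (Suc j) P" and j: "Suc j \<le> n" and N: "1 \<le> N"
    and x: "\<And>i. i < N \<Longrightarrow> x i \<in> c00 \<and> norm_W n (x i) \<le> 1" and \<tau>: "0 \<le> \<tau>" and \<delta>: "0 \<le> \<delta>"
    and first: "\<And>p i. p \<in> P \<Longrightarrow> i < N \<Longrightarrow> \<bar>pairing (fst p) (x i)\<bar> \<le> \<tau>"
    and \<epsilon>: "\<And>i. i < N \<Longrightarrow> 0 \<le> \<epsilon> i"
    and rest: "\<And>i R. i < N \<Longrightarrow> family (W n) j R \<Longrightarrow> \<forall>p\<in>R. Min (supp (x i)) < snd p \<Longrightarrow>
        \<bar>pairing (family_sum R) (x i)\<bar> \<le> \<epsilon> i"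
    and fast: "\<And>i i' u. i < i' \<Longrightarrow> i' < N \<Longrightarrow> u \<in> supp (x i) \<Longrightarrow> real u * \<epsilon> i' \<le> \<delta>"
  shows "\<bar>pairing (family_sum P) (lin_comb {..<N} (\<lambda>_. 1 / real N) x)\<bar> \<le> 1 / real N + \<tau> + \<delta>"
proof -
  define I where "I = {i. i < N \<and> supp (family_sum P) \<inter> supp (x i) \<noteq> {}}"
  have eq: "pairing (family_sum P) (lin_comb {..<N} (\<lambda>_. 1 / real N) x) = (\<Sum>i<N. pairing (family_sum P) (x i)) / real N"
  proof -
    have "pairing (family_sum P) (lin_comb {..<N} (\<lambda>_. 1 / real N) x) = (\<Sum>i<N. (1 / real N) * pairing (family_sum P) (x i))"
      by (rule pairing_lin_comb) (use x in auto)
    then show ?thesis by (simp add: sum_divide_distrib)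
  qed
  have eq2: "(\<Sum>i<N. pairing (family_sum P) (x i)) = (\<Sum>i\<in>I. pairing (family_sum P) (x i))"
    by (rule sum.mono_neutral_right) (auto simp: I_def pairing_disjoint)
  have "\<bar>\<Sum>i\<in>I. pairing (family_sum P) (x i)\<bar> \<le> 1 + real N * (\<tau> + \<delta>)"
  proof (cases "I = {}")
    case True
    then show ?thesis using \<tau> \<delta> by simp
  next
    case False
    have finI: "finite I" by (simp add: I_def)
    define i0 where "i0 = Min I"
    have i0: "i0 \<in> I" "\<And>i. i \<in> I \<Longrightarrow> i0 \<le> i" using False finI by (auto simp: i0_def)
    obtain u where u: "u \<in> supp (family_sum P)" "u \<in> supp (x i0)" using i0 by (auto simp: I_def)
    have "\<bar>pairing (family_sum P) (x i)\<bar> \<le> \<tau> + \<delta>" if "i \<in> I - {i0}" for i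
    proof -
      have i: "i0 < i" "i < N" using that i0(2)[of i] by (auto simp: I_def)
      have "\<bar>\<Sum>p\<in>P. pairing (fst p) (x i)\<bar> \<le> \<tau> + real u * \<epsilon> i"
        by (rule family_on_vector[OF P subset_refl Min_first_index_le[OF P u(1)] \<epsilon>[OF i(2)] \<tau>])
           (use x rest first i in auto)
      then show ?thesis using fast[OF i u(2)] by (simp add: pairing_family_sum)
    qed
    then have "\<bar>\<Sum>i\<in>I - {i0}. pairing (family_sum P) (x i)\<bar> \<le> (\<Sum>i\<in>I - {i0}. \<tau> + \<delta>)"
      by (intro order_trans[OF sum_abs] sum_mono)
    also have "\<dots> \<le> real N * (\<tau> + \<delta>)"
    proof -
      have "card (I - {i0}) \<le> card {..<N}" by (rule card_mono) (auto simp: I_def)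
      then show ?thesis using \<tau> \<delta> by (simp add: mult_right_mono)
    qed
    moreover have "\<bar>pairing (family_sum P) (x i0)\<bar> \<le> 1"
      using pairing_le_norm_W[OF family_sum_W_le[OF P j], of "x i0"] x[of i0] i0 by (auto simp: I_def)
    moreover have "(\<Sum>i\<in>I. pairing (family_sum P) (x i)) =
        pairing (family_sum P) (x i0) + (\<Sum>i\<in>I - {i0}. pairing (family_sum P) (x i))"
      using finI i0 by (simp add: sum.remove)
    ultimately show ?thesis by linarith
  qed
  then have "\<bar>pairing (family_sum P) (lin_comb {..<N} (\<lambda>_. 1 / real N) x)\<bar> \<le> (1 + real N * (\<tau> + \<delta>)) / real N"
    unfolding eq eq2 abs_divide by (simp add: divide_right_mono)
  also have "\<dots> = 1 / real N + \<tau> + \<delta>" using N by (simp add: field_simps)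
  finally show ?thesis .
qed

lemma W_cases:
  assumes "f \<in> W n"
  obtains (unit) i where "1 \<le> i" "f = unit_vec i \<or> f = (\<lambda>j. - unit_vec i j)"
  | (average) l where "f \<in> averages (W n) l"
  | (sum) P where "family (W n) n P" "f = family_sum P"
proof -
  have "(\<exists>i\<ge>1. f = unit_vec i \<or> f = (\<lambda>j. - unit_vec i j)) \<or> (\<exists>l. f \<in> averages (W n) l) \<or>
    (\<exists>P. family (W n) n P \<and> f = family_sum P)" using assms
  proof (induction rule: W_induct)
    case (average f l)
    have "f \<in> averages (W n) l" by (rule averages_mono[OF _ average]) blast
    then show ?case by blast
  next
    case (sum P)
    have "family (W n) n P" by (rule family_mono[OF _ sum]) blast
    then show ?case by blast
  qed auto
  then show thesis using that by blast
qed

lemma family_uminus: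
  assumes P: "family (W n) j P" and P1: "P1 = (\<lambda>p. ((\<lambda>i. - fst p i), snd p)) ` P"
  shows "family (W n) j P1" "family_sum P1 = (\<lambda>i. - family_sum P i)"
proof -
  define r where "r = (\<lambda>p :: (nat \<Rightarrow> real) \<times> nat. ((\<lambda>i. - fst p i), snd p))"
  have P1: "P1 = r ` P" by (simp add: P1 r_def)
  have pr: "prec (r p) (r q) \<longleftrightarrow> prec p q" for p q
    by (simp add: r_def prec_def vec_before_def supp_uminus)
  have first_index: "first_index (r p) = first_index p" for p by (simp add: r_def first_index_def supp_uminus)
  have inj: "inj_on r P"
    using familyD(5)[OF P] pr prec_first_index unfolding inj_on_def by (metis less_irrefl)
  have "alpha_average (W n) (r p)" if "p \<in> P" for p
    unfolding alpha_average_W using averages_uminus[OF familyD(4)[OF P that]] W_uminus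
    by (simp add: r_def)
  moreover have "prec a b \<or> prec b a" if ab: "a \<in> r ` P" "b \<in> r ` P" "a \<noteq> b" for a b
  proof -
    obtain p q where "a = r p" "b = r q" "p \<in> P" "q \<in> P" using ab by blast
    then show ?thesis using familyD(5)[OF P, of p q] pr ab(3) by auto
  qed
  moreover have "first_index ` r ` P = first_index ` P" using first_index by (simp add: image_image)
  ultimately show "family (W n) j P1"
    unfolding P1 family_def using familyD(1,2,6)[OF P] by simp
  show "family_sum P1 = (\<lambda>i. - family_sum P i)"
    unfolding P1 family_sum_def sum.reindex[OF inj] by (simp add: r_def sum_negf fun_eq_iff)
qed

text \<open>Turns a failed upper estimate into a functional that can be joined with those of
  neighbouring vectors; restriction and a change of sign keep the sizes.\<close>

lemma family_localize:
  assumes P: "family (W n) j P" and ne: "pairing (family_sum P) x \<noteq> 0"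
  obtains P1 where "family (W n) j P1" "supp (family_sum P1) \<subseteq> supp x"
    "pairing (family_sum P1) x = \<bar>pairing (family_sum P) x\<bar>" "snd ` P1 \<subseteq> snd ` P"
proof -
  define P2 where "P2 = (\<lambda>p. (restr (supp x) (fst p), snd p)) ` {p \<in> P. supp (fst p) \<inter> supp x \<noteq> {}}"
  have "supp (family_sum P) \<inter> supp x \<noteq> {}" using ne pairing_disjoint by blast
  then have "\<exists>p\<in>P. supp (fst p) \<inter> supp x \<noteq> {}" unfolding supp_family_sum[OF P] by blast
  then have ne2: "P2 \<noteq> {}" unfolding P2_def by blast
  have f2: "family (W n) j P2" by (rule restr_fam(1)[OF P subset_refl _ P2_def ne2]) (rule restr_W)
  have p2: "family_sum P2 = restr (supp x) (family_sum P)"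
    by (rule restr_fam(2)[OF P subset_refl _ P2_def ne2, of "W n"]) (rule restr_W)
  have s2: "snd ` P2 \<subseteq> snd ` P" by (force simp: P2_def)
  have pr: "pairing (family_sum P2) x = pairing (family_sum P) x" by (simp add: p2 pairing_restr)
  define P3 where "P3 = (\<lambda>p. ((\<lambda>i. - fst p i), snd p)) ` P2"
  note u = family_uminus[OF f2 P3_def]
  show thesis
  proof (cases "pairing (family_sum P) x \<ge> 0")
    case True
    then show ?thesis using that[of P2] f2 p2 s2 pr by simp
  next
    case False
    have "snd ` P3 \<subseteq> snd ` P" using s2 by (simp add: P3_def image_image)
    then show ?thesis
      using that[of P3] u pr False by (simp add: p2 supp_uminus pairing_uminus_left)
  qed
qed

text \<open>The numbers \<open>m i\<close> separate the families: supports and sizes of the i-th one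
  lie above \<open>m i\<close> and below all later separators. The number of families is at most
  every \<open>m i\<close>, hence below every first index, and so the union is admissible one level
  higher.\<close>

lemma family_Union:
  fixes J :: "nat set"
  assumes P: "\<And>i. i \<in> J \<Longrightarrow> family (W n) j (P i)" and J: "finite J" "J \<noteq> {}"
    and lo: "\<And>i p u. i \<in> J \<Longrightarrow> p \<in> P i \<Longrightarrow> u \<in> supp (fst p) \<Longrightarrow> m i < u"
    and los: "\<And>i p. i \<in> J \<Longrightarrow> p \<in> P i \<Longrightarrow> m i < snd p"
    and hi: "\<And>i i' p u. i \<in> J \<Longrightarrow> i' \<in> J \<Longrightarrow> i < i' \<Longrightarrow> p \<in> P i \<Longrightarrow> u \<in> supp (fst p) \<Longrightarrow> u < m i'"
    and his: "\<And>i i' p. i \<in> J \<Longrightarrow> i' \<in> J \<Longrightarrow> i < i' \<Longrightarrow> p \<in> P i \<Longrightarrow> snd p < m i'"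
    and card: "\<And>i. i \<in> J \<Longrightarrow> card J \<le> m i"
  shows "family (W n) (Suc j) (\<Union>i\<in>J. P i)" "family_sum (\<Union>i\<in>J. P i) = (\<lambda>t. \<Sum>i\<in>J. family_sum (P i) t)"
proof -
  have pr: "prec p q" if "i \<in> J" "i' \<in> J" "i < i'" "p \<in> P i" "q \<in> P i'" for i i' p q
  proof -
    have fp: "finite (supp (fst p))" "supp (fst p) \<noteq> {}"
      and fq: "finite (supp (fst q))" "supp (fst q) \<noteq> {}"
      using family_supp P that by blast+
    have "Max (supp (fst p)) < m i'" using fp hi[OF that(1-4)] by simp
    moreover have "vec_before (fst p) (fst q)"
    proof (rule vec_beforeI[OF fp fq])
      fix a b assume "a \<in> supp (fst p)" "b \<in> supp (fst q)"
      then show "a < b" using hi[OF that(1-4), of a] lo[OF that(2,5), of b] by linarith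
    qed
    ultimately show ?thesis
      using his[OF that(1-4)] los[OF that(2,5)] unfolding prec_def by linarith
  qed
  have disj: "P i \<inter> P i' = {}" if "i \<in> J" "i' \<in> J" "i \<noteq> i'" for i i'
  proof (rule equals0I)
    fix p assume "p \<in> P i \<inter> P i'"
    then have "prec p p"
      using pr[of i i' p p] pr[of i' i p p] that by (cases i i' rule: linorder_cases) auto
    then show False using prec_first_index by blast
  qed
  define \<G> where "\<G> = (\<lambda>i. first_index ` P i) ` J"
  have "first_index ` (\<Union>i\<in>J. P i) \<in> schreier (Suc j)"
    unfolding schreier_Suc
  proof (intro exI[of _ \<G>] conjI)
    show "\<G> \<subseteq> schreier j" using familyD(6)[OF P] by (auto simp: \<G>_def)
    show "sets_chain \<G>"
      unfolding sets_chain_def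
    proof (intro ballI impI)
      fix A B assume "A \<in> \<G>" "B \<in> \<G>" "A \<noteq> B"
      then obtain i i' where i: "i \<in> J" "i' \<in> J" "i \<noteq> i'" "A = first_index ` P i" "B = first_index ` P i'"
        unfolding \<G>_def by blast
      have "set_before (first_index ` P a) (first_index ` P b)" if "a \<in> J" "b \<in> J" "a < b" for a b
        by (rule set_beforeI)
           (use familyD(1,2)[OF P] that pr[of a b] prec_first_index in auto)
      then show "set_before A B \<or> set_before B A" using i by (cases "i < i'") auto
    qed
    have "card \<G> \<le> card J" unfolding \<G>_def using J by (intro card_image_le)
    also have "\<dots> \<le> Min (\<Union>\<G>)"
    proof (rule Min.boundedI)
      show "finite (\<Union>\<G>)" using familyD(1)[OF P] J by (auto simp: \<G>_def)
      obtain i where "i \<in> J" using J by blast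
      then have "first_index ` P i \<in> \<G>" "first_index ` P i \<noteq> {}" using familyD(2)[OF P] by (simp_all add: \<G>_def)
      then show "\<Union>\<G> \<noteq> {}" by (meson Sup_bot_conv(1))
      fix a assume "a \<in> \<Union>\<G>"
      then obtain i p where ip: "i \<in> J" "p \<in> P i" "a = first_index p" by (auto simp: \<G>_def)
      have "first_index p \<in> supp (fst p)" unfolding first_index_def using family_supp[OF P] ip by simp
      then show "card J \<le> a" using lo ip card by (metis le_trans less_imp_le_nat)
    qed
    finally show "card \<G> \<le> Min (\<Union>\<G>)" .
  qed (use J in \<open>auto simp: \<G>_def\<close>)
  moreover have "prec p q \<or> prec q p" if pq: "p \<in> (\<Union>i\<in>J. P i)" "q \<in> (\<Union>i\<in>J. P i)" "p \<noteq> q" for p q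
  proof -
    obtain i i' where i: "i \<in> J" "p \<in> P i" "i' \<in> J" "q \<in> P i'" using pq by blast
    show ?thesis
    proof (cases "i = i'")
      case True
      then show ?thesis using familyD(5)[OF P[OF i(1)], of p q] i pq by auto
    next
      case False
      then show ?thesis using pr[of i i' p q] pr[of i' i q p] i by (cases "i < i'") auto
    qed
  qed
  moreover have "finite (\<Union>i\<in>J. P i)" "(\<Union>i\<in>J. P i) \<noteq> {}" using J familyD(1,2)[OF P] by auto
  moreover have "\<forall>p\<in>(\<Union>i\<in>J. P i). alpha_average (W n) p"
    using P by (auto simp: family_def)
  ultimately show "family (W n) (Suc j) (\<Union>i\<in>J. P i)" unfolding family_def by simp
  show "family_sum (\<Union>i\<in>J. P i) = (\<lambda>t. \<Sum>i\<in>J. family_sum (P i) t)"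
    unfolding family_sum_def using J familyD(1)[OF P] disj
    by (intro ext sum.UNION_disjoint) auto
qed

text \<open>\<open>B z\<close> is meant to bound all numbers occurring in the object
  \<open>z\<close>, so that each new object is requested beyond everything chosen before.\<close>

lemma fast_sequence:
  fixes B :: "'b \<Rightarrow> nat"
  assumes ex: "\<And>k :: nat. \<exists>z. \<Phi> k z"
  obtains z :: "nat \<Rightarrow> 'b" and m :: "nat \<Rightarrow> nat" where "\<And>i. \<Phi> (m i) (z i)" "\<And>i. M \<le> m i"
    "\<And>i i'. i < i' \<Longrightarrow> B (z i) < m i'" "\<And>i i'. i < i' \<Longrightarrow> m i < m i'"
proof -
  have "\<exists>f. \<forall>i :: nat. (\<Phi> (fst (f i)) (snd (f i)) \<and> M \<le> fst (f i)) \<and>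
      (fst (f i) < fst (f (Suc i)) \<and> B (snd (f i)) < fst (f (Suc i)))"
  proof (rule dependent_nat_choice)
    show "\<exists>f. \<Phi> (fst f) (snd f) \<and> M \<le> fst f" using ex[of M] by auto
    fix f :: "nat \<times> 'b" and i :: nat
    obtain z where "\<Phi> (max (max (Suc (fst f)) (Suc (B (snd f)))) M) z" using ex by blast
    then show "\<exists>g. (\<Phi> (fst g) (snd g) \<and> M \<le> fst g) \<and> (fst f < fst g \<and> B (snd f) < fst g)"
      by (intro exI[of _ "(max (max (Suc (fst f)) (Suc (B (snd f)))) M, z)"]) auto
  qed
  then obtain f where f: "\<And>i. \<Phi> (fst (f i)) (snd (f i))" "\<And>i. M \<le> fst (f i)"
    "\<And>i. fst (f i) < fst (f (Suc i))" "\<And>i. B (snd (f i)) < fst (f (Suc i))" by blast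
  have mono: "fst (f i) < fst (f i')" if "i < i'" for i i'
    using that f(3) by (rule lift_Suc_mono_less[of "\<lambda>i. fst (f i)", rotated])
  have "B (snd (f i)) < fst (f i')" if "i < i'" for i i'
    using f(4)[of i] mono[of "Suc i" i'] that by (cases "Suc i = i'") (auto intro: less_trans)
  then show thesis using that[of "\<lambda>i. fst (f i)" "\<lambda>i. snd (f i)"] f mono by blast
qed

section \<open>The c_0 estimate for sums of rapidly increasing vectors\<close>

text \<open>Induction on the length of the interval. In an average either every summand misses an
  end of the interval, and the induction hypothesis applies, or one summand spans it while the
  others are at most 1, and then the norm \<open>M\<close> of the sum can be absorbed. A very fast
  growing sum reduces, up to \<open>\<eta>\<close>, to its first member, which is an average, or to
  the first vector met.\<close>

lemma norm_W_sum_le: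
  assumes n: "1 \<le> n" and x: "\<And>i. i < N \<Longrightarrow> x i \<in> c00 \<and> norm_W n (x i) \<le> 1"
    and succ: "successive {..<N} x" and \<beta>: "0 \<le> \<beta>"
    and tail: "\<And>P Q i i0 u. family (W n) n P \<Longrightarrow> Q \<subseteq> P \<Longrightarrow> i0 < i \<Longrightarrow> i < N \<Longrightarrow> u \<in> supp (family_sum P) \<Longrightarrow>
      u \<in> supp (x i0) \<Longrightarrow> \<forall>p\<in>Q. Min (supp (x i0)) < snd p \<Longrightarrow>
      \<bar>\<Sum>p\<in>Q. pairing (fst p) (x i)\<bar> \<le> \<beta>"
    and ab: "b \<le> N"
  shows "norm_W n (lin_comb {a..<b} (\<lambda>_. 1) x) \<le> 2 + real (b - a) * (real N * \<beta>)"
  using ab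
proof (induction "b - a" arbitrary: a b rule: less_induct)
  case less
  define X where "X = lin_comb {a..<b} (\<lambda>_. 1) x"
  define M where "M = norm_W n X"
  define \<eta> where "\<eta> = real N * \<beta>"
  have \<eta>: "0 \<le> \<eta>" using \<beta> by (simp add: \<eta>_def)
  have xc: "x i \<in> c00" "norm_W n (x i) \<le> 1" if "i \<in> {a..<b}" for i
    using x[of i] that less.prems by auto
  have pX: "pairing f X = (\<Sum>i\<in>{a..<b}. pairing f (x i))" for f
    unfolding X_def by (subst pairing_lin_comb) (use xc in auto)
  have one: "\<bar>pairing f (x i)\<bar> \<le> 1" if "f \<in> W n" "i \<in> {a..<b}" for f i
    using pairing_le_norm_W[OF that(1), of "x i"] xc that(2) by fastforce
  have single: "\<bar>pairing f X\<bar> \<le> 1" if f: "f \<in> W n" and t: "\<And>i. i \<in> {a..<b} \<Longrightarrow> i \<noteq> i1 \<Longrightarrow> pairing f (x i) = 0" for f i1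
  proof (cases "i1 \<in> {a..<b}")
    case True
    then have "pairing f X = pairing f (x i1)" unfolding pX using t by (simp add: sum.remove)
    then show ?thesis using one[OF f True] by simp
  next
    case False
    then have "pairing f X = 0" unfolding pX using t by (intro sum.neutral) metis
    then show ?thesis by simp
  qed
  have sD: "u < v" if "i \<in> {a..<b}" "i' \<in> {a..<b}" "i < i'" "u \<in> supp (x i)" "v \<in> supp (x i')" for i i' u v
    by (rule successiveD[OF succ, of i i']) (use that less.prems in auto)
  show ?case
  proof (cases "M \<le> 1 \<or> b - a \<le> 1")
    case True
    have "M \<le> 1"
    proof (cases "M \<le> 1")
      case False
      then have "b - a \<le> 1" using True by simp
      show ?thesis unfolding M_def
      proof (rule norm_W_leI)
        fix f assume f: "f \<in> W n"
        have "\<bar>pairing f X\<bar> \<le> 1" by (rule single[OF f, of a]) (use \<open>b - a \<le> 1\<close> in auto)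
        then show "pairing f X \<le> 1" by simp
      qed
    qed
    then show ?thesis using \<beta> unfolding M_def X_def by (smt (verit) mult_nonneg_nonneg of_nat_0_le_iff)
  next
    case False
    then have M1: "1 < M" and L: "2 \<le> b - a" by auto
    \<comment> \<open>\<open>(M + 1) / 2\<close> serves averages with a spanning summand, the other
      term those covered by the induction hypothesis.\<close>
    define D where "D = max ((M + 1) / 2) (2 + real (b - a - 1) * \<eta>)"
    have IH: "norm_W n (lin_comb {c..<d} (\<lambda>_. 1) x) \<le> 2 + real (b - a - 1) * \<eta>"
      if "d - c = b - a - 1" "d \<le> N" for c d
      using less.hyps[of d c] that L unfolding \<eta>_def by simp
    have avg: "\<bar>pairing f X\<bar> \<le> D" if f: "f \<in> averages (W n) s" for f s
    proof -
      obtain A where A: "finite A" "A \<noteq> {}" "A \<subseteq> W n" "vec_chain (\<lambda>g. g) A" "card A \<le> s" "2 \<le> s"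
         "f = (\<lambda>i. (\<Sum>g\<in>A. g i) / real s)" using f unfolding averages_iff by blast
      have eq: "pairing f X = (\<Sum>g\<in>A. pairing g X) / real s"
        by (simp add: A(7) pairing_divide_left pairing_sum_left)
      show ?thesis
      proof (cases "\<exists>g0\<in>A. supp g0 \<inter> supp (x a) \<noteq> {} \<and> supp g0 \<inter> supp (x (b - 1)) \<noteq> {}")
        case True
        then obtain g0 u v where g0: "g0 \<in> A" "u \<in> supp g0" "u \<in> supp (x a)" "v \<in> supp g0" "v \<in> supp (x (b - 1))"
          by blast
        \<comment> \<open>As \<open>g0\<close> reaches from the first to the last vector, any other
          summand lies on one side of it and meets at most the vector at that end.\<close>
        have "\<bar>pairing g X\<bar> \<le> 1" if g: "g \<in> A - {g0}" for g
        proof -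
          have "vec_before g g0 \<or> vec_before g0 g" using A(4) g g0 unfolding vec_chain_def by blast
          then show ?thesis
          proof
            assume bf: "vec_before g g0"
            show ?thesis
            proof (rule single[of _ a])
              fix i assume i: "i \<in> {a..<b}" "i \<noteq> a"
              show "pairing g (x i) = 0"
              proof (rule pairing_disjoint, rule equals0I)
                fix w assume "w \<in> supp g \<inter> supp (x i)"
                then show False using sD[of a i u w] vec_beforeD[OF bf, of w u] g0 i by auto
              qed
            qed (use g A in auto)
          next
            assume bf: "vec_before g0 g"
            show ?thesis
            proof (rule single[of _ "b - 1"])
              fix i assume i: "i \<in> {a..<b}" "i \<noteq> b - 1"
              show "pairing g (x i) = 0"
              proof (rule pairing_disjoint, rule equals0I)
                fix w assume "w \<in> supp g \<inter> supp (x i)"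
                then show False using sD[of i "b - 1" w v] vec_beforeD[OF bf, of v w] g0 i L by fastforce
              qed
            qed (use g A in auto)
          qed
        qed
        then have "\<bar>\<Sum>g\<in>A - {g0}. pairing g X\<bar> \<le> (\<Sum>g\<in>A - {g0}. 1)"
          by (intro order_trans[OF sum_abs] sum_mono)
        also have "\<dots> = real (card A) - 1" using A(1) g0(1) card_Suc_Diff1[OF A(1) g0(1)] by simp
        also have "\<dots> \<le> real s - 1" using A by simp
        moreover have "\<bar>pairing g0 X\<bar> \<le> M" unfolding M_def using A g0 by (intro pairing_le_norm_W) auto
        moreover have "(\<Sum>g\<in>A. pairing g X) = pairing g0 X + (\<Sum>g\<in>A - {g0}. pairing g X)"
          using A g0 by (simp add: sum.remove)
        ultimately have "\<bar>\<Sum>g\<in>A. pairing g X\<bar> \<le> M + real s - 1" by linarith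
        then have "\<bar>pairing f X\<bar> \<le> (M + real s - 1) / real s"
          unfolding eq abs_divide abs_of_nat by (rule divide_right_mono) simp
        \<comment> \<open>Here \<open>1 < M\<close> and \<open>2 \<le> s\<close> enter. The
          coefficient of \<open>M\<close> is below 1, as absorption requires.\<close>
        also have "\<dots> \<le> (M + 1) / 2"
        proof -
          have "0 \<le> (M - 1) * (real s - 2)" using M1 A(6) by (intro mult_nonneg_nonneg) auto
          then have "2 * (M + real s - 1) \<le> (M + 1) * real s" by (simp add: algebra_simps)
          then show ?thesis using A(6) by (simp add: field_simps)
        qed
        finally show ?thesis unfolding D_def by (rule max.coboundedI1)
      next
        case False
        have "\<bar>pairing g X\<bar> \<le> 2 + real (b - a - 1) * \<eta>" if g: "g \<in> A" for g
        proof (cases "supp g \<inter> supp (x a) = {}")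
          case True
          have "{a..<b} = insert a {Suc a..<b}" using L by auto
          then have "pairing g X = (\<Sum>i\<in>{Suc a..<b}. pairing g (x i))"
            unfolding pX using True by (simp add: pairing_disjoint)
          also have "\<dots> = pairing g (lin_comb {Suc a..<b} (\<lambda>_. 1) x)"
            by (subst pairing_lin_comb) (use xc in auto)
          finally have eq': "pairing g X = pairing g (lin_comb {Suc a..<b} (\<lambda>_. 1) x)" .
          show ?thesis
          proof -
            have "norm_W n (lin_comb {Suc a..<b} (\<lambda>_. 1) x) \<le> 2 + real (b - a - 1) * \<eta>"
              by (rule IH) (use less.prems in simp_all)
            moreover have "g \<in> W n" using g A(3) by blast
            ultimately show ?thesis
              unfolding eq' using pairing_le_norm_W[of g n "lin_comb {Suc a..<b} (\<lambda>_. 1) x"] by linarith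
          qed
        next
          case F: False
          then have t: "supp g \<inter> supp (x (b - 1)) = {}" using False g by blast
          have "{a..<b} = insert (b - 1) {a..<b - 1}" using L by auto
          then have "pairing g X = (\<Sum>i\<in>{a..<b - 1}. pairing g (x i))"
            unfolding pX using pairing_disjoint[OF t] by simp
          also have "\<dots> = pairing g (lin_comb {a..<b - 1} (\<lambda>_. 1) x)"
            by (subst pairing_lin_comb) (use xc in auto)
          finally have eq': "pairing g X = pairing g (lin_comb {a..<b - 1} (\<lambda>_. 1) x)" .
          show ?thesis
          proof -
            have "norm_W n (lin_comb {a..<b - 1} (\<lambda>_. 1) x) \<le> 2 + real (b - a - 1) * \<eta>"
              by (rule IH) (use less.prems in simp_all)
            moreover have "g \<in> W n" using g A(3) by blast
            ultimately show ?thesis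
              unfolding eq' using pairing_le_norm_W[of g n "lin_comb {a..<b - 1} (\<lambda>_. 1) x"] by linarith
          qed
        qed
        then have "\<bar>\<Sum>g\<in>A. pairing g X\<bar> \<le> (\<Sum>g\<in>A. 2 + real (b - a - 1) * \<eta>)"
          by (intro order_trans[OF sum_abs] sum_mono)
        also have "\<dots> \<le> real s * (2 + real (b - a - 1) * \<eta>)"
          using A \<eta> by (simp add: mult_right_mono)
        finally have "\<bar>pairing f X\<bar> \<le> real s * (2 + real (b - a - 1) * \<eta>) / real s"
          unfolding eq abs_divide abs_of_nat by (rule divide_right_mono) simp
        then show ?thesis using A(6) by (simp add: D_def)
      qed
    qed
    have D1: "1 \<le> D" using \<eta> by (simp add: D_def le_max_iff_disj)
    have "M \<le> D + \<eta>" unfolding M_def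
    proof (rule norm_W_leI)
      fix f assume "f \<in> W n"
      then show "pairing f X \<le> D + \<eta>"
      proof (cases rule: W_cases)
        case (unit t)
        then have st: "supp f = {t}" by (auto simp: supp_def unit_vec_def split: if_splits)
        have "\<bar>pairing f X\<bar> \<le> 1"
        proof (cases "\<exists>i1\<in>{a..<b}. t \<in> supp (x i1)")
          case True
          then obtain i1 where i1: "i1 \<in> {a..<b}" "t \<in> supp (x i1)" by blast
          show ?thesis
          proof (rule single[OF \<open>f \<in> W n\<close>, of i1])
            fix i assume i: "i \<in> {a..<b}" "i \<noteq> i1"
            then have "t \<notin> supp (x i)" using sD[of i i1 t t] sD[of i1 i t t] i1 by (metis less_irrefl linorder_neqE_nat)
            then show "pairing f (x i) = 0" using st by (intro pairing_disjoint) auto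
          qed
        next
          case False
          show ?thesis
            by (rule single[OF \<open>f \<in> W n\<close>, of a], rule pairing_disjoint) (use False st in auto)
        qed
        then show ?thesis using D1 \<eta> by linarith
      next
        case (average s)
        then show ?thesis using avg[of f s] \<eta> by linarith
      next
        case (sum P)
        define I where "I = {i \<in> {a..<b}. supp f \<inter> supp (x i) \<noteq> {}}"
        show ?thesis
        proof (cases "I = {}")
          case True
          then have "pairing f X = 0" unfolding pX by (intro sum.neutral) (auto simp: I_def pairing_disjoint)
          then show ?thesis using D1 \<eta> by simp
        next
          case False
          have "finite I" by (simp add: I_def)
          define i0 where "i0 = Min I"
          have i0: "i0 \<in> I" "\<And>i. i \<in> I \<Longrightarrow> i0 \<le> i" using False \<open>finite I\<close> by (auto simp: i0_def)
          then have i0ab: "i0 \<in> {a..<b}" by (simp add: I_def)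
          note P = sum(1)
          define P1 where "P1 = {p \<in> P. supp (fst p) \<inter> supp (x i0) \<noteq> {}}"
          have "finite P1" using familyD(1)[OF P] by (simp add: P1_def)
          moreover have "P1 \<noteq> {}" using i0(1) supp_family_sum[OF P] unfolding I_def P1_def sum(2) by blast
          ultimately obtain p1 where p1: "p1 \<in> P1" "\<And>p. p \<in> P1 \<Longrightarrow> first_index p1 \<le> first_index p"
            by (metis arg_min_if_finite(1) arg_min_least)
          then have p1P: "p1 \<in> P" by (simp add: P1_def)
          obtain u where u: "u \<in> supp (fst p1)" "u \<in> supp (x i0)" using p1 by (auto simp: P1_def)
          \<comment> \<open>Members before \<open>p1\<close> miss \<open>x i0\<close> and everything
            later, while those after it have sizes beyond \<open>Min (supp (x i0))\<close>, so that
            \<open>tail\<close> applies to them.\<close>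
          define Q where "Q = {p \<in> P. prec p1 p}"
          define E where "E i = (\<Sum>p\<in>Q. pairing (fst p) (x i))" for i
          have uf: "u \<in> supp (family_sum P)" using u p1P supp_family_sum[OF P] by blast
          have size: "\<forall>p\<in>Q. Min (supp (x i0)) < snd p"
          proof
            fix p assume "p \<in> Q"
            then have "Max (supp (fst p1)) < snd p" by (simp add: Q_def prec_def)
            moreover have "u \<le> Max (supp (fst p1))" using u family_supp[OF P p1P] by auto
            moreover have "Min (supp (x i0)) \<le> u" using u xc[OF i0ab] by (auto simp: c00_def)
            ultimately show "Min (supp (x i0)) < snd p" by linarith
          qed
          have E: "\<bar>E i\<bar> \<le> \<beta>" if "i0 < i" "i < b" for i
            unfolding E_def
            by (rule tail[OF P, of Q i0 i u]) (use that uf u size less.prems in \<open>auto simp: Q_def\<close>)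
          have zero: "pairing f (x i) = 0" if "i \<in> {a..<b}" "i < i0" for i
          proof (rule pairing_disjoint)
            show "supp f \<inter> supp (x i) = {}" using i0(2)[of i] that by (auto simp: I_def)
          qed
          have zero1: "pairing (fst p1) (x i) = 0" if "i \<in> {a..<b}" "i < i0" for i
          proof (rule pairing_disjoint)
            have "supp f \<inter> supp (x i) = {}" using i0(2)[of i] that by (auto simp: I_def)
            then show "supp (fst p1) \<inter> supp (x i) = {}" using supp_family_sum[OF P] sum(2) p1P by blast
          qed
          have split: "pairing f (x i) = pairing (fst p1) (x i) + E i" if i: "i \<in> {a..<b}" "i0 \<le> i" for i
          proof -
            have z: "pairing (fst p) (x i) = 0" if p: "p \<in> P - {p1} - Q" for p
            proof (rule pairing_disjoint, rule equals0I)
              fix w assume w: "w \<in> supp (fst p) \<inter> supp (x i)"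
              have pr: "prec p p1" using familyD(5)[OF P, of p p1] p p1P by (auto simp: Q_def)
              show False
              proof (cases "i = i0")
                case True
                then have "p \<in> P1" using p w by (auto simp: P1_def)
                then show False using p1(2)[of p] prec_first_index[OF pr] by simp
              next
                case False
                then have "u < w" using sD[of i0 i u w] i i0ab u w by auto
                moreover have "w < u" using pr w u vec_beforeD unfolding prec_def by blast
                ultimately show False by simp
              qed
            qed
            have "pairing f (x i) = pairing (fst p1) (x i) + (\<Sum>p\<in>P - {p1}. pairing (fst p) (x i))"
              unfolding sum(2) pairing_family_sum using familyD(1)[OF P] p1P by (simp add: sum.remove)
            also have "(\<Sum>p\<in>P - {p1}. pairing (fst p) (x i)) = E i"
              unfolding E_def
            proof (rule sum.mono_neutral_right)
              show "Q \<subseteq> P - {p1}" using prec_first_index[of p1 p1] by (auto simp: Q_def)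
            qed (use familyD(1)[OF P] z in auto)
            finally show ?thesis .
          qed
          have sumE: "\<bar>\<Sum>i\<in>{Suc i0..<b}. E i\<bar> \<le> \<eta>"
          proof -
            have "\<bar>\<Sum>i\<in>{Suc i0..<b}. E i\<bar> \<le> (\<Sum>i\<in>{Suc i0..<b}. \<beta>)"
              using E by (intro order_trans[OF sum_abs] sum_mono) auto
            also have "\<dots> \<le> \<eta>" using less.prems \<beta> by (simp add: \<eta>_def mult_right_mono)
            finally show ?thesis .
          qed
          have ab: "{a..<b} = {a..<i0} \<union> {i0..<b}" "{i0..<b} = insert i0 {Suc i0..<b}" using i0ab by auto
          have fX: "pairing f X = (\<Sum>i\<in>{i0..<b}. pairing f (x i))"
            unfolding pX ab(1) using zero i0ab by (subst sum.union_disjoint) (auto intro!: sum.neutral)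
          have p1X: "pairing (fst p1) X = (\<Sum>i\<in>{i0..<b}. pairing (fst p1) (x i))"
            unfolding pX ab(1) using zero1 i0ab by (subst sum.union_disjoint) (auto intro!: sum.neutral)
          show ?thesis
          \<comment> \<open>If a later member also meets \<open>x i0\<close>, then \<open>p1\<close>
            ends before the next vector, and only the value of \<open>f\<close> on
            \<open>x i0\<close> remains, at most 1. Otherwise \<open>f\<close> acts on
            \<open>x i0\<close> as the average \<open>p1\<close>, whose value on the whole sum is at
            most \<open>D\<close>.\<close>
          proof (cases "\<exists>q\<in>Q. supp (fst q) \<inter> supp (x i0) \<noteq> {}")
            case False
            have "E i0 = 0" unfolding E_def using False by (intro sum.neutral) (auto intro: pairing_disjoint)
            have "pairing f X = (\<Sum>i\<in>{i0..<b}. pairing (fst p1) (x i) + E i)"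
              unfolding fX using split i0ab by (intro sum.cong) auto
            also have "\<dots> = pairing (fst p1) X + (\<Sum>i\<in>{i0..<b}. E i)"
              unfolding p1X by (simp add: sum.distrib)
            also have "(\<Sum>i\<in>{i0..<b}. E i) = (\<Sum>i\<in>{Suc i0..<b}. E i)"
              unfolding ab(2) using \<open>E i0 = 0\<close> by simp
            finally show ?thesis using sumE avg[OF familyD(4)[OF P p1P]] by linarith
          next
            case True
            then obtain q w where q: "q \<in> Q" "w \<in> supp (fst q)" "w \<in> supp (x i0)" by blast
            have "pairing f (x i) = E i" if i: "i \<in> {Suc i0..<b}" for i
            proof -
              have "pairing (fst p1) (x i) = 0"
              proof (rule pairing_disjoint, rule equals0I)
                fix v assume v: "v \<in> supp (fst p1) \<inter> supp (x i)"
                then have "v < w" using q vec_beforeD unfolding Q_def prec_def by blast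
                moreover have "w < v" using sD[of i0 i w v] i i0ab q v by auto
                ultimately show False by simp
              qed
              then show ?thesis using split[of i] i i0ab by auto
            qed
            then have "pairing f X = pairing f (x i0) + (\<Sum>i\<in>{Suc i0..<b}. E i)"
              unfolding fX ab(2) by simp
            then show ?thesis using sumE one[OF \<open>f \<in> W n\<close> i0ab] D1 by linarith
          qed
        qed
      qed
    qed
    \<comment> \<open>Absorption turns the first alternative into a bound by 1 plus twice
      \<open>\<eta>\<close>; the second one adds one \<open>\<eta>\<close> for one more
      vector.\<close>
    then have "M \<le> (M + 1) / 2 + \<eta> \<or> M \<le> 2 + real (b - a - 1) * \<eta> + \<eta>"
      by (auto simp: D_def max_def split: if_splits)
    then have "M \<le> 2 + real (b - a) * \<eta>"
    proof
      assume "M \<le> (M + 1) / 2 + \<eta>"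
      then have "M \<le> 1 + 2 * \<eta>" by (simp add: field_simps)
      moreover have "2 * \<eta> \<le> real (b - a) * \<eta>" by (rule mult_right_mono) (use L \<eta> in auto)
      ultimately show ?thesis by linarith
    next
      assume "M \<le> 2 + real (b - a - 1) * \<eta> + \<eta>"
      moreover have "real (b - a) = real (b - a - 1) + 1" using L by simp
      ultimately show ?thesis by (simp add: algebra_simps)
    qed
    then show ?thesis by (simp add: M_def X_def \<eta>_def)
  qed
qed

section \<open>Averages of vectors and the gain of Schreier levels\<close>

text \<open>The term 1 / s is what even long averages of successive vectors leave against averages
  of size \<open>s\<close>; \<open>\<epsilon>\<close> is an error independent of the sizes.\<close>

definition good :: "nat \<Rightarrow> nat \<Rightarrow> real \<Rightarrow> (nat \<Rightarrow> real) \<Rightarrow> bool" where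
  "good n j \<epsilon> x \<longleftrightarrow> (\<forall>P s. family (W n) j P \<longrightarrow> 0 < s \<longrightarrow> (\<forall>p\<in>P. s \<le> snd p) \<longrightarrow>
     \<bar>pairing (family_sum P) x\<bar> \<le> 1 / real s + \<epsilon>)"

lemma goodD:
  "good n j \<epsilon> x \<Longrightarrow> family (W n) j P \<Longrightarrow> 0 < s \<Longrightarrow> (\<And>p. p \<in> P \<Longrightarrow> s \<le> snd p) \<Longrightarrow>
   \<bar>pairing (family_sum P) x\<bar> \<le> 1 / real s + \<epsilon>"
  unfolding good_def by blast

lemma le_mult_add_one: "0 < a \<Longrightarrow> k \<le> a * (k + 1)" for a k :: nat
  by (cases a) auto

lemma inverse_nat_mono: "0 < a \<Longrightarrow> a \<le> b \<Longrightarrow> 1 / real b \<le> 1 / real a"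
  by (simp add: frac_le)

lemma family_single:
  assumes "fst p \<in> averages (W n) (snd p)"
  shows "family (W n) j {p}"
proof -
  have "fst p \<in> W n" using assms by (rule averages_W)
  then have "first_index p \<in> supp (fst p)" "0 \<notin> supp (fst p)" unfolding first_index_def using W_supp by (blast intro: Min_in)+
  then have "1 \<le> first_index p" by (metis One_nat_def Suc_leI gr0I)
  then show ?thesis using assms schreier_singleton by (simp add: family_def alpha_average_W)
qed

lemma family_sum_single [simp]: "family_sum {p} = fst p"
  by (simp add: family_sum_def)

lemma family_member: "family (W n) j P \<Longrightarrow> p \<in> P \<Longrightarrow> family (W n) k {p}"
  using familyD(4) family_single by blast

lemma family_0:
  assumes "family (W n) 0 P"
  obtains p where "P = {p}"
proof -
  obtain m where m: "first_index ` P = {m}" using familyD(6)[OF assms] by auto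
  obtain p where p: "p \<in> P" using familyD(2)[OF assms] by blast
  have "q = p" if "q \<in> P" for q
  proof (rule ccontr)
    assume "q \<noteq> p"
    then have "first_index q < first_index p \<or> first_index p < first_index q" using familyD(5)[OF assms that p] prec_first_index by blast
    moreover have "first_index q = m" "first_index p = m" using m that p by blast+
    ultimately show False by simp
  qed
  then have "P = {p}" using p by blast
  then show thesis by (rule that)
qed

lemma pairing_cross:
  assumes N: "1 \<le> N" and x: "\<And>i. i < N \<Longrightarrow> x i \<in> c00"
    and zero: "\<And>i i'. i < N \<Longrightarrow> i' < N \<Longrightarrow> i \<noteq> i' \<Longrightarrow> pairing (g i) (x i') = 0"
    and c: "\<And>i. i < N \<Longrightarrow> c \<le> pairing (g i) (x i)"
  shows "c \<le> pairing (\<lambda>t. \<Sum>i<N. g i t) (lin_comb {..<N} (\<lambda>_. 1 / real N) x)"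
proof -
  have "pairing (\<lambda>t. \<Sum>i<N. g i t) (lin_comb {..<N} (\<lambda>_. 1 / real N) x) =
      (\<Sum>i<N. \<Sum>i'<N. (1 / real N) * pairing (g i) (x i'))"
    unfolding pairing_sum_left by (intro sum.cong refl pairing_lin_comb) (use x in auto)
  also have "\<dots> = (\<Sum>i<N. (1 / real N) * pairing (g i) (x i))"
  proof (rule sum.cong[OF refl])
    fix i assume i: "i \<in> {..<N}"
    show "(\<Sum>i'<N. (1 / real N) * pairing (g i) (x i')) = (1 / real N) * pairing (g i) (x i)"
      using i zero by (subst sum.remove[of _ i]) (auto intro!: sum.neutral)
  qed
  also have "\<dots> \<ge> (\<Sum>i<N. (1 / real N) * c)"
    using c by (intro sum_mono mult_left_mono) auto
  finally show ?thesis using N by simp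
qed

text \<open>The union gains a level by \<open>family_Union\<close>, and on the average of the
  \<open>x i\<close> it averages the lower bounds, so \<open>c\<close> is not lost. The separators
  \<open>m i\<close> also make the cross terms vanish.\<close>

lemma family_average:
  assumes N: "1 \<le> N" and x: "\<And>i. i < N \<Longrightarrow> x i \<in> c00"
    and lox: "\<And>i u. i < N \<Longrightarrow> u \<in> supp (x i) \<Longrightarrow> m i < u"
    and hix: "\<And>i i' u. i < i' \<Longrightarrow> i' < N \<Longrightarrow> u \<in> supp (x i) \<Longrightarrow> u < m i'"
    and P: "\<And>i. i < N \<Longrightarrow> family (W n) j (P i)"
    and lo: "\<And>i u. i < N \<Longrightarrow> u \<in> supp (family_sum (P i)) \<Longrightarrow> m i < u"
    and hi: "\<And>i i' u. i < i' \<Longrightarrow> i' < N \<Longrightarrow> u \<in> supp (family_sum (P i)) \<Longrightarrow> u < m i'"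
    and los: "\<And>i p. i < N \<Longrightarrow> p \<in> P i \<Longrightarrow> m i < snd p"
    and his: "\<And>i i' p. i < i' \<Longrightarrow> i' < N \<Longrightarrow> p \<in> P i \<Longrightarrow> snd p < m i'"
    and card: "\<And>i. i < N \<Longrightarrow> N \<le> m i" and c: "\<And>i. i < N \<Longrightarrow> c \<le> pairing (family_sum (P i)) (x i)"
  shows "family (W n) (Suc j) (\<Union>i<N. P i)"
    "c \<le> pairing (family_sum (\<Union>i<N. P i)) (lin_comb {..<N} (\<lambda>_. 1 / real N) x)"
proof -
  have sub: "supp (fst p) \<subseteq> supp (family_sum (P i))" if "i < N" "p \<in> P i" for i p
    using supp_family_sum[OF P] that by blast
  note U = family_Union[of "{..<N}" n j P m]
  show "family (W n) (Suc j) (\<Union>i<N. P i)"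
    by (rule U) (use N P sub lo hi los his card in \<open>auto simp: subset_iff lessThan_empty_iff\<close>)
  have eq: "family_sum (\<Union>i<N. P i) = (\<lambda>t. \<Sum>i<N. family_sum (P i) t)"
    by (rule U) (use N P sub lo hi los his card in \<open>auto simp: subset_iff lessThan_empty_iff\<close>)
  show "c \<le> pairing (family_sum (\<Union>i<N. P i)) (lin_comb {..<N} (\<lambda>_. 1 / real N) x)"
    unfolding eq
  proof (rule pairing_cross[OF N x _ c])
    fix i i' assume i: "i < N" "i' < N" "i \<noteq> i'"
    show "pairing (family_sum (P i)) (x i') = 0"
    proof (rule pairing_disjoint, rule equals0I)
      fix u assume u: "u \<in> supp (family_sum (P i)) \<inter> supp (x i')"
      show False
      proof (cases "i < i'")
        case True
        then show False using hi[of i i' u] lox[of i' u] u i by auto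
      next
        case False
        then show False using hix[of i' i u] lo[of i u] u i by auto
      qed
    qed
  qed
qed

text \<open>Averaging raises the level of goodness by one, through \<open>average_on_average\<close>
  at level 0 and \<open>family_on_average\<close> above. The starting point and the accuracy of
  \<open>x i\<close> are measured by \<open>8 * (m + 1) * (k i + 1)\<close>, which outweighs
  \<open>k i\<close>, a bound for all earlier supports.\<close>

lemma average_good:
  assumes N: "N = 2 * (m + 1)" and j: "j \<le> n"
    and x: "\<And>i. i < N \<Longrightarrow> x i \<in> c00 \<and> norm_W n (x i) \<le> 1"
    and lox: "\<And>i u. i < N \<Longrightarrow> u \<in> supp (x i) \<Longrightarrow> 8 * (m + 1) * (k i + 1) < u"
    and hix: "\<And>i i' u. i < i' \<Longrightarrow> i' < N \<Longrightarrow> u \<in> supp (x i) \<Longrightarrow> u < k i'"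
    and g: "\<And>i j'. i < N \<Longrightarrow> j = Suc j' \<Longrightarrow> good n j' (1 / real (8 * (m + 1) * (k i + 1))) (x i)"
  shows "good n j (1 / real (m + 1)) (lin_comb {..<N} (\<lambda>_. 1 / real N) x)"
  unfolding good_def
proof (intro allI impI)
  fix P s assume P: "family (W n) j P" and s: "0 < (s :: nat)" and ps: "\<forall>p\<in>P. s \<le> snd p"
  have "k i \<le> 8 * (m + 1) * (k i + 1)" for i by (rule le_mult_add_one) simp
  then have succ: "successive {..<N} x"
    unfolding successive_def using lox hix by (meson lessThan_iff less_le_trans less_trans not_less)
  have N1: "1 \<le> N" using N by simp
  show "\<bar>pairing (family_sum P) (lin_comb {..<N} (\<lambda>_. 1 / real N) x)\<bar> \<le> 1 / real s + 1 / real (m + 1)"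
  proof (cases j)
    case 0
    then obtain p where p: "P = {p}" using family_0 P by blast
    have "\<bar>pairing (fst p) (lin_comb {..<N} (\<lambda>_. 1 / real N) x)\<bar> \<le> 1 / real (snd p) + 1 / real N"
      by (rule average_on_average[OF _ N1 x succ]) (use familyD(4)[OF P] p in auto)
    also have "\<dots> \<le> 1 / real s + 1 / real (m + 1)"
      using ps p s N by (intro add_mono divide_left_mono) auto
    finally show ?thesis by (simp add: p)
  next
    case (Suc j')
    \<comment> \<open>The error besides 1 / s is 1 / N + d + d. As 1 / N equals 2 d, it amounts to 4
      d, that is 1 / (m + 1).\<close>
    define d where "d = 1 / (4 * real (m + 1))"
    have d0: "0 < d" by (simp add: d_def)
    have K: "1 / real (8 * (m + 1) * (k i + 1)) \<le> d / 2" for i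
    proof -
      have "1 / real (8 * (m + 1) * (k i + 1)) \<le> 1 / real (8 * (m + 1))"
        by (rule inverse_nat_mono) auto
      then show ?thesis by (simp add: d_def)
    qed
    have "\<bar>pairing (family_sum P) (lin_comb {..<N} (\<lambda>_. 1 / real N) x)\<bar> \<le> 1 / real N + (1 / real s + d) + d"
    \<comment> \<open>The numerator 2 collects the goodness error of \<open>x i\<close> and the term
      1 / s for sizes beyond the start of its support; both are bounded by the same number.\<close>
    proof (rule family_on_average[where \<epsilon> = "\<lambda>i. 2 / real (8 * (m + 1) * (k i + 1))"])
      show "family (W n) (Suc j') P" using P Suc by simp
      show "Suc j' \<le> n" using j Suc by simp
      show "\<bar>pairing (fst p) (x i)\<bar> \<le> 1 / real s + d" if "p \<in> P" "i < N" for p i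
      proof -
        have "\<bar>pairing (family_sum {p}) (x i)\<bar> \<le> 1 / real s + 1 / real (8 * (m + 1) * (k i + 1))"
          by (rule goodD[OF g[OF that(2) Suc] family_member[OF P that(1)] s]) (use ps that in auto)
        also have "\<dots> \<le> 1 / real s + d" using K[of i] d0 by linarith
        finally show ?thesis by simp
      qed
      show "\<bar>pairing (family_sum R) (x i)\<bar> \<le> 2 / real (8 * (m + 1) * (k i + 1))"
        if i: "i < N" and R: "family (W n) j' R" "\<forall>p\<in>R. Min (supp (x i)) < snd p" for i R
      proof (cases "supp (x i) = {}")
        case True
        then show ?thesis by (simp add: pairing_disjoint)
      next
        case False
        then have "Min (supp (x i)) \<in> supp (x i)" using x[OF i] by (auto simp: c00_def)
        then have "8 * (m + 1) * (k i + 1) < Min (supp (x i))" by (rule lox[OF i])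
        then have "\<bar>pairing (family_sum R) (x i)\<bar> \<le>
            1 / real (8 * (m + 1) * (k i + 1)) + 1 / real (8 * (m + 1) * (k i + 1))"
          by (intro goodD[OF g[OF i Suc] R(1)]) (use R(2) in \<open>auto intro: less_imp_le less_trans\<close>)
        then show ?thesis by simp
      qed
      show "real u * (2 / real (8 * (m + 1) * (k i' + 1))) \<le> d" if "i < i'" "i' < N" "u \<in> supp (x i)" for i i' u
      proof -
        have "real u * (2 / real (8 * (m + 1) * (k i' + 1))) \<le> real (k i' + 1) * (2 / real (8 * (m + 1) * (k i' + 1)))"
          using hix[OF that] by (intro mult_right_mono) auto
        also have "\<dots> = d"
        proof -
          have e: "real (8 * (m + 1) * (k i' + 1)) = 8 * real (m + 1) * real (k i' + 1)"
            by (simp only: of_nat_mult of_nat_numeral)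
          have gen: "b * (2 / (8 * a * b)) = 1 / (4 * a)" if "0 < a" "0 < b" for a b :: real
            using that by (simp add: field_simps)
          show ?thesis unfolding e d_def by (rule gen) simp_all
        qed
        finally show ?thesis .
      qed
    qed (use N1 x in \<open>auto simp: d_def\<close>)
    also have "\<dots> = 1 / real s + 1 / real (m + 1)"
    proof -
      have "1 / real N = 2 * d" "1 / real (m + 1) = 4 * d" by (simp_all add: N d_def field_simps)
      then show ?thesis by linarith
    qed
    finally show ?thesis .
  qed
qed

text \<open>The vectors \<open>v i\<close> are to be averaged and the functionals
  \<open>\<eta> i\<close> detect them, in cells cut by \<open>\<beta>\<close>. Having all interval
  sums of \<open>\<eta>\<close> in \<open>W\<close> lets Step 3 drop the first and the last cell of
  an interval. Goodness at level n - 1 is what S_n-admissible sums require, since these split into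
  S_(n-1) pieces.\<close>

definition block :: "nat \<Rightarrow> real \<Rightarrow> (nat \<Rightarrow> (nat \<Rightarrow> real) set) \<Rightarrow> nat \<Rightarrow> nat \<Rightarrow> (nat \<Rightarrow> nat) \<Rightarrow>
    (nat \<Rightarrow> nat \<Rightarrow> real) \<Rightarrow> (nat \<Rightarrow> nat \<Rightarrow> real) \<Rightarrow> bool" where
  "block n c V m N \<beta> v \<eta> \<longleftrightarrow> N = 2 * (m + 1) \<and> m < \<beta> 0 \<and> (\<forall>i<N. \<beta> i < \<beta> (Suc i)) \<and>
     (\<forall>i<N. v i \<in> c00 \<and> norm_W n (v i) \<le> 1 \<and> supp (v i) \<subseteq> {\<beta> i..<\<beta> (Suc i)} \<and>
        supp (\<eta> i) \<subseteq> {\<beta> i..<\<beta> (Suc i)} \<and> c \<le> pairing (\<eta> i) (v i)) \<and>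
     (\<forall>a b. a < b \<and> b \<le> N \<longrightarrow> (\<lambda>t. \<Sum>i\<in>{a..<b}. \<eta> i t) \<in> W n) \<and>
     lin_comb {..<N} (\<lambda>_. 1 / real N) v \<in> V m \<and>
     good n (n - 1) (1 / real (m + 1)) (lin_comb {..<N} (\<lambda>_. 1 / real N) v)"

section \<open>Lower estimates on vectors far out in a subspace\<close>

text \<open>\<open>V m\<close> stands for the finitely supported vectors beyond \<open>m\<close>
  within 1 / (m + 1) of a subspace, see \<open>near\<close>. Adding vectors adds up the distances;
  hence the further index \<open>m'\<close> in \<open>V_sum\<close>, which depends on the number of
  summands but not on the vectors.\<close>

locale asymptotic =
  fixes n :: nat and V :: "nat \<Rightarrow> (nat \<Rightarrow> real) set"
  assumes n1: "1 \<le> n"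
    and V_c00: "x \<in> V m \<Longrightarrow> x \<in> c00"
    and V_supp: "x \<in> V m \<Longrightarrow> u \<in> supp x \<Longrightarrow> m < u"
    and V_mono: "x \<in> V m' \<Longrightarrow> m \<le> m' \<Longrightarrow> x \<in> V m"
    and V_scale: "x \<in> V m \<Longrightarrow> \<bar>c\<bar> \<le> 1 \<Longrightarrow> (\<lambda>i. c * x i) \<in> V m"
    and V_sum: "\<exists>m'. \<forall>x. (\<forall>i<N. x i \<in> V m') \<longrightarrow> lin_comb {..<N :: nat} (\<lambda>_. 1) x \<in> V m"
    and V_norm: "\<exists>x\<in>V m. norm_W n x = 1"
begin

lemma V_lin_comb:
  assumes c: "\<bar>c\<bar> \<le> 1"
  obtains m' where "\<And>x. (\<And>i. i < N \<Longrightarrow> x i \<in> V m') \<Longrightarrow> lin_comb {..<N :: nat} (\<lambda>_. c) x \<in> V m"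
proof -
  obtain m' where m': "\<And>x. (\<forall>i<N. x i \<in> V m') \<Longrightarrow> lin_comb {..<N} (\<lambda>_. 1) x \<in> V m" using V_sum by blast
  have "lin_comb {..<N} (\<lambda>_. c) x \<in> V m" if "\<And>i. i < N \<Longrightarrow> x i \<in> V m'" for x
  proof -
    have "lin_comb {..<N} (\<lambda>_. 1) (\<lambda>i t. c * x i t) \<in> V m" using that V_scale[OF _ c] by (intro m') auto
    then show ?thesis by (simp add: lin_comb_def)
  qed
  then show thesis by (rule that)
qed

text \<open>\<open>level 0\<close> is the conclusion of Step 1; the higher levels are reached by averaging in Step 2.\<close>

definition level :: "nat \<Rightarrow> real \<Rightarrow> bool" where
  "level j c \<longleftrightarrow> (\<forall>m. \<exists>x P. x \<in> V m \<and> norm_W n x \<le> 1 \<and>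
     (\<forall>j'. j = Suc j' \<longrightarrow> good n j' (1 / real (m + 1)) x) \<and>
     family (W n) j P \<and> (\<forall>p\<in>P. m < snd p) \<and> (\<forall>u\<in>supp (family_sum P). m < u) \<and> c \<le> pairing (family_sum P) x)"

text \<open>The negation of \<open>level 0 c\<close>, freed by \<open>family_localize\<close> from
  the sign and from the demand that the average be supported beyond \<open>m\<close>.\<close>

lemma small_averages:
  assumes no: "\<not> level 0 c" and c: "0 < c"
  obtains m where "\<And>x s \<alpha>. x \<in> V m \<Longrightarrow> norm_W n x \<le> 1 \<Longrightarrow> m < s \<Longrightarrow> \<alpha> \<in> averages (W n) s \<Longrightarrow>
    \<bar>pairing \<alpha> x\<bar> < c"
proof -
  obtain m where m: "\<And>x P. x \<in> V m \<Longrightarrow> norm_W n x \<le> 1 \<Longrightarrow> family (W n) 0 P \<Longrightarrow> (\<forall>p\<in>P. m < snd p) \<Longrightarrow>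
     (\<forall>u\<in>supp (family_sum P). m < u) \<Longrightarrow> \<not> c \<le> pairing (family_sum P) x"
    using no unfolding level_def by blast
  show thesis
  proof (rule that[of m], rule ccontr)
    fix x s \<alpha> assume x: "x \<in> V m" "norm_W n x \<le> 1" and s: "m < s" and \<alpha>: "\<alpha> \<in> averages (W n) s"
      and "\<not> \<bar>pairing \<alpha> x\<bar> < c"
    then have ge: "c \<le> \<bar>pairing \<alpha> x\<bar>" by simp
    have f: "family (W n) 0 {(\<alpha>, s)}" using \<alpha> by (intro family_single) simp
    have "pairing (family_sum {(\<alpha>, s)}) x \<noteq> 0" using ge c by simp
    then obtain P where P: "family (W n) 0 P" "supp (family_sum P) \<subseteq> supp x"
      "pairing (family_sum P) x = \<bar>pairing (family_sum {(\<alpha>, s)}) x\<bar>" "snd ` P \<subseteq> snd ` {(\<alpha>, s)}"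
      by (rule family_localize[OF f])
    then show False using m[OF x P(1)] s ge V_supp[OF x(1)] by auto
  qed
qed

text \<open>The vectors built in Step 1 under the assumption that \<open>level 0 c\<close> fails for all \<open>c > 0\<close>.\<close>

definition flat :: "nat \<Rightarrow> real \<Rightarrow> bool" where
  "flat j c \<longleftrightarrow> (\<forall>m. \<exists>x\<in>V m. c \<le> norm_W n x \<and> norm_W n x \<le> 1 \<and>
     (\<forall>R. family (W n) j R \<longrightarrow> (\<forall>p\<in>R. Min (supp x) < snd p) \<longrightarrow> \<bar>pairing (family_sum R) x\<bar> \<le> 1 / real (m + 1)))"

lemma norm_pos_supp:
  assumes "0 < norm_W n x"
  shows "supp x \<noteq> {}"
proof
  assume "supp x = {}"
  then have "norm_W n x \<le> 0" by (intro norm_W_leI) (simp add: pairing_def)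
  with assms show False by simp
qed

lemma Min_supp_V: "x \<in> V m \<Longrightarrow> supp x \<noteq> {} \<Longrightarrow> m < Min (supp x)"
  using V_supp V_c00 by (simp add: c00_def)

text \<open>Any far normalized vector will do: sizes beyond the start of its support are large
  enough for \<open>small_averages\<close>.\<close>

lemma flat_0:
  assumes no: "\<And>c. 0 < c \<Longrightarrow> \<not> level 0 c"
  shows "flat 0 1"
  unfolding flat_def
proof
  fix m :: nat
  obtain m1 where m1: "\<And>x s \<alpha>. x \<in> V m1 \<Longrightarrow> norm_W n x \<le> 1 \<Longrightarrow> m1 < s \<Longrightarrow> \<alpha> \<in> averages (W n) s \<Longrightarrow>
    \<bar>pairing \<alpha> x\<bar> < 1 / real (m + 1)" using small_averages[OF no, of "1 / real (m + 1)"] by auto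
  obtain x where x: "x \<in> V (max m m1)" "norm_W n x = 1" using V_norm by blast
  have xm: "x \<in> V m" "x \<in> V m1" using V_mono[OF x(1)] by auto
  have "\<bar>pairing (family_sum R) x\<bar> \<le> 1 / real (m + 1)"
    if R: "family (W n) 0 R" "\<forall>p\<in>R. Min (supp x) < snd p" for R
  proof -
    obtain p where p: "R = {p}" using family_0 R by blast
    have "m1 < Min (supp x)" using Min_supp_V[OF xm(2)] norm_pos_supp[of x] x by simp
    then have "\<bar>pairing (fst p) x\<bar> < 1 / real (m + 1)"
      using R p x xm familyD(4)[OF R(1), of p] by (intro m1[of x "snd p"]) auto
    then show ?thesis by (simp add: p)
  qed
  then show "\<exists>x\<in>V m. 1 \<le> norm_W n x \<and> norm_W n x \<le> 1 \<and>
     (\<forall>R. family (W n) 0 R \<longrightarrow> (\<forall>p\<in>R. Min (supp x) < snd p) \<longrightarrow> \<bar>pairing (family_sum R) x\<bar> \<le> 1 / real (m + 1))"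
    using x xm by (intro bexI[of _ x]) auto
qed

text \<open>Bounds all coordinates and sizes in a pair of vector and family, for use as
  \<open>B\<close> in \<open>fast_sequence\<close>. The 0 keeps the maximum defined when all
  supports are empty.\<close>

definition cell_bound :: "(nat \<Rightarrow> real) \<times> ((nat \<Rightarrow> real) \<times> nat) set \<Rightarrow> nat" where
  "cell_bound z = Max (insert 0 (supp (fst z) \<union> supp (family_sum (snd z)) \<union> snd ` snd z))"

lemma cell_bound:
  assumes "x \<in> c00" "family (W n) j P"
  shows "u \<in> supp x \<Longrightarrow> u \<le> cell_bound (x, P)" "u \<in> supp (family_sum P) \<Longrightarrow> u \<le> cell_bound (x, P)"
    "p \<in> P \<Longrightarrow> snd p \<le> cell_bound (x, P)"
proof -
  have "finite (supp x)" "finite P" using assms familyD(1) by (auto simp: c00_def)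
  moreover have "finite (supp (family_sum P))"
    unfolding supp_family_sum[OF assms(2)] using family_supp[OF assms(2)] \<open>finite P\<close> by blast
  ultimately have fin: "finite (insert 0 (supp x \<union> supp (family_sum P) \<union> snd ` P))" by simp
  show "u \<in> supp x \<Longrightarrow> u \<le> cell_bound (x, P)" "u \<in> supp (family_sum P) \<Longrightarrow> u \<le> cell_bound (x, P)" "p \<in> P \<Longrightarrow> snd p \<le> cell_bound (x, P)"
    unfolding cell_bound_def fst_conv snd_conv by (rule Max_ge[OF fin]; simp)+
qed

text \<open>A dichotomy. If flatness at the next level fails with the old constant, all far vectors
  of norm between \<open>c\<close> and 1 admit S_(j+1) sums above a fixed \<open>e\<close>. Averages
  of flat vectors are then flat at the next level, and the joined sums keep their norm at least
  \<open>e\<close>.\<close>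

lemma flat_Suc:
  assumes no: "\<And>c. 0 < c \<Longrightarrow> \<not> level 0 c" and j: "Suc j < n" and c: "0 < c" "flat j c"
  shows "\<exists>c>0. flat (Suc j) c"
proof (cases "flat (Suc j) c")
  case True
  then show ?thesis using c by blast
next
  case False
  then obtain m0 where m0: "\<And>x. x \<in> V m0 \<Longrightarrow> c \<le> norm_W n x \<Longrightarrow> norm_W n x \<le> 1 \<Longrightarrow>
     \<exists>R. family (W n) (Suc j) R \<and> (\<forall>p\<in>R. Min (supp x) < snd p) \<and> 1 / real (m0 + 1) < \<bar>pairing (family_sum R) x\<bar>"
    unfolding flat_def by (meson not_le)
  define e where "e = 1 / real (m0 + 1)"
  have e: "0 < e" by (simp add: e_def)
  have "flat (Suc j) e" unfolding flat_def
  proof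
    fix m :: nat
    \<comment> \<open>The three errors of \<open>family_on_average\<close> will each be 1 / N, in
      total 1 / (m + 1).\<close>
    define N where "N = 3 * (m + 1)"
    define \<delta> where "\<delta> = 1 / real N"
    have \<delta>: "0 < \<delta>" by (simp add: \<delta>_def N_def)
    obtain m1 where m1: "\<And>x s \<alpha>. x \<in> V m1 \<Longrightarrow> norm_W n x \<le> 1 \<Longrightarrow> m1 < s \<Longrightarrow> \<alpha> \<in> averages (W n) s \<Longrightarrow>
      \<bar>pairing \<alpha> x\<bar> < \<delta>" using small_averages[OF no[OF \<delta>] \<delta>] by blast
    have "\<bar>1 / real N\<bar> \<le> 1" by (simp add: N_def)
    then obtain m2 where m2: "\<And>x. (\<And>i. i < N \<Longrightarrow> x i \<in> V m2) \<Longrightarrow> lin_comb {..<N} (\<lambda>_. 1 / real N) x \<in> V m"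
      using V_lin_comb by metis
    define \<Phi> where "\<Phi> k z \<longleftrightarrow> (case z of (x, P) \<Rightarrow> x \<in> V k \<and> norm_W n x \<le> 1 \<and>
      family (W n) (Suc j) P \<and> (\<forall>p\<in>P. k < snd p) \<and> supp (family_sum P) \<subseteq> supp x \<and> e \<le> pairing (family_sum P) x \<and>
      (\<forall>R. family (W n) j R \<longrightarrow> (\<forall>p\<in>R. Min (supp x) < snd p) \<longrightarrow> \<bar>pairing (family_sum R) x\<bar> \<le> \<delta> / real (k + 1)))"
      for k z
    have "\<exists>z. \<Phi> k z" for k
    proof -
      \<comment> \<open>Far enough for \<open>m0\<close> to apply and for 1 / (K + 1) to be at most
        \<open>\<delta> / (k + 1)\<close>.\<close>
      define K where "K = N * (k + 1) + m0"
      have Kk: "k \<le> K" "m0 \<le> K" using le_mult_add_one[of N k] by (simp_all add: K_def N_def)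
      obtain x where x: "x \<in> V K" "c \<le> norm_W n x" "norm_W n x \<le> 1"
        and xR: "\<And>R. family (W n) j R \<Longrightarrow> (\<forall>p\<in>R. Min (supp x) < snd p) \<Longrightarrow> \<bar>pairing (family_sum R) x\<bar> \<le> 1 / real (K + 1)"
        using c(2) unfolding flat_def by blast
      have xm: "x \<in> V k" "x \<in> V m0" using V_mono[OF x(1)] Kk by auto
      have lo: "k < Min (supp x)" by (rule Min_supp_V[OF xm(1)], rule norm_pos_supp) (use x c in simp)
      obtain R where R: "family (W n) (Suc j) R" "\<forall>p\<in>R. Min (supp x) < snd p" "e < \<bar>pairing (family_sum R) x\<bar>"
        using m0[OF xm(2) x(2,3)] unfolding e_def by blast
      have "pairing (family_sum R) x \<noteq> 0" using R(3) e by auto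
      then obtain P where P: "family (W n) (Suc j) P" "supp (family_sum P) \<subseteq> supp x"
        "pairing (family_sum P) x = \<bar>pairing (family_sum R) x\<bar>" "snd ` P \<subseteq> snd ` R"
        by (rule family_localize[OF R(1)])
      have "1 / real (K + 1) \<le> \<delta> / real (k + 1)"
      proof -
        have "real N * real (k + 1) \<le> real (K + 1)" by (simp add: K_def algebra_simps)
        then have "1 / real (K + 1) \<le> 1 / (real N * real (k + 1))"
          by (intro divide_left_mono) (auto simp: N_def)
        then show ?thesis by (simp add: \<delta>_def)
      qed
      moreover have "\<forall>p\<in>P. k < snd p" using P(4) R(2) lo by (fastforce simp: image_subset_iff)
      ultimately have "\<Phi> k (x, P)"
        using xm x P R(3) xR unfolding \<Phi>_def by (fastforce intro: order_trans)
      then show ?thesis by blast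
    qed
    then obtain z and k :: "nat \<Rightarrow> nat" where z: "\<And>i. \<Phi> (k i) (z i)" and k0: "\<And>i. max (max m m1) (max m2 N) \<le> k i"
      and Bz: "\<And>i i'. i < i' \<Longrightarrow> cell_bound (z i) < k i'" and km: "\<And>i i'. i < i' \<Longrightarrow> k i < k i'"
      by (rule fast_sequence[where \<Phi> = \<Phi> and M = "max (max m m1) (max m2 N)" and B = cell_bound]) (rule that)
    define x where "x i = fst (z i)" for i
    define P where "P i = snd (z i)" for i
    have zi: "z i = (x i, P i)" for i by (simp add: x_def P_def)
    have xV: "x i \<in> V (k i)" "norm_W n (x i) \<le> 1" and P: "family (W n) (Suc j) (P i)" "\<And>p. p \<in> P i \<Longrightarrow> k i < snd p"
      "supp (family_sum (P i)) \<subseteq> supp (x i)" "e \<le> pairing (family_sum (P i)) (x i)"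
      and xR: "\<And>R. family (W n) j R \<Longrightarrow> (\<forall>p\<in>R. Min (supp (x i)) < snd p) \<Longrightarrow> \<bar>pairing (family_sum R) (x i)\<bar> \<le> \<delta> / real (k i + 1)" for i
      using z[of i] unfolding \<Phi>_def zi by auto
    have xc: "x i \<in> c00" for i using xV V_c00 by blast
    have lox: "k i < u" if "u \<in> supp (x i)" for i u using V_supp xV that by blast
    have hix: "u < k i'" if "i < i'" "u \<in> supp (x i)" for i i' u
      using cell_bound(1)[OF xc P(1)[of i] that(2)] Bz[OF that(1)] unfolding zi by linarith
    have his: "snd p < k i'" if "i < i'" "p \<in> P i" for i i' p
      using cell_bound(3)[OF xc P(1) that(2)] Bz[OF that(1)] unfolding zi by (meson le_less_trans)
    define y where "y = lin_comb {..<N} (\<lambda>_. 1 / real N) x"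
    have N1: "1 \<le> N" by (simp add: N_def)
    have yV: "y \<in> V m" unfolding y_def
      by (rule m2, rule V_mono[OF xV(1)]) (use k0 in auto)
    have y1: "norm_W n y \<le> 1" unfolding y_def by (rule norm_W_average_le) (use xc xV in auto)
    have sub: "u \<in> supp (x i)" if "u \<in> supp (family_sum (P i))" for i u using P(3) that by blast
    have kN: "N \<le> k i" for i using k0[of i] by simp
    note fa = family_average[of N x k n "Suc j" P e, OF N1 xc lox hix P(1) _ _ P(2) his kN P(4)]
    have "family (W n) (Suc (Suc j)) (\<Union>i<N. P i)" "e \<le> pairing (family_sum (\<Union>i<N. P i)) y"
      unfolding y_def by (rule fa; use lox hix sub in blast)+
    \<comment> \<open>The union has level j + 2, which is at most \<open>n\<close>, so its sum
      belongs to \<open>W\<close>.\<close>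
    then have ye: "e \<le> norm_W n y" using family_sum_W_le[of n "Suc (Suc j)"] pairing_le_norm[of _ n y] j by fastforce
    have "supp y \<noteq> {}" by (rule norm_pos_supp) (use ye e in simp)
    have loy: "m1 < Min (supp y)"
    proof -
      have "Min (supp y) \<in> supp y" using \<open>supp y \<noteq> {}\<close> V_c00[OF yV] by (auto simp: c00_def)
      then obtain i where "Min (supp y) \<in> supp (x i)" using supp_lin_comb unfolding y_def by blast
      then show ?thesis using lox[of _ i] k0[of i] by fastforce
    qed
    have yR: "\<bar>pairing (family_sum R) y\<bar> \<le> 1 / real (m + 1)"
      if R: "family (W n) (Suc j) R" "\<forall>p\<in>R. Min (supp y) < snd p" for R
    proof -
      have "\<bar>pairing (family_sum R) y\<bar> \<le> 1 / real N + \<delta> + \<delta>" unfolding y_def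
      proof (rule family_on_average[OF R(1), where \<epsilon> = "\<lambda>i. \<delta> / real (k i + 1)"])
        show "\<bar>pairing (fst p) (x i)\<bar> \<le> \<delta>" if "p \<in> R" for p i
        proof (rule less_imp_le, rule m1[of "x i" "snd p"])
          show "x i \<in> V m1" using V_mono[OF xV(1)] k0[of i] by simp
          show "m1 < snd p" using R(2) that loy by (meson less_trans)
        qed (use xV familyD(4)[OF R(1) that] in auto)
        show "real u * (\<delta> / real (k i' + 1)) \<le> \<delta>" if "i < i'" "u \<in> supp (x i)" for i i' u
        proof -
          have "real u * (\<delta> / real (k i' + 1)) \<le> real (k i' + 1) * (\<delta> / real (k i' + 1))"
            using hix[OF that] \<delta> by (intro mult_right_mono) auto
          then show ?thesis by simp
        qed
      qed (use N1 xc xV xR \<delta> j in auto)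
      also have "\<dots> = 1 / real (m + 1)" by (simp add: \<delta>_def N_def field_simps)
      finally show ?thesis .
    qed
    show "\<exists>x\<in>V m. e \<le> norm_W n x \<and> norm_W n x \<le> 1 \<and>
     (\<forall>R. family (W n) (Suc j) R \<longrightarrow> (\<forall>p\<in>R. Min (supp x) < snd p) \<longrightarrow> \<bar>pairing (family_sum R) x\<bar> \<le> 1 / real (m + 1))"
      using yV ye y1 yR by blast
  qed
  then show ?thesis using e by blast
qed

text \<open>Otherwise flatness climbs to level n - 1. There \<open>norm_W_sum_le\<close> bounds a
  sum of \<open>N\<close> vectors by 3, while an average of size \<open>N\<close> has value at least
  c / 2 on it. For \<open>N\<close> beyond \<open>ms\<close> this contradicts
  \<open>small_averages\<close>.\<close>

lemma level_0: "\<exists>c>0. level 0 c"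
proof (rule ccontr)
  assume "\<not> (\<exists>c>0. level 0 c)"
  then have no: "\<not> level 0 c" if "0 < c" for c using that by blast
  have fl: "j < n \<Longrightarrow> \<exists>c>0. flat j c" for j
  proof (induction j)
    case 0
    then show ?case using flat_0[OF no] zero_less_one by blast
  next
    case (Suc j)
    then show ?case using flat_Suc[OF no, of j] by auto
  qed
  obtain j where nj: "n = Suc j" using n1 by (cases n) auto
  obtain c where c: "0 < c" "flat j c" using fl[of j] nj by auto
  obtain ms where ms: "\<And>x s \<alpha>. x \<in> V ms \<Longrightarrow> norm_W n x \<le> 1 \<Longrightarrow> ms < s \<Longrightarrow> \<alpha> \<in> averages (W n) s \<Longrightarrow>
    \<bar>pairing \<alpha> x\<bar> < c / 8" using small_averages[OF no, of "c / 8"] c by auto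
  \<comment> \<open>Above \<open>ms\<close>, and at least 2, as a size must be.\<close>
  define N where "N = ms + 2"
  \<comment> \<open>Makes the error term in \<open>norm_W_sum_le\<close>, where the bound on each
    tail will be twice \<open>\<tau>\<close>, equal to 1.\<close>
  define \<tau> where "\<tau> = 1 / (2 * real N * real N)"
  have \<tau>: "0 < \<tau>" by (simp add: \<tau>_def N_def)
  obtain m1 where m1: "\<And>x s \<alpha>. x \<in> V m1 \<Longrightarrow> norm_W n x \<le> 1 \<Longrightarrow> m1 < s \<Longrightarrow> \<alpha> \<in> averages (W n) s \<Longrightarrow>
    \<bar>pairing \<alpha> x\<bar> < \<tau>" using small_averages[OF no[OF \<tau>] \<tau>] by blast
  have "\<bar>1 / 4 :: real\<bar> \<le> 1" by simp
  then obtain m2 where m2: "\<And>x. (\<And>i. i < N \<Longrightarrow> x i \<in> V m2) \<Longrightarrow> lin_comb {..<N} (\<lambda>_. 1 / 4) x \<in> V ms"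
    using V_lin_comb by metis
  define \<Phi> where "\<Phi> k x \<longleftrightarrow> x \<in> V k \<and> c \<le> norm_W n x \<and> norm_W n x \<le> 1 \<and>
      (\<forall>R. family (W n) j R \<longrightarrow> (\<forall>p\<in>R. Min (supp x) < snd p) \<longrightarrow> \<bar>pairing (family_sum R) x\<bar> \<le> \<tau> / real (k + 1))"
    for k x
  have "\<exists>x. \<Phi> k x" for k
  proof -
    define K where "K = 2 * N * N * (k + 1)"
    have Kk: "k \<le> K" unfolding K_def by (rule le_mult_add_one) (simp add: N_def)
    obtain x where x: "x \<in> V K" "c \<le> norm_W n x" "norm_W n x \<le> 1"
      and xR: "\<And>R. family (W n) j R \<Longrightarrow> (\<forall>p\<in>R. Min (supp x) < snd p) \<Longrightarrow> \<bar>pairing (family_sum R) x\<bar> \<le> 1 / real (K + 1)"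
      using c(2) unfolding flat_def by blast
    have "1 / real (K + 1) \<le> 1 / real K" by (rule inverse_nat_mono) (auto simp: K_def N_def)
    also have "real K = 2 * real N * real N * real (k + 1)"
      unfolding K_def by (simp only: of_nat_mult of_nat_numeral)
    also have "1 / (2 * real N * real N * real (k + 1)) = \<tau> / real (k + 1)" by (simp add: \<tau>_def)
    finally show ?thesis using V_mono[OF x(1) Kk] x xR unfolding \<Phi>_def by (meson order_trans)
  qed
  then obtain x and k :: "nat \<Rightarrow> nat" where x: "\<And>i. \<Phi> (k i) (x i)" and k0: "\<And>i. max m1 m2 \<le> k i"
    and Bx: "\<And>i i'. i < i' \<Longrightarrow> Max (insert 0 (supp (x i))) < k i'" and km: "\<And>i i'. i < i' \<Longrightarrow> k i < k i'"
    by (rule fast_sequence[where \<Phi> = \<Phi> and M = "max m1 m2" and B = "\<lambda>x. Max (insert 0 (supp x))"]) (rule that)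
  have xV: "x i \<in> V (k i)" "c \<le> norm_W n (x i)" "norm_W n (x i) \<le> 1"
    and xR: "\<And>R. family (W n) j R \<Longrightarrow> (\<forall>p\<in>R. Min (supp (x i)) < snd p) \<Longrightarrow> \<bar>pairing (family_sum R) (x i)\<bar> \<le> \<tau> / real (k i + 1)" for i
    using x[of i] unfolding \<Phi>_def by auto
  have xc: "x i \<in> c00" for i using xV V_c00 by blast
  have lox: "k i < u" if "u \<in> supp (x i)" for i u using V_supp xV that by blast
  have hix: "u < k i'" if "i < i'" "u \<in> supp (x i)" for i i' u
  proof -
    have "u \<le> Max (insert 0 (supp (x i)))" using that xc[of i] by (intro Max_ge) (auto simp: c00_def)
    then show ?thesis using Bx[OF that(1)] by simp
  qed
  have succ: "successive I x" for I
    unfolding successive_def using hix lox by (meson less_trans)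
  have N2: "2 \<le> N" by (simp add: N_def)
  have "norm_W n (lin_comb {0..<N} (\<lambda>_. 1) x) \<le> 2 + real (N - 0) * (real N * (2 * \<tau>))"
  proof (rule norm_W_sum_le[OF n1 _ succ])
    fix P Q i i0 u assume P: "family (W n) n P" "Q \<subseteq> P" and i: "i0 < i" and u: "u \<in> supp (family_sum P)" "u \<in> supp (x i0)"
      and size: "\<forall>p\<in>Q. Min (supp (x i0)) < snd p"
    have "\<bar>\<Sum>p\<in>Q. pairing (fst p) (x i)\<bar> \<le> \<tau> + real u * (\<tau> / real (k i + 1))"
    proof (rule family_on_vector[OF _ P(2) Min_first_index_le[OF P(1) u(1)]])
      show "family (W n) (Suc j) P" using P nj by simp
      fix p assume p: "p \<in> Q"
      have "m1 < Min (supp (x i0))"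
      proof (rule Min_supp_V)
        show "x i0 \<in> V m1" using V_mono[OF xV(1)] k0[of i0] by simp
      qed (use u in auto)
      then have "m1 < snd p" using size p by (meson less_trans)
      moreover have "x i \<in> V m1" using V_mono[OF xV(1)] k0[of i] by simp
      ultimately show "\<bar>pairing (fst p) (x i)\<bar> \<le> \<tau>"
        using xV familyD(4)[OF P(1), of p] P(2) p
        by (intro less_imp_le[OF m1[of "x i" "snd p"]]) auto
    qed (use \<tau> xc xR in auto)
    also have "\<dots> \<le> \<tau> + real (k i + 1) * (\<tau> / real (k i + 1))"
      using hix[OF i u(2)] \<tau> by (intro add_mono mult_right_mono) auto
    finally show "\<bar>\<Sum>p\<in>Q. pairing (fst p) (x i)\<bar> \<le> 2 * \<tau>" by simp
  qed (use xc xV \<tau> in auto)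
  also have "\<dots> = 3" using N2 by (simp add: \<tau>_def)
  finally have S: "norm_W n (lin_comb {0..<N} (\<lambda>_. 1) x) \<le> 3" .
  \<comment> \<open>The factor 1/4 brings the norm from 3 below 1. The value c / 2 of the average
    becomes c / 8, the threshold for which \<open>ms\<close> was chosen.\<close>
  define u where "u = lin_comb {..<N} (\<lambda>_. 1 / 4) x"
  have uV: "u \<in> V ms" unfolding u_def by (rule m2, rule V_mono[OF xV(1)]) (use k0 in auto)
  have "norm_W n u \<le> 1"
  proof -
    have u_eq: "u = lin_comb {0 :: nat} (\<lambda>_. 1 / 4) (\<lambda>_. lin_comb {0..<N} (\<lambda>_. 1) x)"
      by (simp add: u_def lin_comb_def sum_divide_distrib atLeast0LessThan fun_eq_iff)
    have "lin_comb {0..<N} (\<lambda>_. 1) x \<in> c00" using xc by (intro lin_comb_c00) auto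
    then have "norm_W n u \<le> (\<Sum>i\<in>{0 :: nat}. \<bar>1 / 4\<bar> * norm_W n (lin_comb {0..<N} (\<lambda>_. 1) x))"
      unfolding u_eq by (intro norm_W_lin_comb) auto
    then show ?thesis using S by simp
  qed
  have "\<exists>g. g \<in> W n \<and> supp g \<subseteq> supp (x i) \<and> c / 2 \<le> pairing g (x i)" for i
  proof -
    have "c / 2 < norm_W n (x i)" using xV(2)[of i] c by linarith
    then obtain f where f: "f \<in> W n" "c / 2 < pairing f (x i)" by (rule less_norm_W)
    then have "supp f \<inter> supp (x i) \<noteq> {}" using pairing_disjoint[of f "x i"] c by auto
    then have "restr (supp (x i)) f \<in> W n" using restr_W f by blast
    then show ?thesis using f by (intro exI[of _ "restr (supp (x i)) f"]) (auto simp: pairing_restr)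
  qed
  then obtain g where g: "\<And>i. g i \<in> W n" "\<And>i. supp (g i) \<subseteq> supp (x i)" "\<And>i. c / 2 \<le> pairing (g i) (x i)"
    by metis
  have gb: "vec_before (g i) (g i')" if "i < i'" for i i'
  proof (rule vec_beforeI)
    fix a b assume "a \<in> supp (g i)" "b \<in> supp (g i')"
    then show "a < b" using g(2) successiveD[OF succ[of UNIV] _ _ that, of a b] by blast
  qed (use W_supp[OF g(1)] in simp_all)
  have ginj: "inj g"
  proof (rule linorder_injI)
    fix i i' :: nat assume "i < i'"
    then show "g i \<noteq> g i'" using vec_before_Min[OF gb] by fastforce
  qed
  define \<alpha> where "\<alpha> = (\<lambda>t. (\<Sum>i<N. g i t) / real N)"
  have "\<alpha> \<in> averages (W n) N"
    unfolding averages_iff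
  proof (intro exI[of _ "g ` {..<N}"] conjI)
    show "vec_chain (\<lambda>g. g) (g ` {..<N})"
      unfolding vec_chain_def
    proof (intro ballI impI)
      fix a b assume ab: "a \<in> g ` {..<N}" "b \<in> g ` {..<N}" "a \<noteq> b"
      then obtain i i' where i: "a = g i" "b = g i'" by blast
      with ab have "i \<noteq> i'" by auto
      then show "vec_before a b \<or> vec_before b a"
        unfolding i using gb[of i i'] gb[of i' i] by (cases i i' rule: linorder_cases) auto
    qed
    show "\<alpha> = (\<lambda>i. (\<Sum>h\<in>g ` {..<N}. h i) / real N)"
      unfolding \<alpha>_def by (simp add: sum.reindex[OF inj_on_subset[OF ginj]])
  qed (use N2 g card_image_le[of "{..<N}" g] in \<open>auto simp: lessThan_empty_iff\<close>)
  then have "\<bar>pairing \<alpha> u\<bar> < c / 8"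
    by (intro ms[OF uV \<open>norm_W n u \<le> 1\<close>]) (simp_all add: N_def)
  moreover have "c / 2 \<le> pairing (\<lambda>t. \<Sum>i<N. g i t) (lin_comb {..<N} (\<lambda>_. 1 / real N) x)"
  proof (rule pairing_cross)
    fix i i' :: nat assume "i \<noteq> i'"
    show "pairing (g i) (x i') = 0"
    proof (rule pairing_disjoint, rule equals0I)
      fix v assume "v \<in> supp (g i) \<inter> supp (x i')"
      then have v: "v \<in> supp (x i)" "v \<in> supp (x i')" using g(2) by blast+
      show False using \<open>i \<noteq> i'\<close> successiveD[OF succ[of UNIV], of i i' v v]
        successiveD[OF succ[of UNIV], of i' i v v] v by (cases i i' rule: linorder_cases) auto
    qed
  qed (use N2 xc g in auto)
  moreover have "pairing \<alpha> u = pairing (\<lambda>t. \<Sum>i<N. g i t) (lin_comb {..<N} (\<lambda>_. 1 / real N) x) / 4"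
  proof -
    have "pairing f (lin_comb {..<N} (\<lambda>_. d) x) = d * (\<Sum>i<N. pairing f (x i))" for f d
      by (subst pairing_lin_comb) (use xc in \<open>auto simp: sum_distrib_left\<close>)
    then show ?thesis unfolding u_def \<alpha>_def pairing_divide_left using N2 by simp
  qed
  ultimately show False by linarith
qed

section \<open>Cells and their averages\<close>

text \<open>A vector with a detecting family as \<open>level j c\<close> provides them, placed deep
  enough for \<open>average_good\<close> with target \<open>m\<close> and separator
  \<open>k\<close>.\<close>

definition cell :: "nat \<Rightarrow> real \<Rightarrow> nat \<Rightarrow> nat \<Rightarrow> (nat \<Rightarrow> real) \<times> ((nat \<Rightarrow> real) \<times> nat) set \<Rightarrow> bool" where
  "cell j c m k z \<longleftrightarrow> fst z \<in> V (8 * (m + 1) * (k + 1)) \<and> norm_W n (fst z) \<le> 1 \<and>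
     (\<forall>j'. j = Suc j' \<longrightarrow> good n j' (1 / real (8 * (m + 1) * (k + 1))) (fst z)) \<and>
     family (W n) j (snd z) \<and> (\<forall>p\<in>snd z. k < snd p) \<and> (\<forall>u\<in>supp (family_sum (snd z)). k < u) \<and>
     c \<le> pairing (family_sum (snd z)) (fst z)"

lemma cell_ex:
  assumes c: "level j c"
  shows "\<exists>z. cell j c m k z"
proof -
  define K where "K = 8 * (m + 1) * (k + 1)"
  have Kk: "k \<le> K" unfolding K_def by (rule le_mult_add_one) simp
  have "0 < K" by (simp add: K_def)
  obtain x P where x: "x \<in> V K" "norm_W n x \<le> 1" "\<And>j'. j = Suc j' \<Longrightarrow> good n j' (1 / real (K + 1)) x"
    and P: "family (W n) j P" "\<forall>p\<in>P. K < snd p" "\<forall>u\<in>supp (family_sum P). K < u" "c \<le> pairing (family_sum P) x"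
    using c unfolding level_def by blast
  have "1 / real (K + 1) \<le> 1 / real K" using \<open>0 < K\<close> by (intro divide_left_mono) auto
  then have "good n j' (1 / real K) x" if "j = Suc j'" for j'
    using x(3)[OF that] unfolding good_def by (meson add_left_mono order_trans)
  then have "cell j c m k (x, P)" using x P Kk unfolding cell_def K_def by auto
  then show ?thesis by blast
qed

lemma cells:
  assumes z: "\<And>i. cell j c m (k i) (z i)" and Bz: "\<And>i i'. i < i' \<Longrightarrow> cell_bound (z i) < k i'"
  shows "fst (z i) \<in> c00" "fst (z i) \<in> V (k i)" "norm_W n (fst (z i)) \<le> 1"
    "u \<in> supp (fst (z i)) \<Longrightarrow> 8 * (m + 1) * (k i + 1) < u" "u \<in> supp (fst (z i)) \<Longrightarrow> k i < u"
    "i < i' \<Longrightarrow> u \<in> supp (fst (z i)) \<Longrightarrow> u < k i'"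
    "j = Suc j' \<Longrightarrow> good n j' (1 / real (8 * (m + 1) * (k i + 1))) (fst (z i))"
    "family (W n) j (snd (z i))" "u \<in> supp (family_sum (snd (z i))) \<Longrightarrow> k i < u"
    "i < i' \<Longrightarrow> u \<in> supp (family_sum (snd (z i))) \<Longrightarrow> u < k i'"
    "p \<in> snd (z i) \<Longrightarrow> k i < snd p" "i < i' \<Longrightarrow> p \<in> snd (z i) \<Longrightarrow> snd p < k i'"
    "c \<le> pairing (family_sum (snd (z i))) (fst (z i))"
proof -
  have zi: "fst (z i) \<in> V (8 * (m + 1) * (k i + 1))" "norm_W n (fst (z i)) \<le> 1"
     "\<And>j'. j = Suc j' \<Longrightarrow> good n j' (1 / real (8 * (m + 1) * (k i + 1))) (fst (z i))"
     "family (W n) j (snd (z i))" "\<And>p. p \<in> snd (z i) \<Longrightarrow> k i < snd p"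
     "\<And>u. u \<in> supp (family_sum (snd (z i))) \<Longrightarrow> k i < u" "c \<le> pairing (family_sum (snd (z i))) (fst (z i))"
    using z[of i] unfolding cell_def by blast+
  have kle: "k i \<le> 8 * (m + 1) * (k i + 1)" by (rule le_mult_add_one) simp
  show xc: "fst (z i) \<in> c00" using zi V_c00 by blast
  show "fst (z i) \<in> V (k i)" using V_mono[OF zi(1) kle] .
  show lo: "8 * (m + 1) * (k i + 1) < u" if "u \<in> supp (fst (z i))" using V_supp zi(1) that by blast
  show "k i < u" if "u \<in> supp (fst (z i))" using lo[OF that] kle by linarith
  note b = cell_bound[OF xc zi(4), unfolded prod.collapse]
  show "u < k i'" if "i < i'" "u \<in> supp (fst (z i))"
    using b(1)[OF that(2)] Bz[OF that(1)] by linarith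
  show "u < k i'" if "i < i'" "u \<in> supp (family_sum (snd (z i)))"
    using b(2)[OF that(2)] Bz[OF that(1)] by linarith
  show "snd p < k i'" if "i < i'" "p \<in> snd (z i)"
    using b(3)[OF that(2)] Bz[OF that(1)] by linarith
qed (use z[of i] in \<open>auto simp: cell_def\<close>)

text \<open>\<open>average_good\<close> raises the goodness and \<open>family_average\<close> the
  level of the detecting family, with the same \<open>c\<close>.\<close>

lemma level_Suc:
  assumes j: "Suc j \<le> n" and c: "level j c"
  shows "level (Suc j) c"
  unfolding level_def
proof
  fix m :: nat
  define N where "N = 2 * (m + 1)"
  have N1: "1 \<le> N" by (simp add: N_def)
  have "\<bar>1 / real N\<bar> \<le> 1" by (simp add: N_def)
  then obtain m2 where m2: "\<And>x. (\<And>i. i < N \<Longrightarrow> x i \<in> V m2) \<Longrightarrow> lin_comb {..<N} (\<lambda>_. 1 / real N) x \<in> V m"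
    using V_lin_comb by metis
  have "\<exists>z. cell j c m k z" for k by (rule cell_ex[OF c])
  then obtain z and k :: "nat \<Rightarrow> nat" where z: "\<And>i. cell j c m (k i) (z i)" and k0: "\<And>i. max (max m m2) N \<le> k i"
    and Bz: "\<And>i i'. i < i' \<Longrightarrow> cell_bound (z i) < k i'" and km: "\<And>i i'. i < i' \<Longrightarrow> k i < k i'"
    by (rule fast_sequence[where \<Phi> = "cell j c m" and M = "max (max m m2) N" and B = cell_bound]) (rule that)
  define x where "x i = fst (z i)" for i
  define P where "P i = snd (z i)" for i
  note C = cells[of j c m k z, OF z Bz, folded x_def P_def]
  define y where "y = lin_comb {..<N} (\<lambda>_. 1 / real N) x"
  have yV: "y \<in> V m" unfolding y_def
    by (rule m2, rule V_mono[OF C(2)]) (use k0 in auto)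
  have y1: "norm_W n y \<le> 1" unfolding y_def by (rule norm_W_average_le) (use C in auto)
  have kN: "N \<le> k i" for i using k0[of i] by simp
  note fa = family_average[of N x k n j P c, OF N1 C(1,5,6,8-12) kN C(13)]
  have R: "family (W n) (Suc j) (\<Union>i<N. P i)" "c \<le> pairing (family_sum (\<Union>i<N. P i)) y"
    unfolding y_def by (rule fa; assumption)+
  have "good n j (1 / real (m + 1)) y" unfolding y_def
    by (rule average_good[OF N_def, of j n x k]) (use j C in auto)
  moreover have "m < snd p" if p: "p \<in> (\<Union>i<N. P i)" for p
  proof -
    obtain i where "p \<in> P i" using p by blast
    then show ?thesis using C(11) k0[of i] by fastforce
  qed
  moreover have "m < u" if u: "u \<in> supp (family_sum (\<Union>i<N. P i))" for u
  proof -
    obtain i p where "p \<in> P i" "u \<in> supp (fst p)" using u supp_family_sum[OF R(1)] by blast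
    then have "u \<in> supp (family_sum (P i))" using supp_family_sum[OF C(8)] by blast
    then show ?thesis using C(9) k0[of i] by fastforce
  qed
  ultimately show "\<exists>x P. x \<in> V m \<and> norm_W n x \<le> 1 \<and>
     (\<forall>j'. Suc j = Suc j' \<longrightarrow> good n j' (1 / real (m + 1)) x) \<and>
     family (W n) (Suc j) P \<and> (\<forall>p\<in>P. m < snd p) \<and> (\<forall>u\<in>supp (family_sum P). m < u) \<and> c \<le> pairing (family_sum P) x"
    using yV y1 R by (intro exI[of _ y] exI[of _ "\<Union>i<N. P i"]) auto
qed

lemma level_ex: "j \<le> n \<Longrightarrow> \<exists>c>0. level j c"
proof (induction j)
  case 0
  show ?case by (rule level_0)
next
  case (Suc j)
  then show ?case using level_Suc by (meson Suc_leD)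
qed

text \<open>The families of the cells have level n - 1. At most \<open>N\<close> of them are joined
  and all begin beyond \<open>N\<close>, so every union over an interval is S_n-admissible and its
  sum lies in \<open>W\<close>. Supports lie strictly above \<open>k i\<close>, hence the i-th cell
  starts at \<open>Suc (k i)\<close>.\<close>

lemma cells_block:
  assumes N: "N = 2 * (m + 1)" and nj: "n = Suc j" and z: "\<And>i. cell j c m (k i) (z i)"
    and Bz: "\<And>i i'. i < i' \<Longrightarrow> cell_bound (z i) < k i'" and km: "\<And>i i'. i < i' \<Longrightarrow> k i < k i'"
    and k0: "\<And>i. max (max m m2) N \<le> k i"
    and m2: "\<And>x. (\<And>i. i < N \<Longrightarrow> x i \<in> V m2) \<Longrightarrow> lin_comb {..<N} (\<lambda>_. 1 / real N) x \<in> V m"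
  shows "block n c V m N (\<lambda>i. Suc (k i)) (\<lambda>i. fst (z i)) (\<lambda>i. family_sum (snd (z i)))"
proof -
  define x where "x i = fst (z i)" for i
  define P where "P i = snd (z i)" for i
  note C = cells[of j c m k z, OF z Bz, folded x_def P_def]
  have kN: "N \<le> k i" for i using k0[of i] by simp
  have "(\<lambda>t. \<Sum>i\<in>{a..<b}. family_sum (P i) t) \<in> W n" if ab: "a < b" "b \<le> N" for a b
  proof -
    have sub: "supp (fst p) \<subseteq> supp (family_sum (P i))" if "p \<in> P i" for i p
      using supp_family_sum[OF C(8)] that by blast
    have cab: "card {a..<b} \<le> k i" for i using ab kN[of i] by simp
    note U = family_Union[of "{a..<b}" n j P k]
    have "family (W n) (Suc j) (\<Union>i\<in>{a..<b}. P i)"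
      by (rule U) (use ab C sub cab in \<open>auto simp: subset_iff\<close>)
    moreover have "family_sum (\<Union>i\<in>{a..<b}. P i) = (\<lambda>t. \<Sum>i\<in>{a..<b}. family_sum (P i) t)"
      by (rule U) (use ab C sub cab in \<open>auto simp: subset_iff\<close>)
    ultimately show ?thesis using family_sum_W unfolding nj by metis
  qed
  moreover have "lin_comb {..<N} (\<lambda>_. 1 / real N) x \<in> V m"
    by (rule m2, rule V_mono[OF C(2)]) (use k0 in auto)
  moreover have "good n j (1 / real (m + 1)) (lin_comb {..<N} (\<lambda>_. 1 / real N) x)"
    by (rule average_good[OF N, of j n x k]) (use nj C in auto)
  moreover have "m < Suc (k 0)" using k0[of 0] by simp
  moreover have "Suc (k i) \<le> u \<and> u < Suc (k (Suc i))" if "u \<in> supp (x i) \<union> supp (family_sum (P i))" for i u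
  proof -
    have "k i < u" using that by (blast intro: C(5) C(9))
    moreover have "u < k (Suc i)" using that lessI[of i] by (blast intro: C(6) C(10))
    ultimately show ?thesis by simp
  qed
  ultimately show ?thesis
    unfolding block_def x_def[symmetric] P_def[symmetric] using N C(1,3,13) km nj
    by (auto simp: subset_iff)
qed

end

text \<open>Both constructions run along one sequence of separators, each new pair chosen beyond
  everything used so far in either space. So the cells coincide, and the smaller of the two
  constants serves both.\<close>

lemma common_blocks:
  assumes A: "asymptotic n V" and B: "asymptotic n V'"
  shows "\<exists>c>0. \<forall>m. \<exists>N \<beta> v \<eta> w \<zeta>. block n c V m N \<beta> v \<eta> \<and> block n c V' m N \<beta> w \<zeta>"
proof -
  interpret A: asymptotic n V by (rule A)
  interpret B: asymptotic n V' by (rule B)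
  obtain j where nj: "n = Suc j" using A.n1 by (cases n) auto
  obtain c1 c2 where c12: "0 < c1" "A.level j c1" "0 < c2" "B.level j c2"
    using A.level_ex[of j] B.level_ex[of j] nj by auto
  define c where "c = min c1 c2"
  have c: "0 < c" using c12 by (simp add: c_def)
  have "c \<le> c1" "c \<le> c2" by (simp_all add: c_def)
  then have cl: "A.level j c" "B.level j c"
    using c12 unfolding A.level_def B.level_def by (meson order_trans)+
  have "\<exists>N \<beta> v \<eta> w \<zeta>. block n c V m N \<beta> v \<eta> \<and> block n c V' m N \<beta> w \<zeta>" for m
  proof -
    define N where "N = 2 * (m + 1)"
    have "\<bar>1 / real N\<bar> \<le> 1" by (simp add: N_def)
    then obtain m1 m2 where m1: "\<And>x. (\<And>i. i < N \<Longrightarrow> x i \<in> V m1) \<Longrightarrow> lin_comb {..<N} (\<lambda>_. 1 / real N) x \<in> V m"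
      and m2: "\<And>x. (\<And>i. i < N \<Longrightarrow> x i \<in> V' m2) \<Longrightarrow> lin_comb {..<N} (\<lambda>_. 1 / real N) x \<in> V' m"
      using A.V_lin_comb B.V_lin_comb by metis
    define \<Phi> where "\<Phi> k z \<longleftrightarrow> A.cell j c m k (fst z) \<and> B.cell j c m k (snd z)" for k z
    define M where "M = max (max (max m m1) m2) N"
    have "\<exists>z. \<Phi> k z" for k
      using A.cell_ex[OF cl(1), of m k] B.cell_ex[OF cl(2), of m k] unfolding \<Phi>_def by auto
    then obtain z and k :: "nat \<Rightarrow> nat" where z: "\<And>i. \<Phi> (k i) (z i)" and k0: "\<And>i. M \<le> k i"
      and Bz: "\<And>i i'. i < i' \<Longrightarrow> max (A.cell_bound (fst (z i))) (B.cell_bound (snd (z i))) < k i'"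
      and km: "\<And>i i'. i < i' \<Longrightarrow> k i < k i'"
      by (rule fast_sequence[where \<Phi> = \<Phi> and M = M and B = "\<lambda>z. max (A.cell_bound (fst z)) (B.cell_bound (snd z))"])
        (rule that)
    have "block n c V m N (\<lambda>i. Suc (k i)) (\<lambda>i. fst (fst (z i))) (\<lambda>i. family_sum (snd (fst (z i))))"
      by (rule A.cells_block[OF N_def nj, of c k "\<lambda>i. fst (z i)" m1])
         (use z Bz km k0 m1 in \<open>auto simp: \<Phi>_def M_def\<close>)
    moreover have "block n c V' m N (\<lambda>i. Suc (k i)) (\<lambda>i. fst (snd (z i))) (\<lambda>i. family_sum (snd (snd (z i))))"
      by (rule B.cells_block[OF N_def nj, of c k "\<lambda>i. snd (z i)" m2])
         (use z Bz km k0 m2 in \<open>auto simp: \<Phi>_def M_def\<close>)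
    ultimately show ?thesis by blast
  qed
  then show ?thesis using c by blast
qed

section \<open>Domination of one block sequence by another\<close>

lemma sum_eighth_le:
  assumes "finite R" "\<And>k. k \<in> R \<Longrightarrow> k1 \<le> k"
  shows "(\<Sum>k\<in>R. (1 / 8 :: real) ^ k) \<le> 8 / 7 * (1 / 8) ^ k1"
proof -
  obtain M where M: "\<And>k. k \<in> R \<Longrightarrow> k < M" using finite_nat_set_iff_bounded assms(1) by auto
  have "(\<Sum>k\<in>R. (1 / 8 :: real) ^ k) \<le> (\<Sum>k\<in>{k1..<k1 + M}. (1 / 8) ^ k)"
    using assms(2) M trans_less_add2 by (intro sum_mono2) fastforce+
  also have "\<dots> = (\<Sum>i<M. (1 / 8) ^ (i + k1))"
    using sum.shift_bounds_nat_ivl[of "\<lambda>k. (1 / 8 :: real) ^ k" 0 k1 M]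
    by (simp add: add.commute atLeast0LessThan)
  also have "\<dots> = (1 / 8) ^ k1 * (\<Sum>i<M. (1 / 8) ^ i)"
    by (simp add: power_add sum_distrib_left mult.commute)
  also have "(\<Sum>i<M. (1 / 8 :: real) ^ i) = 8 / 7 * (1 - (1 / 8) ^ M)"
    by (subst geometric_sum) (auto simp: field_simps)
  also have "(1 / 8 :: real) ^ k1 * (8 / 7 * (1 - (1 / 8) ^ M)) \<le> (1 / 8) ^ k1 * (8 / 7 * 1)"
    by (intro mult_left_mono) auto
  finally show ?thesis by simp
qed

lemma supp_sum_subset: "supp (\<lambda>t. \<Sum>i\<in>J. f i t) \<subseteq> (\<Union>i\<in>J. supp (f i))"
  by (auto simp: supp_def intro: ccontr)

text \<open>Members replaced by functionals that begin no earlier stay admissible by spreading;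
  order and growth of the new members are supplied by \<open>pr\<close>.\<close>

lemma family_image:
  assumes P: "family (W n) j P" and Q: "Q \<subseteq> P" "Q \<noteq> {}"
    and avg: "\<And>p. p \<in> Q \<Longrightarrow> fst (I p) \<in> averages (W n) (snd (I p))"
    and pr: "\<And>p q. p \<in> Q \<Longrightarrow> q \<in> Q \<Longrightarrow> prec p q \<Longrightarrow> prec (I p) (I q)"
    and le: "\<And>p. p \<in> Q \<Longrightarrow> first_index p \<le> first_index (I p)"
  shows "family (W n) j (I ` Q) \<and> family_sum (I ` Q) = (\<lambda>t. \<Sum>p\<in>Q. fst (I p) t)"
proof -
  have ch: "prec p q \<or> prec q p" if "p \<in> Q" "q \<in> Q" "p \<noteq> q" for p q
    using familyD(5)[OF P] that Q by blast
  have inj: "inj_on I Q"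
    using ch pr prec_first_index unfolding inj_on_def by (metis less_irrefl)
  have injm: "inj_on first_index Q"
    using ch prec_first_index unfolding inj_on_def by (metis less_irrefl)
  have "(first_index \<circ> I) ` Q \<in> schreier j"
  proof (rule schreier_spread_rel[OF familyD(6)[OF P] Q(2) injm])
    show "(first_index \<circ> I) p < (first_index \<circ> I) q" if "p \<in> Q" "q \<in> Q" "first_index p < first_index q" for p q
    proof -
      have "p \<noteq> q" using that(3) by auto
      then have "prec p q" using ch[OF that(1,2)] prec_first_index[of q p] that(3) by auto
      then show ?thesis using prec_first_index[OF pr[OF that(1,2)]] by simp
    qed
  qed (use Q le in auto)
  moreover have "prec a b \<or> prec b a" if ab: "a \<in> I ` Q" "b \<in> I ` Q" "a \<noteq> b" for a b
  proof -
    obtain p q where "p \<in> Q" "q \<in> Q" "a = I p" "b = I q" using ab by blast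
    then show ?thesis using ch[of p q] pr[of p q] pr[of q p] ab(3) by auto
  qed
  moreover have "finite Q" using Q familyD(1)[OF P] finite_subset by blast
  ultimately have "family (W n) j (I ` Q)"
    unfolding family_def using Q avg by (simp add: alpha_average_W image_comp)
  moreover have "family_sum (I ` Q) = (\<lambda>t. \<Sum>p\<in>Q. fst (I p) t)"
    unfolding family_sum_def sum.reindex[OF inj] by simp
  ultimately show ?thesis ..
qed

text \<open>Strictness on both sides is what replacement uses: a point of \<open>f\<close> below
  keeps first indices from decreasing, a point above keeps maxima below the next size, and both
  preserve the order of successive functionals. The zero functional is enclosed in any
  \<open>f\<close>.\<close>

definition enclosed :: "(nat \<Rightarrow> real) \<Rightarrow> (nat \<Rightarrow> real) \<Rightarrow> bool" where
  "enclosed g f \<longleftrightarrow> (\<forall>u\<in>supp g. \<exists>s\<in>supp f. \<exists>t\<in>supp f. s < u \<and> u < t)"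

lemma enclosedE:
  assumes "enclosed g f" "u \<in> supp g"
  obtains s t where "s \<in> supp f" "t \<in> supp f" "s < u" "u < t"
  using assms unfolding enclosed_def by blast

lemma vec_before_enclosed:
  assumes fg: "vec_before f f'" and b: "enclosed g f" "enclosed g' f'" and g: "g \<in> W n" "g' \<in> W n"
  shows "vec_before g g'"
proof (rule vec_beforeI)
  fix i j assume "i \<in> supp g" "j \<in> supp g'"
  then obtain t s where "t \<in> supp f" "i < t" "s \<in> supp f'" "s < j"
    using b by (meson enclosedE)
  then show "i < j" using vec_beforeD[OF fg, of t s] by simp
qed (use W_supp g in auto)

section \<open>Transferring functionals from one block sequence to the other\<close>

text \<open>The sequence to be dominated is made of \<open>v\<close>, the dominating one of
  \<open>w\<close> with functionals \<open>\<eta>\<close>, in the same cells. The conditions on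
  \<open>\<mu>\<close> make errors on block \<open>k\<close> small at scale 8^-k, even when
  multiplied by the end of an earlier block. The coefficients are fixed and bounded by 1, so that
  the errors need not refer to them.\<close>

locale block_sequences =
  fixes n :: nat and c :: real and \<mu> N :: "nat \<Rightarrow> nat" and \<beta> :: "nat \<Rightarrow> nat \<Rightarrow> nat"
    and v w \<eta> :: "nat \<Rightarrow> nat \<Rightarrow> nat \<Rightarrow> real" and a :: "nat \<Rightarrow> real"
  assumes n1: "1 \<le> n" and c: "0 < c" and N: "N k = 2 * (\<mu> k + 1)" and \<beta>0: "\<mu> k < \<beta> k 0"
    and \<beta>_Suc: "i < N k \<Longrightarrow> \<beta> k i < \<beta> k (Suc i)"
    and v: "i < N k \<Longrightarrow> v k i \<in> c00 \<and> norm_W n (v k i) \<le> 1 \<and> supp (v k i) \<subseteq> {\<beta> k i..<\<beta> k (Suc i)}"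
    and w: "i < N k \<Longrightarrow> w k i \<in> c00 \<and> supp (w k i) \<subseteq> {\<beta> k i..<\<beta> k (Suc i)}"
    and \<eta>: "i < N k \<Longrightarrow> supp (\<eta> k i) \<subseteq> {\<beta> k i..<\<beta> k (Suc i)} \<and> c \<le> pairing (\<eta> k i) (w k i)"
    and \<eta>_W: "r < s \<Longrightarrow> s \<le> N k \<Longrightarrow> (\<lambda>t. \<Sum>i\<in>{r..<s}. \<eta> k i t) \<in> W n"
    and good: "good n (n - 1) (1 / real (\<mu> k + 1)) (lin_comb {..<N k} (\<lambda>_. 1 / real (N k)) (v k))"
    and \<mu>: "32 * 8 ^ k \<le> \<mu> k + 1" and fast: "k' < k \<Longrightarrow> 32 * 8 ^ k * \<beta> k' (N k') \<le> \<mu> k + 1"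
    and a: "\<bar>a k\<bar> \<le> 1"
begin

definition y where "y k = lin_comb {..<N k} (\<lambda>_. 1 / real (N k)) (v k)"
definition z where "z k = lin_comb {..<N k} (\<lambda>_. 1 / real (N k)) (w k)"
definition D where "D k = {\<beta> k 0..<\<beta> k (N k)}"
definition eps :: "nat \<Rightarrow> real" where "eps k = (1 / 8) ^ k"

lemma N_pos: "0 < N k"
  by (simp add: N)

lemma eps_pos: "0 < eps k"
  by (simp add: eps_def)

lemma eps_mono: "k \<le> k' \<Longrightarrow> eps k' \<le> eps k"
  unfolding eps_def by (intro power_decreasing) auto

lemma eps_less: "k < k' \<Longrightarrow> eps k' \<le> eps k / 8"
  using eps_mono[of "Suc k" k'] by (simp add: eps_def)

lemma inverse_\<mu>: "2 / real (\<mu> k + 1) \<le> eps k / 16"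
proof -
  have "real (32 * 8 ^ k) \<le> real (\<mu> k + 1)" using \<mu>[of k] by (simp only: of_nat_le_iff)
  then have "2 / real (\<mu> k + 1) \<le> 2 / (32 * 8 ^ k)" by (intro divide_left_mono) auto
  then show ?thesis by (simp add: eps_def power_divide)
qed

lemma two_over_N: "2 / real (N k) \<le> eps k / 16"
proof -
  have "2 / real (N k) \<le> 2 / real (\<mu> k + 1)" by (intro divide_left_mono) (auto simp: N)
  then show ?thesis using inverse_\<mu>[of k] by linarith
qed

lemma \<beta>_mono: "i \<le> i' \<Longrightarrow> i' \<le> N k \<Longrightarrow> \<beta> k i \<le> \<beta> k i'"
proof (induction i')
  case (Suc i')
  then show ?case using \<beta>_Suc[of i' k] by (cases "i = Suc i'") auto
qed auto

lemma D_less: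
  assumes "k < k'" "s \<in> D k" "t \<in> D k'"
  shows "s < t"
proof -
  have "\<beta> k (N k) \<le> 32 * 8 ^ k' * \<beta> k (N k)" by simp
  then have "\<beta> k (N k) \<le> \<beta> k' 0" using fast[OF assms(1)] \<beta>0[of k'] by linarith
  then show ?thesis using assms by (simp add: D_def)
qed

lemma D_disjoint: "t \<in> D k \<Longrightarrow> t \<in> D k' \<Longrightarrow> k = k'"
  using D_less by (metis less_irrefl linorder_neqE_nat)

lemma cell_D: "i < N k \<Longrightarrow> {\<beta> k i..<\<beta> k (Suc i)} \<subseteq> D k"
  unfolding D_def using \<beta>_mono[of 0 i k] \<beta>_mono[of "Suc i" "N k" k] by auto

lemma cells_disjoint:
  assumes "i < N k" "i' < N k" "t \<in> {\<beta> k i..<\<beta> k (Suc i)}" "t \<in> {\<beta> k i'..<\<beta> k (Suc i')}"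
  shows "i = i'"
  using assms \<beta>_mono[of "Suc i" i' k] \<beta>_mono[of "Suc i'" i k]
  by (cases i i' rule: linorder_cases) auto

lemma y_c00: "y k \<in> c00" and z_c00: "z k \<in> c00"
  unfolding y_def z_def using v w by (auto intro: lin_comb_c00)

lemma supp_y: "supp (y k) \<subseteq> D k"
proof
  fix t assume "t \<in> supp (y k)"
  then obtain i where "i < N k" "t \<in> supp (v k i)" unfolding y_def using supp_lin_comb by blast
  then show "t \<in> D k" using v cell_D by blast
qed

lemma supp_z: "supp (z k) \<subseteq> D k"
proof
  fix t assume "t \<in> supp (z k)"
  then obtain i where "i < N k" "t \<in> supp (w k i)" unfolding z_def using supp_lin_comb by blast
  then show "t \<in> D k" using w cell_D by blast
qed

lemma pairing_y_0: "supp f \<inter> D k = {} \<Longrightarrow> pairing f (y k) = 0"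
  using supp_y by (intro pairing_disjoint) blast

lemma pairing_z_0: "supp f \<inter> D k = {} \<Longrightarrow> pairing f (z k) = 0"
  using supp_z by (intro pairing_disjoint) blast

lemma pairing_y: "pairing f (y k) = (\<Sum>i<N k. pairing f (v k i)) / real (N k)"
  unfolding y_def by (subst pairing_lin_comb) (use v in \<open>auto simp: sum_divide_distrib\<close>)

lemma pairing_z: "pairing f (z k) = (\<Sum>i<N k. pairing f (w k i)) / real (N k)"
  unfolding z_def by (subst pairing_lin_comb) (use w in \<open>auto simp: sum_divide_distrib\<close>)

abbreviation Y where "Y S \<equiv> lin_comb S a y"
abbreviation Z where "Z S \<equiv> lin_comb S a z"

lemma pairing_Y: "finite S \<Longrightarrow> pairing f (Y S) = (\<Sum>k\<in>S. a k * pairing f (y k))"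
  by (rule pairing_lin_comb) (use y_c00 in auto)

lemma pairing_Z: "finite S \<Longrightarrow> pairing f (Z S) = (\<Sum>k\<in>S. a k * pairing f (z k))"
  by (rule pairing_lin_comb) (use z_c00 in auto)

lemma pairing_Z_subset:
  assumes "finite S" "R \<subseteq> S" "supp g \<subseteq> (\<Union>k\<in>R. D k)"
  shows "pairing g (Z R) = pairing g (Z S)"
proof -
  have "pairing g (z k) = 0" if "k \<in> S - R" for k
  proof (rule pairing_z_0)
    show "supp g \<inter> D k = {}" using assms(3) that D_disjoint by blast
  qed
  moreover have "finite R" using assms finite_subset by blast
  ultimately show ?thesis
    using assms by (simp add: pairing_Z) (intro sum.mono_neutral_left, auto)
qed

definition touched :: "(nat \<Rightarrow> real) \<Rightarrow> nat set \<Rightarrow> nat set" where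
  "touched f S = {k \<in> S. supp f \<inter> D k \<noteq> {}}"

lemma pairing_Y_touched:
  assumes "finite S" "touched f S \<subseteq> R" "R \<subseteq> S"
  shows "pairing f (Y S) = (\<Sum>k\<in>R. a k * pairing f (y k))"
  unfolding pairing_Y[OF assms(1)]
  by (rule sum.mono_neutral_right) (use assms pairing_y_0 in \<open>auto simp: touched_def\<close>)

text \<open>If \<open>f\<close> meets cells from \<open>lo\<close> to \<open>hi\<close> only, its
  value on \<open>y k\<close> is at most their number over \<open>N k\<close>. On the interior cells
  a sum of the \<open>\<eta> k i\<close> is enclosed in \<open>f\<close> and gains at least
  \<open>c\<close> from each. The two cells lost cost two parts in \<open>N k\<close>.\<close>

lemma single_block:
  assumes f: "f \<in> W n" and S: "finite S" and k: "k \<in> S" and t: "touched f S \<subseteq> {k}"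
  shows "\<exists>h. (h = (\<lambda>_. 0) \<or> h \<in> W n) \<and> supp h \<subseteq> D k \<and> enclosed h f \<and> 0 \<le> pairing h (Z S) \<and>
    pairing f (Y S) \<le> 1 / c * pairing h (Z S) + eps k / 16"
proof -
  have fY: "pairing f (Y S) = a k * pairing f (y k)"
    using pairing_Y_touched[OF S t] k by simp
  define I where "I = {i. i < N k \<and> supp f \<inter> {\<beta> k i..<\<beta> k (Suc i)} \<noteq> {}}"
  have fv: "\<bar>pairing f (v k i)\<bar> \<le> 1" if "i < N k" for i
    using pairing_le_norm_W[OF f, of "v k i"] v[OF that] by linarith
  have zero: "pairing f (v k i) = 0" if "i < N k" "i \<notin> I" for i
    using v[OF that(1)] that by (intro pairing_disjoint) (auto simp: I_def)
  have e0: "0 \<le> eps k / 16" using eps_pos[of k] by simp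
  have short: ?thesis if "pairing f (Y S) \<le> eps k / 16"
    by (rule exI[of _ "\<lambda>_. 0"]) (use that in \<open>auto simp: supp_def enclosed_def\<close>)
  show ?thesis
  proof (cases "I = {}")
    case True
    then have "pairing f (y k) = 0" unfolding pairing_y using zero by (simp add: sum.neutral)
    then show ?thesis using short fY e0 by simp
  next
    case False
    have finI: "finite I" by (simp add: I_def)
    define lo where "lo = Min I"
    define hi where "hi = Max I"
    have lo: "lo \<in> I" "\<And>i. i \<in> I \<Longrightarrow> lo \<le> i" and hi: "hi \<in> I" "\<And>i. i \<in> I \<Longrightarrow> i \<le> hi"
      using False finI by (auto simp: lo_def hi_def)
    have hiN: "hi < N k" and loN: "lo < N k" using lo hi by (auto simp: I_def)
    have lohi: "lo \<le> hi" using lo hi by blast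
    have "\<bar>\<Sum>i<N k. pairing f (v k i)\<bar> = \<bar>\<Sum>i\<in>I. pairing f (v k i)\<bar>"
      using zero by (intro arg_cong[where f = abs] sum.mono_neutral_right) (auto simp: I_def)
    also have "\<dots> \<le> (\<Sum>i\<in>I. 1)"
      using fv by (intro order_trans[OF sum_abs] sum_mono) (auto simp: I_def)
    also have "\<dots> \<le> real (card {lo..hi})"
    proof -
      have "card I \<le> card {lo..hi}" using lo hi by (intro card_mono) auto
      then show ?thesis by simp
    qed
    finally have sum_le: "\<bar>\<Sum>i<N k. pairing f (v k i)\<bar> \<le> real (hi - lo) + 1" using lohi by (simp add: of_nat_diff)
    have fle: "pairing f (Y S) \<le> \<bar>a k\<bar> * (real (hi - lo) + 1) / real (N k)"
    proof -
      have "a k * pairing f (y k) \<le> \<bar>a k\<bar> * \<bar>pairing f (y k)\<bar>" by (metis abs_ge_self abs_mult)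
      also have "\<bar>pairing f (y k)\<bar> \<le> (real (hi - lo) + 1) / real (N k)"
        unfolding pairing_y abs_divide abs_of_nat by (rule divide_right_mono[OF sum_le]) simp
      finally show ?thesis unfolding fY by (simp add: mult_left_mono)
    qed
    show ?thesis
    proof (cases "Suc lo < hi")
      \<comment> \<open>There is no interior cell. At most two cells are met, and the zero
        functional suffices.\<close>
      case False
      then have "real (hi - lo) + 1 \<le> 2" by simp
      then have "\<bar>a k\<bar> * (real (hi - lo) + 1) \<le> 1 * 2" using a by (intro mult_mono) auto
      then have "\<bar>a k\<bar> * (real (hi - lo) + 1) / real (N k) \<le> 2 / real (N k)"
        by (intro divide_right_mono) auto
      then have "pairing f (Y S) \<le> eps k / 16" using fle two_over_N[of k] by linarith
      then show ?thesis by (rule short)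
    next
      case True
      define g where "g = (\<lambda>t. \<Sum>i\<in>{Suc lo..<hi}. \<eta> k i t)"
      have g: "g \<in> W n" unfolding g_def by (rule \<eta>_W) (use True hiN in auto)
      have sg: "\<exists>i\<in>{Suc lo..<hi}. u \<in> {\<beta> k i..<\<beta> k (Suc i)}" if "u \<in> supp g" for u
      proof -
        have "\<exists>i\<in>{Suc lo..<hi}. u \<in> supp (\<eta> k i)"
          using that supp_sum_subset unfolding g_def by blast
        then show ?thesis using \<eta> hiN by (meson atLeastLessThan_iff less_trans subsetD)
      qed
      have bt: "enclosed g f" unfolding enclosed_def
      proof
        fix u assume "u \<in> supp g"
        then obtain i where i: "Suc lo \<le> i" "i < hi" "\<beta> k i \<le> u" "u < \<beta> k (Suc i)" using sg by fastforce
        obtain s t where s: "s \<in> supp f" "s < \<beta> k (Suc lo)" and t: "t \<in> supp f" "\<beta> k hi \<le> t"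
          using lo(1) hi(1) by (auto simp: I_def)
        have "\<beta> k (Suc lo) \<le> \<beta> k i" "\<beta> k (Suc i) \<le> \<beta> k hi" using i hiN by (auto intro!: \<beta>_mono)
        then show "\<exists>s\<in>supp f. \<exists>t\<in>supp f. s < u \<and> u < t" using s t i by (meson le_less_trans less_le_trans)
      qed
      have gD: "supp g \<subseteq> D k"
      proof
        fix u assume "u \<in> supp g"
        then obtain i where i: "Suc lo \<le> i" "i < hi" "u \<in> {\<beta> k i..<\<beta> k (Suc i)}" using sg by fastforce
        then have "i < N k" using hiN by linarith
        then show "u \<in> D k" using cell_D i(3) by blast
      qed
      have gz: "c * (real (hi - lo) - 1) / real (N k) \<le> pairing g (z k)"
      proof -
        have "pairing g (z k) = (\<Sum>i\<in>{Suc lo..<hi}. \<Sum>i'<N k. pairing (\<eta> k i) (w k i')) / real (N k)"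
          unfolding g_def pairing_sum_left pairing_z by (simp add: sum_divide_distrib)
        also have "(\<Sum>i\<in>{Suc lo..<hi}. \<Sum>i'<N k. pairing (\<eta> k i) (w k i')) =
            (\<Sum>i\<in>{Suc lo..<hi}. pairing (\<eta> k i) (w k i))"
        proof (rule sum.cong[OF refl])
          fix i assume i: "i \<in> {Suc lo..<hi}"
          then have iN: "i < N k" using hiN by simp
          have "pairing (\<eta> k i) (w k i') = 0" if "i' < N k" "i' \<noteq> i" for i'
            using \<eta>[OF iN] w[OF that(1)] cells_disjoint[OF iN that(1)] that(2)
            by (intro pairing_disjoint) blast
          then show "(\<Sum>i'<N k. pairing (\<eta> k i) (w k i')) = pairing (\<eta> k i) (w k i)"
            using iN by (subst sum.remove[of _ i]) (auto intro!: sum.neutral)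
        qed
        finally have eq: "pairing g (z k) = (\<Sum>i\<in>{Suc lo..<hi}. pairing (\<eta> k i) (w k i)) / real (N k)" .
        have "(\<Sum>i\<in>{Suc lo..<hi}. c) \<le> (\<Sum>i\<in>{Suc lo..<hi}. pairing (\<eta> k i) (w k i))"
          using \<eta> hiN by (intro sum_mono) auto
        then have "c * (real (hi - lo) - 1) \<le> (\<Sum>i\<in>{Suc lo..<hi}. pairing (\<eta> k i) (w k i))"
          using True by (simp add: of_nat_diff algebra_simps)
        then show ?thesis unfolding eq by (rule divide_right_mono) simp
      qed
      \<comment> \<open>The sign of \<open>a k\<close> is absorbed by the functional.\<close>
      define h where "h = (if 0 \<le> a k then g else (\<lambda>t. - g t))"
      have sh: "supp h = supp g" by (simp add: h_def supp_uminus)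
      have hW: "h \<in> W n" using g W_uminus by (simp add: h_def)
      have "pairing h (Z S) = pairing h (Z {k})"
        using pairing_Z_subset[OF S, of "{k}" h] k gD sh by simp
      also have "\<dots> = a k * pairing h (z k)" by (simp add: pairing_Z)
      also have "\<dots> = \<bar>a k\<bar> * pairing g (z k)" by (simp add: h_def pairing_uminus_left)
      finally have hZ: "pairing h (Z S) = \<bar>a k\<bar> * pairing g (z k)" .
      have "1 / c * pairing h (Z S) \<ge> 1 / c * (\<bar>a k\<bar> * (c * (real (hi - lo) - 1) / real (N k)))"
        unfolding hZ using gz c by (intro mult_left_mono) auto
      moreover have "1 / c * (\<bar>a k\<bar> * (c * (real (hi - lo) - 1) / real (N k))) =
          \<bar>a k\<bar> * (real (hi - lo) + 1) / real (N k) - 2 * \<bar>a k\<bar> / real (N k)"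
        using c N_pos[of k] by (simp add: field_simps)
      moreover have "2 * \<bar>a k\<bar> / real (N k) \<le> 2 / real (N k)"
        using a[of k] by (intro divide_right_mono) auto
      ultimately have "pairing f (Y S) \<le> 1 / c * pairing h (Z S) + eps k / 16"
        using fle two_over_N[of k] by linarith
      moreover have "0 \<le> pairing h (Z S)"
      proof -
        have "0 \<le> c * (real (hi - lo) - 1) / real (N k)" using c True by simp
        then show ?thesis unfolding hZ using gz by simp
      qed
      ultimately show ?thesis using hW sh gD bt by (intro exI[of _ h]) (auto simp: enclosed_def)
    qed
  qed
qed

text \<open>\<open>single_block\<close> achieves the factor 1 / c. The factor 2 / c leaves room for
  inserting half of a functional into a family in \<open>dominated_sum\<close>.\<close>

definition dominated :: "(nat \<Rightarrow> real) \<Rightarrow> nat set \<Rightarrow> real \<Rightarrow> bool" where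
  "dominated f S E \<longleftrightarrow> (\<exists>g. (g = (\<lambda>_. 0) \<or> g \<in> W n) \<and> supp g \<subseteq> (\<Union>k\<in>S. D k) \<and> enclosed g f \<and>
     pairing f (Y S) \<le> 2 / c * pairing g (Z S) + E)"

text \<open>The error depends on \<open>f\<close> only through the first block met, not on its depth
  in \<open>W\<close>.\<close>

definition err :: "(nat \<Rightarrow> real) \<Rightarrow> nat set \<Rightarrow> real" where
  "err f S = (if touched f S = {} then 0 else eps (Min (touched f S)))"

text \<open>A smaller error for functionals meeting one block only, where
  \<open>single_block\<close> applies directly. This is the gain that averages exploit.\<close>

definition err1 :: "(nat \<Rightarrow> real) \<Rightarrow> nat set \<Rightarrow> real" where
  "err1 f S = (if \<exists>k. touched f S = {k} then eps (Min (touched f S)) / 16 else err f S)"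

lemma dominated_mono: "dominated f S E \<Longrightarrow> E \<le> E' \<Longrightarrow> dominated f S E'"
  unfolding dominated_def by force

lemma dominated_single:
  assumes f: "f \<in> W n" and S: "finite S" and t: "touched f S = {k}"
  shows "dominated f S (eps k / 16)"
proof -
  have k: "k \<in> S" using t by (auto simp: touched_def)
  then obtain h where h: "h = (\<lambda>_. 0) \<or> h \<in> W n" "supp h \<subseteq> D k" "enclosed h f" "0 \<le> pairing h (Z S)"
    "pairing f (Y S) \<le> 1 / c * pairing h (Z S) + eps k / 16"
    using single_block[OF f S k] t by auto
  have "1 / c * pairing h (Z S) \<le> 2 / c * pairing h (Z S)"
    using h(4) c by (intro mult_right_mono) (auto simp: divide_right_mono)
  then show ?thesis unfolding dominated_def using h k by (intro exI[of _ h]) auto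
qed

lemma dominated_untouched:
  assumes S: "finite S" and t: "touched f S = {}"
  shows "dominated f S 0"
proof -
  have "pairing f (Y S) = 0" using pairing_Y_touched[OF S, of f "{}"] t by simp
  then show ?thesis unfolding dominated_def
    by (intro exI[of _ "\<lambda>_. 0"]) (auto simp: supp_def enclosed_def)
qed

lemma dominated_err1:
  assumes "f \<in> W n" "finite S" "dominated f S (err f S)"
  shows "dominated f S (err1 f S)"
  using assms dominated_single by (auto simp: err1_def)

lemma finite_touched: "finite S \<Longrightarrow> finite (touched f S)"
  by (simp add: touched_def)

text \<open>Starting after \<open>k1\<close> gains 1/8 by the decay of \<open>eps\<close>, and
  meeting a single block gains 1/16 by \<open>err1\<close>. The full error is left to functionals
  that meet \<open>k1\<close> and go on.\<close>

lemma err1_bounds: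
  assumes S: "finite S" and k1: "\<And>k. k \<in> touched f S \<Longrightarrow> k1 \<le> k"
  shows "err1 f S \<le> eps k1"
    and "\<not> (k1 \<in> touched f S \<and> (\<exists>k\<in>touched f S. k1 < k)) \<Longrightarrow> err1 f S \<le> eps k1 / 8"
proof -
  let ?m = "Min (touched f S)"
  have m: "?m \<in> touched f S" if "touched f S \<noteq> {}" using that finite_touched[OF S] by simp
  have e: "eps ?m \<le> eps k1" if "touched f S \<noteq> {}" using m[OF that] k1 eps_mono by blast
  show "err1 f S \<le> eps k1"
    using e eps_pos[of k1] eps_pos[of ?m] by (fastforce simp: err1_def err_def)
  assume not: "\<not> (k1 \<in> touched f S \<and> (\<exists>k\<in>touched f S. k1 < k))"
  show "err1 f S \<le> eps k1 / 8"
  proof (cases "touched f S = {} \<or> (\<exists>k. touched f S = {k})")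
    case True
    then show ?thesis using e eps_pos[of k1] by (auto simp: err1_def err_def)
  next
    case False
    then have ne: "touched f S \<noteq> {}" by blast
    have "k1 < ?m"
    proof (rule ccontr)
      assume "\<not> k1 < ?m"
      then have "?m = k1" using m[OF ne] k1[of ?m] by simp
      then have k: "k1 \<in> touched f S" using m[OF ne] by simp
      then obtain k where "k \<in> touched f S" "k \<noteq> k1" using False by blast
      then show False using not k k1[of k] by auto
    qed
    then show ?thesis using eps_less[of k1 ?m] False by (simp add: err1_def err_def)
  qed
qed

text \<open>The summands are replaced one by one and averaged with the same size, so the result can
  again be a member of a family. At most one summand meets the first block of \<open>f\<close> and a
  later one, which makes the mean of the errors smaller than the error of \<open>f\<close>. The
  margin is spent in \<open>charge_blocks\<close>.\<close>

lemma dominated_average: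
  assumes f: "f \<in> averages {g \<in> W n. \<forall>S. finite S \<longrightarrow> dominated g S (err g S)} s" and S: "finite S"
  shows "\<exists>g. (g = (\<lambda>_. 0) \<or> g \<in> averages (W n) s) \<and> supp g \<subseteq> (\<Union>k\<in>S. D k) \<and> enclosed g f \<and>
     pairing f (Y S) \<le> 2 / c * pairing g (Z S) + 9 / 16 * err f S"
proof -
  obtain A where A: "finite A" "A \<noteq> {}" "A \<subseteq> {g \<in> W n. \<forall>S. finite S \<longrightarrow> dominated g S (err g S)}"
    "vec_chain (\<lambda>g. g) A" "card A \<le> s" "2 \<le> s" "f = (\<lambda>i. (\<Sum>g\<in>A. g i) / real s)"
    using f unfolding averages_iff by blast
  have suppf: "supp f = (\<Union>g\<in>A. supp g)" unfolding A(7) using supp_average A by blast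
  have "dominated g S (err1 g S)" if "g \<in> A" for g using dominated_err1 that A(3) S by blast
  then obtain h where h: "\<And>g. g \<in> A \<Longrightarrow> h g = (\<lambda>_. 0) \<or> h g \<in> W n"
    "\<And>g. g \<in> A \<Longrightarrow> supp (h g) \<subseteq> (\<Union>k\<in>S. D k)" "\<And>g. g \<in> A \<Longrightarrow> enclosed (h g) g"
    "\<And>g. g \<in> A \<Longrightarrow> pairing g (Y S) \<le> 2 / c * pairing (h g) (Z S) + err1 g S"
    unfolding dominated_def by metis
  define T where "T = {g \<in> A. h g \<noteq> (\<lambda>_. 0)}"
  have TA: "T \<subseteq> A" and hT: "\<And>g. g \<in> T \<Longrightarrow> h g \<in> W n" using h(1) by (auto simp: T_def)
  have finT: "finite T" using TA A(1) finite_subset by blast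
  have ch: "vec_before (h g) (h g') \<or> vec_before (h g') (h g)" if "g \<in> T" "g' \<in> T" "g \<noteq> g'" for g g'
  proof -
    have "vec_before g g' \<or> vec_before g' g" using A(4) that TA unfolding vec_chain_def by blast
    then show ?thesis using vec_before_enclosed h(3) hT that TA by (meson subsetD)
  qed
  have inj: "inj_on h T" using ch vec_before_Min unfolding inj_on_def by (metis less_irrefl)
  define g where "g = (\<lambda>t. (\<Sum>g\<in>T. h g t) / real s)"
  have ge: "g = (\<lambda>t. (\<Sum>g\<in>h ` T. g t) / real s)" unfolding g_def sum.reindex[OF inj] by simp
  have vch: "vec_chain (\<lambda>g. g) (h ` T)" unfolding vec_chain_def using ch by blast
  have suppg: "supp g = (\<Union>g\<in>h ` T. supp g)" unfolding ge
    by (rule supp_average[OF _ vch A(6)]) (simp add: finT)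
  have "g = (\<lambda>_. 0) \<or> g \<in> averages (W n) s"
  proof (cases "T = {}")
    case True
    then show ?thesis by (simp add: g_def)
  next
    case False
    have "card (h ` T) \<le> s" using card_image_le[OF finT, of h] card_mono[OF A(1) TA] A(5) by linarith
    then show ?thesis unfolding averages_iff using False finT hT vch A(6) ge by blast
  qed
  moreover have "supp g \<subseteq> (\<Union>k\<in>S. D k)" unfolding suppg using h(2) TA by blast
  moreover have "enclosed g f" unfolding enclosed_def
  proof
    fix u assume "u \<in> supp g"
    then obtain q where q: "q \<in> A" "u \<in> supp (h q)" unfolding suppg using TA by blast
    from enclosedE[OF h(3)[OF q(1)] q(2)] obtain s t where "s \<in> supp q" "t \<in> supp q" "s < u" "u < t" .
    then show "\<exists>s\<in>supp f. \<exists>t\<in>supp f. s < u \<and> u < t" unfolding suppf using q(1) by blast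
  qed
  moreover have "pairing f (Y S) \<le> 2 / c * pairing g (Z S) + 9 / 16 * err f S"
  proof -
    have fY: "pairing f (Y S) = (\<Sum>q\<in>A. pairing q (Y S)) / real s"
      by (simp add: A(7) pairing_divide_left pairing_sum_left)
    have "(\<Sum>q\<in>A. pairing (h q) (Z S)) = (\<Sum>q\<in>T. pairing (h q) (Z S))"
      using A(1) by (intro sum.mono_neutral_right) (auto simp: T_def)
    then have gZ: "pairing g (Z S) = (\<Sum>q\<in>A. pairing (h q) (Z S)) / real s"
      by (simp add: g_def pairing_divide_left pairing_sum_left)
    have E: "(\<Sum>q\<in>A. err1 q S) \<le> real s * (9 / 16 * err f S)"
    proof (cases "touched f S = {}")
      case True
      then have "touched q S = {}" if "q \<in> A" for q using that suppf by (auto simp: touched_def)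
      then have "err1 q S = 0" if "q \<in> A" for q using that by (simp add: err1_def err_def)
      then show ?thesis using True by (simp add: err_def)
    next
      case False
      define k1 where "k1 = Min (touched f S)"
      have k1: "k1 \<le> k" if "q \<in> A" "k \<in> touched q S" for q k
      proof -
        have "k \<in> touched f S" using that suppf by (auto simp: touched_def)
        then show ?thesis unfolding k1_def using finite_touched[OF S] by simp
      qed
      have ef: "err f S = eps k1" using False by (simp add: err_def k1_def)
      define L where "L = {q \<in> A. k1 \<in> touched q S \<and> (\<exists>k\<in>touched q S. k1 < k)}"
      \<comment> \<open>The earlier of two such summands would reach a later block before the other
        one meets block \<open>k1\<close>.\<close>
      have one: "q = q'" if qq: "q \<in> L" "q' \<in> L" for q q'
      proof (rule ccontr)
        have no: False if b: "vec_before r r'" "r \<in> L" "r' \<in> L" for r r'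
        proof -
          obtain k t t' where "k1 < k" "t \<in> supp r" "t \<in> D k" "t' \<in> supp r'" "t' \<in> D k1"
            using b(2,3) by (auto simp: L_def touched_def)
          then show False using vec_beforeD[OF b(1), of t t'] D_less[of k1 k t' t] by simp
        qed
        assume "q \<noteq> q'"
        then have "vec_before q q' \<or> vec_before q' q" using A(4) qq unfolding vec_chain_def L_def by blast
        then show False using no qq by blast
      qed
      have s2: "2 \<le> real s" using A(6) by simp
      show ?thesis
      proof (cases "L = {}")
        case True
        have "(\<Sum>q\<in>A. err1 q S) \<le> (\<Sum>q\<in>A. eps k1 / 8)"
        proof (rule sum_mono)
          fix q assume q: "q \<in> A"
          then have "\<not> (k1 \<in> touched q S \<and> (\<exists>k\<in>touched q S. k1 < k))" using True by (auto simp: L_def)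
          then show "err1 q S \<le> eps k1 / 8" using err1_bounds(2)[OF S k1[OF q]] by blast
        qed
        also have "\<dots> = real (card A) * (eps k1 / 8)" by simp
        also have "\<dots> \<le> real s * (9 / 16 * eps k1)"
          using A(5) eps_pos[of k1] by (intro mult_mono) auto
        finally show ?thesis unfolding ef .
      next
        case False
        then obtain q0 where q0: "q0 \<in> L" by blast
        then have q0A: "q0 \<in> A" by (simp add: L_def)
        have "(\<Sum>q\<in>A - {q0}. err1 q S) \<le> (\<Sum>q\<in>A - {q0}. eps k1 / 8)"
        proof (rule sum_mono)
          fix q assume q: "q \<in> A - {q0}"
          then have "\<not> (k1 \<in> touched q S \<and> (\<exists>k\<in>touched q S. k1 < k))" using one[OF _ q0] by (auto simp: L_def)
          then show "err1 q S \<le> eps k1 / 8" using err1_bounds(2)[OF S k1[of q]] q by blast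
        qed
        also have "\<dots> = (real (card A) - 1) * (eps k1 / 8)"
          using A(1) q0A card_Suc_Diff1[OF A(1) q0A] by simp
        also have "\<dots> \<le> (real s - 1) * (eps k1 / 8)"
          using A(5) eps_pos[of k1] by (intro mult_right_mono) auto
        finally have "(\<Sum>q\<in>A - {q0}. err1 q S) \<le> (real s - 1) * (eps k1 / 8)" .
        moreover have "err1 q0 S \<le> eps k1" using err1_bounds(1)[OF S k1[OF q0A]] .
        moreover have "(\<Sum>q\<in>A. err1 q S) = err1 q0 S + (\<Sum>q\<in>A - {q0}. err1 q S)"
          using A(1) q0A by (simp add: sum.remove)
        \<comment> \<open>One full error and s - 1 errors of an eighth; their mean is largest for s
          = 2, where it is 9/16.\<close>
        moreover have "eps k1 + (real s - 1) * (eps k1 / 8) \<le> real s * (9 / 16 * eps k1)"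
        proof -
          have "2 * eps k1 \<le> real s * eps k1" using s2 eps_pos[of k1] by (intro mult_right_mono) auto
          moreover have e1: "(real s - 1) * (eps k1 / 8) = (real s * eps k1 - eps k1) / 8"
            by (simp add: algebra_simps)
          moreover have e2: "real s * (9 / 16 * eps k1) = 9 / 16 * (real s * eps k1)" by simp
          moreover have "e + (x - e) / 8 \<le> 9 / 16 * x" if "2 * e \<le> x" for e x :: real
            using that by (simp add: field_simps)
          ultimately show ?thesis unfolding e1 e2 by blast
        qed
        ultimately show ?thesis unfolding ef by linarith
      qed
    qed
    have "(\<Sum>q\<in>A. pairing q (Y S)) \<le> (\<Sum>q\<in>A. 2 / c * pairing (h q) (Z S) + err1 q S)"
      using h(4) by (intro sum_mono)
    also have "\<dots> = 2 / c * (\<Sum>q\<in>A. pairing (h q) (Z S)) + (\<Sum>q\<in>A. err1 q S)"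
      by (simp add: sum.distrib sum_distrib_left)
    also have "\<dots> \<le> 2 / c * (\<Sum>q\<in>A. pairing (h q) (Z S)) + real s * (9 / 16 * err f S)" using E by simp
    finally have "pairing f (Y S) \<le> (2 / c * (\<Sum>q\<in>A. pairing (h q) (Z S)) + real s * (9 / 16 * err f S)) / real s"
      unfolding fY by (rule divide_right_mono) simp
    also have "\<dots> = 2 / c * pairing g (Z S) + 9 / 16 * err f S"
      unfolding gZ using A(6) by (simp add: add_divide_distrib)
    finally show ?thesis .
  qed
  ultimately show ?thesis by blast
qed

text \<open>A size beyond the start of block \<open>k\<close> exceeds \<open>\<mu> k\<close>, so
  goodness bounds the value by twice the reciprocal of \<open>\<mu> k + 1\<close>.\<close>

lemma good_single:
  assumes P: "family (W n) j P" and p: "p \<in> P" and size: "\<beta> k 0 < snd p"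
  shows "\<bar>a k * pairing (fst p) (y k)\<bar> \<le> eps k / 16"
proof -
  have "\<bar>pairing (family_sum {p}) (y k)\<bar> \<le> 1 / real (\<mu> k + 1) + 1 / real (\<mu> k + 1)"
    unfolding y_def
    by (rule goodD[OF good family_member[OF P p]]) (use size \<beta>0[of k] in auto)
  then have "\<bar>pairing (fst p) (y k)\<bar> \<le> eps k / 16" using inverse_\<mu>[of k] by simp
  moreover have "\<bar>a k\<bar> * \<bar>pairing (fst p) (y k)\<bar> \<le> 1 * \<bar>pairing (fst p) (y k)\<bar>"
    using a by (intro mult_right_mono) auto
  ultimately show ?thesis by (simp add: abs_mult)
qed

text \<open>An earlier block met by the sum bounds the number of its S_(n-1) pieces by the end of
  that block, and \<open>fast\<close> makes this number harmless against the error on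
  \<open>y k\<close>.\<close>

lemma good_tail:
  assumes P: "family (W n) n P" and Q: "Q \<subseteq> P" and size: "\<forall>p\<in>Q. \<beta> k 0 < snd p"
    and k1: "k1 < k" "u \<in> supp (family_sum P)" "u \<in> D k1"
  shows "\<bar>a k * (\<Sum>p\<in>Q. pairing (fst p) (y k))\<bar> \<le> eps k / 16"
proof -
  obtain j where nj: "n = Suc j" using n1 by (cases n) auto
  define e where "e = 2 / real (\<mu> k + 1)"
  have "\<bar>\<Sum>p\<in>Q. pairing (fst p) (y k)\<bar> \<le> real (\<beta> k1 (N k1)) * e"
  proof (rule family_tail[OF _ Q _ _ _ size])
    show "family (W n) (Suc j) P" using P nj by simp
    show "Min (first_index ` P) \<le> \<beta> k1 (N k1)" using Min_first_index_le[OF P k1(2)] k1(3) by (simp add: D_def)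
    show "0 \<le> e" by (simp add: e_def)
    fix R assume R: "family (W n) j R" "\<forall>p\<in>R. \<beta> k 0 < snd p"
    have "\<bar>pairing (family_sum R) (y k)\<bar> \<le> 1 / real (\<mu> k + 1) + 1 / real (\<mu> k + 1)"
      unfolding y_def
      by (rule goodD[OF good]) (use R \<beta>0[of k] nj in \<open>auto simp: Suc_le_eq intro: less_trans\<close>)
    then show "\<bar>pairing (family_sum R) (y k)\<bar> \<le> e" by (simp add: e_def)
  qed
  also have "\<dots> \<le> eps k / 16"
  proof -
    have "real (32 * 8 ^ k * \<beta> k1 (N k1)) \<le> real (\<mu> k + 1)" using fast[OF k1(1)] by (simp only: of_nat_le_iff)
    then have "32 * 8 ^ k * real (\<beta> k1 (N k1)) \<le> real (\<mu> k + 1)" by simp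
    then have "real (\<beta> k1 (N k1)) / real (\<mu> k + 1) \<le> 1 / (32 * 8 ^ k)" by (simp add: field_simps)
    then show ?thesis by (simp add: e_def eps_def power_divide)
  qed
  finally have "\<bar>\<Sum>p\<in>Q. pairing (fst p) (y k)\<bar> \<le> eps k / 16" .
  moreover have "\<bar>a k\<bar> * \<bar>\<Sum>p\<in>Q. pairing (fst p) (y k)\<bar> \<le> 1 * \<bar>\<Sum>p\<in>Q. pairing (fst p) (y k)\<bar>"
    using a by (intro mult_right_mono) auto
  ultimately show ?thesis by (simp add: abs_mult)
qed

text \<open>The induction hypothesis of the recursion on \<open>W\<close>. It quantifies over all
  \<open>S\<close> because each member of a sum is compared only on the blocks charged to
  it.\<close>

definition dominated_by_items :: "(nat \<Rightarrow> real) set" where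
  "dominated_by_items = {g \<in> W n. \<forall>S. finite S \<longrightarrow> dominated g S (err g S)}"

text \<open>Each block \<open>k\<close> is charged to one member \<open>\<phi> k\<close>, and each
  member is dominated on its own blocks by \<open>dominated_average\<close>. The replacement lives
  on those blocks, so it vanishes for members without any. The error 5/8 is 9/16 for the members
  plus 1/16 for the neglected rest.\<close>

lemma charge_blocks:
  assumes P: "family dominated_by_items n P" and S: "finite S" "R \<subseteq> S"
    and \<phi>: "\<And>k. k \<in> R \<Longrightarrow> \<phi> k \<in> P \<and> supp (fst (\<phi> k)) \<inter> D k \<noteq> {}"
    and rest: "\<And>k. k \<in> R \<Longrightarrow> \<bar>a k * (\<Sum>p\<in>P - {\<phi> k}. pairing (fst p) (y k))\<bar> \<le> eps k / 16"
  obtains U g where "U \<subseteq> \<phi> ` R" "\<And>p. p \<in> U \<Longrightarrow> g p \<in> averages (W n) (snd p)"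
    "\<And>p. p \<in> U \<Longrightarrow> supp (g p) \<subseteq> (\<Union>k\<in>S. D k)" "\<And>p. p \<in> U \<Longrightarrow> enclosed (g p) (fst p)"
    "(\<Sum>k\<in>R. a k * pairing (family_sum P) (y k)) \<le> 2 / c * (\<Sum>p\<in>U. pairing (g p) (Z S)) + 5 / 8 * (\<Sum>k\<in>R. eps k)"
proof -
  have finP: "finite P" using familyD(1)[OF P] .
  have finR: "finite R" using S finite_subset by blast
  define K where "K p = {k \<in> R. \<phi> k = p}" for p
  have KR: "K p \<subseteq> R" for p by (auto simp: K_def)
  have finK: "finite (K p)" for p using KR finR finite_subset by blast
  have "\<forall>p\<in>P. \<exists>g. (g = (\<lambda>_. 0) \<or> g \<in> averages (W n) (snd p)) \<and> supp g \<subseteq> (\<Union>k\<in>K p. D k) \<and>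
      enclosed g (fst p) \<and> pairing (fst p) (Y (K p)) \<le> 2 / c * pairing g (Z (K p)) + 9 / 16 * err (fst p) (K p)"
    using dominated_average[OF familyD(4)[OF P, unfolded dominated_by_items_def] finK] by blast
  then obtain g where g: "\<And>p. p \<in> P \<Longrightarrow> g p = (\<lambda>_. 0) \<or> g p \<in> averages (W n) (snd p)"
    "\<And>p. p \<in> P \<Longrightarrow> supp (g p) \<subseteq> (\<Union>k\<in>K p. D k)" "\<And>p. p \<in> P \<Longrightarrow> enclosed (g p) (fst p)"
    "\<And>p. p \<in> P \<Longrightarrow> pairing (fst p) (Y (K p)) \<le> 2 / c * pairing (g p) (Z (K p)) + 9 / 16 * err (fst p) (K p)"
    by metis
  define U where "U = {p \<in> P. g p \<noteq> (\<lambda>_. 0)}"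
  have sub: "p \<in> \<phi> ` R" if "p \<in> U" for p
  proof -
    have "supp (g p) \<noteq> {}" using that by (auto simp: U_def supp_def fun_eq_iff)
    then have "K p \<noteq> {}" using g(2)[of p] that by (auto simp: U_def)
    then show ?thesis by (auto simp: K_def)
  qed
  \<comment> \<open>Crude, but the blocks charged to different members are disjoint, so these errors
    add up to one sum over \<open>R\<close>.\<close>
  have errK: "err (fst p) (K p) \<le> (\<Sum>k\<in>K p. eps k)" if "p \<in> P" for p
  proof (cases "touched (fst p) (K p) = {}")
    case True
    then show ?thesis using eps_pos by (simp add: err_def sum_nonneg less_imp_le)
  next
    case False
    then have "Min (touched (fst p) (K p)) \<in> touched (fst p) (K p)"
      using finite_touched[OF finK] by simp
    then have "Min (touched (fst p) (K p)) \<in> K p" by (auto simp: touched_def)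
    then show ?thesis using False finK eps_pos by (simp add: err_def member_le_sum less_imp_le)
  qed
  have "(\<Sum>k\<in>R. a k * pairing (family_sum P) (y k)) =
      (\<Sum>k\<in>R. a k * pairing (fst (\<phi> k)) (y k) + a k * (\<Sum>p\<in>P - {\<phi> k}. pairing (fst p) (y k)))"
  proof (rule sum.cong[OF refl])
    fix k assume "k \<in> R"
    then have "\<phi> k \<in> P" using \<phi> by blast
    then show "a k * pairing (family_sum P) (y k) =
        a k * pairing (fst (\<phi> k)) (y k) + a k * (\<Sum>p\<in>P - {\<phi> k}. pairing (fst p) (y k))"
      using finP by (simp add: pairing_family_sum sum.remove distrib_left)
  qed
  also have "\<dots> \<le> (\<Sum>k\<in>R. a k * pairing (fst (\<phi> k)) (y k) + eps k / 16)"
    by (rule sum_mono, rule add_left_mono, rule order_trans[OF abs_ge_self rest])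
  also have "\<dots> = (\<Sum>k\<in>R. a k * pairing (fst (\<phi> k)) (y k)) + (\<Sum>k\<in>R. eps k) / 16"
    by (simp add: sum.distrib sum_divide_distrib)
  also have "(\<Sum>k\<in>R. a k * pairing (fst (\<phi> k)) (y k)) =
      (\<Sum>p\<in>P. \<Sum>k\<in>K p. a k * pairing (fst (\<phi> k)) (y k))"
    unfolding K_def by (rule sum.group[symmetric]) (use finR finP \<phi> in auto)
  also have "\<dots> = (\<Sum>p\<in>P. pairing (fst p) (Y (K p)))"
    by (intro sum.cong refl) (simp add: pairing_Y finK, simp add: K_def)
  also have "\<dots> \<le> (\<Sum>p\<in>P. 2 / c * pairing (g p) (Z S) + 9 / 16 * (\<Sum>k\<in>K p. eps k))"
  proof (rule sum_mono)
    fix p assume p: "p \<in> P"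
    have eq: "pairing (g p) (Z (K p)) = pairing (g p) (Z S)"
      by (rule pairing_Z_subset[OF S(1) order_trans[OF KR S(2)] g(2)[OF p]])
    then show "pairing (fst p) (Y (K p)) \<le> 2 / c * pairing (g p) (Z S) + 9 / 16 * (\<Sum>k\<in>K p. eps k)"
      using g(4)[OF p, unfolded eq] errK[OF p] by linarith
  qed
  also have "\<dots> = 2 / c * (\<Sum>p\<in>P. pairing (g p) (Z S)) + 9 / 16 * (\<Sum>p\<in>P. \<Sum>k\<in>K p. eps k)"
    by (simp add: sum.distrib sum_distrib_left)
  also have "(\<Sum>p\<in>P. \<Sum>k\<in>K p. eps k) = (\<Sum>k\<in>R. eps k)"
    unfolding K_def by (rule sum.group) (use finR finP \<phi> in auto)
  also have "(\<Sum>p\<in>P. pairing (g p) (Z S)) = (\<Sum>p\<in>U. pairing (g p) (Z S))"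
    using finP by (intro sum.mono_neutral_right) (auto simp: U_def)
  finally have le: "(\<Sum>k\<in>R. a k * pairing (family_sum P) (y k)) \<le>
      2 / c * (\<Sum>p\<in>U. pairing (g p) (Z S)) + 5 / 8 * (\<Sum>k\<in>R. eps k)" by simp
  show thesis
  proof (rule that[OF _ _ _ _ le])
    show "U \<subseteq> \<phi> ` R" using sub by blast
    fix p assume p: "p \<in> U"
    then have pP: "p \<in> P" by (simp add: U_def)
    show "g p \<in> averages (W n) (snd p)" using g(1)[OF pP] p by (simp add: U_def)
    have "(\<Union>k\<in>K p. D k) \<subseteq> (\<Union>k\<in>S. D k)" using KR S(2) by blast
    then show "supp (g p) \<subseteq> (\<Union>k\<in>S. D k)" using g(2)[OF pP] by (rule order_trans[rotated])
    show "enclosed (g p) (fst p)" using g(3)[OF pP] .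
  qed
qed

text \<open>Every block is charged to the first member meeting it. After the first block
  \<open>k1\<close> the other members are negligible by \<open>good_tail\<close>. On
  \<open>k1\<close> no earlier block bounds the number of pieces, and many members may matter
  together; this case is treated separately.\<close>

lemma dominated_sum:
  assumes P: "family dominated_by_items n P" and S: "finite S"
  shows "dominated (family_sum P) S (err (family_sum P) S)"
proof (cases "touched (family_sum P) S = {}")
  case True
  then show ?thesis using dominated_untouched[OF S] by (simp add: err_def)
next
  case False
  define f where "f = family_sum P"
  define R where "R = touched f S"
  have RS: "R \<subseteq> S" and finR: "finite R" and Rne: "R \<noteq> {}"
    using False finite_touched[OF S] by (auto simp: R_def f_def touched_def)
  have PW: "family (W n) n P" by (rule family_mono[OF _ P]) (auto simp: dominated_by_items_def)
  have finP: "finite P" using familyD(1)[OF P] .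
  have fW: "f \<in> W n" unfolding f_def by (rule family_sum_W[OF PW])
  have suppf: "supp f = (\<Union>p\<in>P. supp (fst p))" unfolding f_def by (rule supp_family_sum[OF PW])
  have snd2: "2 \<le> snd p" if "p \<in> P" for p using familyD(4)[OF PW that] unfolding averages_iff by blast
  define k1 where "k1 = Min R"
  have k1: "k1 \<in> R" "\<And>k. k \<in> R \<Longrightarrow> k1 \<le> k" using finR Rne by (auto simp: k1_def)
  have err: "err f S = eps k1" using Rne by (simp add: err_def R_def k1_def)
  define T where "T k = {p \<in> P. supp (fst p) \<inter> D k \<noteq> {}}" for k
  have T: "finite (T k)" for k using finP by (simp add: T_def)
  have Tne: "T k \<noteq> {}" if "k \<in> R" for k
  proof -
    have "\<exists>p\<in>P. supp (fst p) \<inter> D k \<noteq> {}" using that unfolding R_def touched_def suppf by blast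
    then show ?thesis unfolding T_def by blast
  qed
  define \<phi> where "\<phi> k = arg_min_on first_index (T k)" for k
  have \<phi>: "\<phi> k \<in> T k" "\<And>p. p \<in> T k \<Longrightarrow> first_index (\<phi> k) \<le> first_index p" if "k \<in> R" for k
    unfolding \<phi>_def using T Tne[OF that] by (auto intro: arg_min_if_finite arg_min_least)
  have first: "prec (\<phi> k) p" if "k \<in> R" "p \<in> T k" "p \<noteq> \<phi> k" for k p
  proof -
    have "\<phi> k \<in> P" "p \<in> P" using \<phi>(1)[OF that(1)] that(2) by (auto simp: T_def)
    then show ?thesis using familyD(5)[OF PW, of "\<phi> k" p] \<phi>(2)[OF that(1,2)] prec_first_index[of p "\<phi> k"] that(3) by auto
  qed
  \<comment> \<open>A predecessor meeting block \<open>k\<close> forces the size past the start of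
    that block.\<close>
  have size: "\<beta> k 0 < snd p" if qp: "q \<in> T k" "prec q p" for k p q
  proof -
    have q: "q \<in> P" using qp(1) by (simp add: T_def)
    obtain u where u: "u \<in> supp (fst q)" "u \<in> D k" using qp(1) unfolding T_def by blast
    have "u \<le> Max (supp (fst q))" using u family_supp(1)[OF PW q] by simp
    then show ?thesis using qp(2) u(2) unfolding prec_def D_def by simp
  qed
  obtain u1 where u1: "u1 \<in> supp f" "u1 \<in> D k1" using k1(1) by (auto simp: R_def touched_def)
  have rest0: "(\<Sum>p\<in>P - {\<phi> k}. pairing (fst p) (y k)) = (\<Sum>p\<in>T k - {\<phi> k}. pairing (fst p) (y k))" for k
    using finP by (intro sum.mono_neutral_right) (auto simp: T_def pairing_y_0)
  have rest: "\<bar>a k * (\<Sum>p\<in>P - {\<phi> k}. pairing (fst p) (y k))\<bar> \<le> eps k / 16" if k: "k \<in> R" "k1 < k" for k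
    unfolding rest0
  proof (rule good_tail[OF PW _ _ k(2)])
    show "\<forall>p\<in>T k - {\<phi> k}. \<beta> k 0 < snd p" using first[OF k(1)] size[OF \<phi>(1)[OF k(1)]] by blast
  qed (use u1 in \<open>auto simp: f_def T_def\<close>)
  have order: "prec p q" if o: "p \<in> T k" "q \<in> T k'" "p \<notin> T k'" "k < k'" "p \<in> P" for p q k k'
  proof -
    have q: "q \<in> P" using o(2) by (simp add: T_def)
    have "p \<noteq> q" using o by blast
    moreover have "\<not> prec q p"
    proof
      assume "prec q p"
      moreover obtain s t where "s \<in> supp (fst p)" "s \<in> D k" "t \<in> supp (fst q)" "t \<in> D k'"
        using o(1,2) unfolding T_def by blast
      ultimately have "t < s" "s < t" using vec_beforeD D_less[OF o(4)] unfolding prec_def by blast+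
      then show False by simp
    qed
    ultimately show ?thesis using familyD(5)[OF PW o(5) q] by blast
  qed
  have fY: "pairing f (Y S) = (\<Sum>k\<in>R. a k * pairing f (y k))"
    by (rule pairing_Y_touched[OF S]) (use RS in \<open>auto simp: R_def\<close>)
  have \<phi>': "\<phi> k \<in> P \<and> supp (fst (\<phi> k)) \<inter> D k \<noteq> {}" if "k \<in> R" for k
    using \<phi>(1)[OF that] by (simp add: T_def)
  define p1 where "p1 = \<phi> k1"
  have p1: "p1 \<in> P" "p1 \<in> T k1" using \<phi>(1)[OF k1(1)] by (auto simp: p1_def T_def)
  show ?thesis
  \<comment> \<open>With one member on the first block, every block can be charged; the error is 5/8
    of a geometric sum, at most 5/7 of \<open>eps k1\<close>.\<close>
  proof (cases "T k1 = {p1}")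
    case True
    have r: "\<bar>a k * (\<Sum>p\<in>P - {\<phi> k}. pairing (fst p) (y k))\<bar> \<le> eps k / 16" if k: "k \<in> R" for k
    proof (cases "k = k1")
      case k: True
      have "T k - {\<phi> k} = {}" unfolding k using True p1_def by simp
      then have "(\<Sum>p\<in>T k - {\<phi> k}. pairing (fst p) (y k)) = 0" by (simp only: sum.empty)
      then show ?thesis unfolding rest0 using eps_pos[of k] by simp
    next
      case False
      then show ?thesis using rest[OF k] k1(2)[OF k] by simp
    qed
    obtain U g where U: "U \<subseteq> \<phi> ` R" "\<And>p. p \<in> U \<Longrightarrow> g p \<in> averages (W n) (snd p)"
      "\<And>p. p \<in> U \<Longrightarrow> supp (g p) \<subseteq> (\<Union>k\<in>S. D k)" "\<And>p. p \<in> U \<Longrightarrow> enclosed (g p) (fst p)"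
      and le: "(\<Sum>k\<in>R. a k * pairing (family_sum P) (y k)) \<le>
        2 / c * (\<Sum>p\<in>U. pairing (g p) (Z S)) + 5 / 8 * (\<Sum>k\<in>R. eps k)"
      by (rule charge_blocks[OF P S RS \<phi>' r]; (assumption | rule that))
    have UP: "U \<subseteq> P" using U(1) \<phi>' by blast
    have gW: "g p \<in> W n" if "p \<in> U" for p using averages_W[OF U(2)[OF that]] .
    define I where "I p = (g p, snd p)" for p
    define G where "G = (\<lambda>t. \<Sum>p\<in>U. g p t)"
    have "G = (\<lambda>_. 0) \<or> G \<in> W n"
    proof (cases "U = {}")
      case True
      then show ?thesis by (simp add: G_def)
    next
      case False
      have "family (W n) n (I ` U) \<and> family_sum (I ` U) = (\<lambda>t. \<Sum>p\<in>U. fst (I p) t)"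
      proof (rule family_image[OF PW UP False])
        fix p q assume pq: "p \<in> U" "q \<in> U" "prec p q"
        have "vec_before (g p) (g q)"
          using vec_before_enclosed[OF _ U(4)[OF pq(1)] U(4)[OF pq(2)] gW[OF pq(1)] gW[OF pq(2)]] pq(3)
          unfolding prec_def by blast
        moreover have "Max (supp (g p)) < snd q"
        proof -
          have "Max (supp (g p)) \<in> supp (g p)" using W_supp[OF gW[OF pq(1)]] by simp
          then obtain t where "t \<in> supp (fst p)" "Max (supp (g p)) < t" by (rule enclosedE[OF U(4)[OF pq(1)]])
          moreover have "t \<le> Max (supp (fst p))" using calculation family_supp(1)[OF PW subsetD[OF UP pq(1)]] by simp
          ultimately show ?thesis using pq(3) unfolding prec_def by simp
        qed
        ultimately show "prec (I p) (I q)" using pq(3) by (simp add: prec_def I_def)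
      next
        fix p assume p: "p \<in> U"
        have "first_index (I p) \<in> supp (g p)" using W_supp[OF gW[OF p]] by (simp add: first_index_def I_def)
        then obtain s where "s \<in> supp (fst p)" "s < first_index (I p)" by (rule enclosedE[OF U(4)[OF p]])
        moreover have "first_index p \<le> s" using calculation family_supp(1)[OF PW subsetD[OF UP p]] by (simp add: first_index_def)
        ultimately show "first_index p \<le> first_index (I p)" by simp
      qed (use U(2) in \<open>auto simp: I_def\<close>)
      then show ?thesis using family_sum_W[of n "I ` U"] by (simp add: G_def I_def)
    qed
    moreover have sG: "supp G \<subseteq> (\<Union>p\<in>U. supp (g p))" unfolding G_def by (rule supp_sum_subset)
    then have "supp G \<subseteq> (\<Union>k\<in>S. D k)" using U(3) by blast
    moreover have "enclosed G f"
      unfolding enclosed_def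
    proof
      fix u assume "u \<in> supp G"
      then obtain p where p: "p \<in> U" "u \<in> supp (g p)" using sG by blast
      from enclosedE[OF U(4)[OF p(1)] p(2)] obtain s t where "s \<in> supp (fst p)" "t \<in> supp (fst p)" "s < u" "u < t" .
      then show "\<exists>s\<in>supp f. \<exists>t\<in>supp f. s < u \<and> u < t" using p(1) UP unfolding suppf by blast
    qed
    moreover have "pairing f (Y S) \<le> 2 / c * pairing G (Z S) + eps k1"
    proof -
      have "(\<Sum>k\<in>R. eps k) \<le> 8 / 7 * eps k1" unfolding eps_def by (rule sum_eighth_le[OF finR k1(2)])
      then have "5 / 8 * (\<Sum>k\<in>R. eps k) \<le> eps k1" using eps_pos[of k1] by linarith
      moreover have GZ: "pairing G (Z S) = (\<Sum>p\<in>U. pairing (g p) (Z S))" unfolding G_def by (rule pairing_sum_left)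
      ultimately show ?thesis unfolding fY GZ using le unfolding f_def by linarith
    qed
    ultimately show ?thesis unfolding dominated_def f_def[symmetric] err by blast
  next
    case False
    \<comment> \<open>The member \<open>e\<close> is the last one meeting block \<open>k1\<close>.
      The others, forming \<open>F\<close>, end before \<open>e\<close> does and so meet no later
      block. On \<open>y k1\<close> the member \<open>e\<close> is negligible because its size
      passes the start of the block, but it may be in charge of later blocks.\<close>
    have "Max (first_index ` T k1) \<in> first_index ` T k1" using T[of k1] p1(2) by (intro Max_in) auto
    then obtain e where eT: "e \<in> T k1" and e: "Max (first_index ` T k1) = first_index e" by blast
    have emax: "first_index p \<le> first_index e" if "p \<in> T k1" for p
      unfolding e[symmetric] using that T[of k1] by (intro Max_ge) auto
    have eP: "e \<in> P" using eT by (simp add: T_def)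
    define F where "F = T k1 - {e}"
    have FP: "F \<subseteq> P" by (auto simp: F_def T_def)
    have before_e: "prec p e" if "p \<in> F" for p
      using familyD(5)[OF PW, of p e] that FP eP emax[of p] prec_first_index[of e p] by (fastforce simp: F_def)
    have "p1 \<noteq> e"
    proof
      assume "p1 = e"
      obtain q where q: "q \<in> T k1" "q \<noteq> p1" using False p1(2) by blast
      then have "prec p1 q" using first[OF k1(1) q(1)] by (simp add: p1_def)
      moreover have "prec q e" using before_e[of q] q \<open>p1 = e\<close> by (simp add: F_def)
      ultimately show False using prec_first_index[of p1 q] prec_first_index[of q e] \<open>p1 = e\<close> by simp
    qed
    then have p1F: "p1 \<in> F" using p1 by (simp add: F_def)
    have onlyF: "p \<notin> T k" if "p \<in> F" "k1 < k" for p k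
    proof
      assume "p \<in> T k"
      moreover obtain s where "s \<in> supp (fst e)" "s \<in> D k1" using eT by (auto simp: T_def)
      moreover have "vec_before (fst p) (fst e)" using before_e[OF that(1)] by (simp add: prec_def)
      ultimately obtain t where "t \<in> supp (fst p)" "t \<in> D k" "t < s" using vec_beforeD by (fastforce simp: T_def)
      then show False using D_less[OF that(2) \<open>s \<in> D k1\<close>] by fastforce
    qed
    define f1 where "f1 = family_sum F"
    have famF: "family (W n) n F" by (rule family_subset[OF PW FP]) (use p1F in blast)
    have f1W: "f1 \<in> W n" unfolding f1_def by (rule family_sum_W[OF famF])
    have suppf1: "supp f1 = (\<Union>p\<in>F. supp (fst p))" unfolding f1_def by (rule supp_family_sum[OF famF])
    have "touched f1 S \<subseteq> {k1}"
    proof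
      fix k assume "k \<in> touched f1 S"
      then obtain p where p: "p \<in> F" "p \<in> T k" "k \<in> S" using FP unfolding touched_def suppf1 by (auto simp: T_def)
      then have "k \<in> R" unfolding R_def touched_def suppf using FP by (auto simp: T_def)
      then show "k \<in> {k1}" using onlyF[OF p(1), of k] p(2) k1(2)[of k] by fastforce
    qed
    moreover have k1S: "k1 \<in> S" using k1 RS by blast
    \<comment> \<open>The whole sum over \<open>F\<close> is replaced by one functional, at the
      better constant 1 / c.\<close>
    ultimately obtain h where h: "h = (\<lambda>_. 0) \<or> h \<in> W n" "supp h \<subseteq> D k1" "enclosed h f1"
      "pairing f1 (Y S) \<le> 1 / c * pairing h (Z S) + eps k1 / 16"
      using single_block[OF f1W S] by blast
    have f1Y: "pairing f1 (Y S) = a k1 * pairing f1 (y k1)"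
      using pairing_Y_touched[OF S \<open>touched f1 S \<subseteq> {k1}\<close>] k1S by simp
    have split1: "a k1 * pairing f (y k1) \<le> pairing f1 (Y S) + eps k1 / 16"
    proof -
      have "pairing f (y k1) = (\<Sum>p\<in>T k1. pairing (fst p) (y k1))"
        unfolding f_def pairing_family_sum using finP
        by (intro sum.mono_neutral_right) (auto simp: T_def pairing_y_0)
      also have "\<dots> = pairing (fst e) (y k1) + (\<Sum>p\<in>F. pairing (fst p) (y k1))"
        unfolding F_def using T eT by (simp add: sum.remove)
      also have "(\<Sum>p\<in>F. pairing (fst p) (y k1)) = pairing f1 (y k1)" by (simp add: f1_def pairing_family_sum)
      finally have "a k1 * pairing f (y k1) = a k1 * pairing (fst e) (y k1) + pairing f1 (Y S)"
        by (simp add: f1Y distrib_left)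
      moreover have "\<bar>a k1 * pairing (fst e) (y k1)\<bar> \<le> eps k1 / 16"
        by (rule good_single[OF PW eP]) (rule size[OF p1(2) before_e[OF p1F]])
      ultimately show ?thesis by linarith
    qed
    define R' where "R' = R - {k1}"
    have R'k: "k \<in> R" "k1 < k" if "k \<in> R'" for k using that k1(2)[of k] by (auto simp: R'_def)
    have R'S: "R' \<subseteq> S" using RS by (auto simp: R'_def)
    obtain U g where U: "U \<subseteq> \<phi> ` R'" "\<And>p. p \<in> U \<Longrightarrow> g p \<in> averages (W n) (snd p)"
      "\<And>p. p \<in> U \<Longrightarrow> supp (g p) \<subseteq> (\<Union>k\<in>S. D k)" "\<And>p. p \<in> U \<Longrightarrow> enclosed (g p) (fst p)"
      and le: "(\<Sum>k\<in>R'. a k * pairing (family_sum P) (y k)) \<le>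
        2 / c * (\<Sum>p\<in>U. pairing (g p) (Z S)) + 5 / 8 * (\<Sum>k\<in>R'. eps k)"
      by (rule charge_blocks[OF P S R'S \<phi>'[OF R'k(1)] rest[OF R'k]]; (assumption | rule that))
    have UP: "U \<subseteq> P" using U(1) \<phi>' R'k(1) by blast
    have gW: "g p \<in> W n" if "p \<in> U" for p using averages_W[OF U(2)[OF that]] .
    \<comment> \<open>The members charged with later blocks come after all of \<open>F\<close>,
      which leaves the place of \<open>p1\<close> free for \<open>h\<close>.\<close>
    have FU: "prec q p" if qp: "q \<in> F" "p \<in> U" for q p
    proof -
      obtain k where k: "k \<in> R'" "p = \<phi> k" using U(1) qp(2) by blast
      have "p \<in> T k" using \<phi>(1)[OF R'k(1)[OF k(1)]] k(2) by simp
      moreover have "q \<in> T k1" using qp(1) by (simp add: F_def)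
      ultimately show ?thesis
        using order onlyF[OF qp(1) R'k(2)[OF k(1)]] R'k(2)[OF k(1)] subsetD[OF FP qp(1)] by blast
    qed
    have FU0: "q \<noteq> p" if "q \<in> F" "p \<in> U" for q p using prec_first_index[OF FU[OF that]] by auto
    \<comment> \<open>A single element of \<open>W\<close> divided by 2 is an average of size 2, the
      least size allowed. So \<open>h2\<close> can open the new sum, and 2 / c times
      \<open>h2\<close> is 1 / c times \<open>h\<close>.\<close>
    define h2 where "h2 = (\<lambda>t. h t / 2)"
    have sh2: "supp h2 = supp h" unfolding h2_def by (rule supp_divide) simp
    define I where "I p = (if p = p1 then (h2, 2) else (g p, snd p))" for p
    \<comment> \<open>A zero \<open>h\<close> is left out, since members of a family are
      nonzero.\<close>
    define U' where "U' = (if h = (\<lambda>_. 0) then U else insert p1 U)"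
    have U'P: "U' \<subseteq> P" using UP p1 by (auto simp: U'_def)
    have finU: "finite U" using UP finP finite_subset by blast
    have IU: "I p = (g p, snd p)" if "p \<in> U" for p using FU0[OF p1F that] by (simp add: I_def)
    have p1U: "p1 \<notin> U" using FU0[OF p1F, of p1] by blast
    have h2avg: "h2 \<in> averages (W n) 2" if "h \<noteq> (\<lambda>_. 0)"
      unfolding averages_iff using h(1) that
      by (intro exI[of _ "{h}"]) (auto simp: h2_def vec_chain_def)
    define G where "G = (\<lambda>t. \<Sum>p\<in>U'. fst (I p) t)"
    have Ienc: "enclosed (fst (I p)) f" if "p \<in> U'" for p
      unfolding enclosed_def
    proof
      fix u assume u: "u \<in> supp (fst (I p))"
      show "\<exists>s\<in>supp f. \<exists>t\<in>supp f. s < u \<and> u < t"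
      proof (cases "p = p1")
        case True
        then have "u \<in> supp h" using u sh2 by (simp add: I_def)
        from enclosedE[OF h(3) this] obtain s t where "s \<in> supp f1" "t \<in> supp f1" "s < u" "u < t" .
        then show ?thesis using FP unfolding suppf1 suppf by blast
      next
        case False
        then have p: "p \<in> U" using that by (auto simp: U'_def split: if_splits)
        then have "u \<in> supp (g p)" using u IU by simp
        from enclosedE[OF U(4)[OF p] this] obtain s t where "s \<in> supp (fst p)" "t \<in> supp (fst p)" "s < u" "u < t" .
        then show ?thesis using p UP unfolding suppf by blast
      qed
    qed
    have "G = (\<lambda>_. 0) \<or> G \<in> W n"
    proof (cases "U' = {}")
      case True
      then show ?thesis by (simp add: G_def)
    next
      case ne: False
      have "family (W n) n (I ` U') \<and> family_sum (I ` U') = (\<lambda>t. \<Sum>p\<in>U'. fst (I p) t)"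
      proof (rule family_image[OF PW U'P ne])
        fix p q assume pq: "p \<in> U'" "q \<in> U'" "prec p q"
        have "q \<noteq> p1"
        proof
          assume "q = p1"
          then have "p \<in> U" using pq prec_first_index[of p1 p1] by (auto simp: U'_def split: if_splits)
          then show False using FU[OF p1F, of p] pq(3) \<open>q = p1\<close> prec_first_index[of p p1] prec_first_index[of p1 p] by simp
        qed
        then have q: "q \<in> U" using pq(2) by (auto simp: U'_def split: if_splits)
        show "prec (I p) (I q)"
        proof (cases "p = p1")
          case True
          have hW: "h \<in> W n" using h(1) pq(1) p1U True by (auto simp: U'_def split: if_splits)
          \<comment> \<open>A point of \<open>h\<close> lies below a point of some member
            \<open>r\<close> of \<open>F\<close>, and \<open>r\<close> precedes \<open>q\<close>.
            Hence \<open>h2\<close> ends before \<open>g q\<close> begins and below the size of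
            \<open>q\<close>.\<close>
          have hq: "u < i \<and> u < snd q" if u: "u \<in> supp h2" and i: "i \<in> supp (g q)" for u i
          proof -
            have "u \<in> supp h" using u sh2 by simp
            from enclosedE[OF h(3) this] obtain s t where "s \<in> supp f1" "t \<in> supp f1" "s < u" "u < t" .
            then obtain r where r: "r \<in> F" "t \<in> supp (fst r)" unfolding suppf1 by blast
            have rq: "prec r q" using FU[OF r(1) q] .
            from enclosedE[OF U(4)[OF q] i] obtain s' where s': "s' \<in> supp (fst q)" "s' < i" .
            have "t < s'" using rq vec_beforeD r(2) s'(1) unfolding prec_def by blast
            moreover have "t \<le> Max (supp (fst r))" using r(2) family_supp(1)[OF PW subsetD[OF FP r(1)]] by simp
            ultimately show ?thesis using \<open>u < t\<close> s'(2) rq unfolding prec_def by linarith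
          qed
          have ne: "finite (supp h2)" "supp h2 \<noteq> {}" using W_supp[OF hW] sh2 by auto
          have "vec_before h2 (g q)"
            by (rule vec_beforeI) (use ne W_supp[OF gW[OF q]] hq in auto)
          moreover have "Max (supp h2) < snd q"
          proof -
            obtain i where "i \<in> supp (g q)" using W_supp[OF gW[OF q]] by blast
            then show ?thesis using ne hq by simp
          qed
          moreover have "2 < snd q" using FU[OF p1F q] snd2[OF p1(1)] by (simp add: prec_def)
          ultimately show ?thesis using True IU[OF q] by (simp add: prec_def I_def)
        next
          case False
          then have p: "p \<in> U" using pq(1) by (auto simp: U'_def split: if_splits)
          have "vec_before (g p) (g q)"
            using vec_before_enclosed[OF _ U(4)[OF p] U(4)[OF q] gW[OF p] gW[OF q]] pq(3)
            unfolding prec_def by blast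
          moreover have "Max (supp (g p)) < snd q"
          proof -
            have "Max (supp (g p)) \<in> supp (g p)" using W_supp[OF gW[OF p]] by simp
            then obtain t where "t \<in> supp (fst p)" "Max (supp (g p)) < t" by (rule enclosedE[OF U(4)[OF p]])
            moreover have "t \<le> Max (supp (fst p))" using calculation family_supp(1)[OF PW subsetD[OF UP p]] by simp
            ultimately show ?thesis using pq(3) unfolding prec_def by simp
          qed
          ultimately show ?thesis using pq(3) IU[OF p] IU[OF q] by (simp add: prec_def)
        qed
      next
        fix p assume p: "p \<in> U'"
        show "first_index p \<le> first_index (I p)"
        proof (cases "p = p1")
          case True
          have hW: "h \<in> W n" using h(1) p p1U True by (auto simp: U'_def split: if_splits)
          have "first_index (I p) \<in> supp h" using W_supp[OF hW] sh2 True by (simp add: first_index_def I_def)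
          from enclosedE[OF h(3) this] obtain s where "s \<in> supp f1" "s < first_index (I p)" .
          then obtain r where r: "r \<in> F" "s \<in> supp (fst r)" unfolding suppf1 by blast
          have "first_index p \<le> first_index r" using \<phi>(2)[OF k1(1), of r] r(1) True by (simp add: p1_def F_def)
          also have "\<dots> \<le> s" using r(2) family_supp(1)[OF PW subsetD[OF FP r(1)]] by (simp add: first_index_def)
          finally show ?thesis using \<open>s < first_index (I p)\<close> by simp
        next
          case False
          then have pU: "p \<in> U" using p by (auto simp: U'_def split: if_splits)
          have "first_index (I p) \<in> supp (g p)" using W_supp[OF gW[OF pU]] IU[OF pU] by (simp add: first_index_def)
          then obtain s where "s \<in> supp (fst p)" "s < first_index (I p)" by (rule enclosedE[OF U(4)[OF pU]])
          moreover have "first_index p \<le> s" using calculation family_supp(1)[OF PW subsetD[OF UP pU]] by (simp add: first_index_def)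
          ultimately show "first_index p \<le> first_index (I p)" by simp
        qed
      next
        fix p assume p: "p \<in> U'"
        show "fst (I p) \<in> averages (W n) (snd (I p))"
        proof (cases "p = p1")
          case True
          then have "h \<noteq> (\<lambda>_. 0)" using p p1U by (auto simp: U'_def)
          then show ?thesis using h2avg True by (simp add: I_def)
        next
          case False
          then have "p \<in> U" using p by (simp add: U'_def split: if_splits)
          then show ?thesis using U(2)[of p] IU[of p] by simp
        qed
      qed
      then show ?thesis using family_sum_W[of n "I ` U'"] by (simp add: G_def)
    qed
    moreover have sG: "supp G \<subseteq> (\<Union>p\<in>U'. supp (fst (I p)))" unfolding G_def by (rule supp_sum_subset)
    have "supp (fst (I p)) \<subseteq> (\<Union>k\<in>S. D k)" if "p \<in> U'" for p
    proof (cases "p = p1")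
      case True
      then show ?thesis using h(2) sh2 k1S by (auto simp: I_def)
    next
      case False
      then have "p \<in> U" using that by (auto simp: U'_def split: if_splits)
      then show ?thesis using U(3) IU by simp
    qed
    then have "supp G \<subseteq> (\<Union>k\<in>S. D k)" using sG by blast
    moreover have "enclosed G f" using Ienc sG unfolding enclosed_def by blast
    moreover have "pairing f (Y S) \<le> 2 / c * pairing G (Z S) + eps k1"
    proof -
      have "(\<Sum>k\<in>R'. eps k) \<le> 8 / 7 * eps (Suc k1)"
        unfolding eps_def
      proof (rule sum_eighth_le)
        show "finite R'" using finR by (simp add: R'_def)
        show "Suc k1 \<le> k" if "k \<in> R'" for k using R'k(2)[OF that] by (rule Suc_leI)
      qed
      also have "\<dots> = eps k1 / 7" by (simp add: eps_def)
      finally have E: "(\<Sum>k\<in>R'. eps k) \<le> eps k1 / 7" .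
      have "pairing G (Z S) = (\<Sum>p\<in>U'. pairing (fst (I p)) (Z S))" unfolding G_def by (rule pairing_sum_left)
      also have "\<dots> = pairing h2 (Z S) + (\<Sum>p\<in>U. pairing (fst (I p)) (Z S))"
      proof (cases "h = (\<lambda>_. 0)")
        case True
        then show ?thesis by (simp add: U'_def h2_def)
      next
        case False
        then show ?thesis using p1U finU by (simp add: U'_def I_def)
      qed
      also have "pairing h2 (Z S) = pairing h (Z S) / 2" unfolding h2_def by (rule pairing_divide_left)
      also have "(\<Sum>p\<in>U. pairing (fst (I p)) (Z S)) = (\<Sum>p\<in>U. pairing (g p) (Z S))"
        using IU by (intro sum.cong) auto
      finally have "2 / c * pairing G (Z S) = 1 / c * pairing h (Z S) + 2 / c * (\<Sum>p\<in>U. pairing (g p) (Z S))"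
        by (simp add: algebra_simps)
      moreover have "pairing f (Y S) = a k1 * pairing f (y k1) + (\<Sum>k\<in>R'. a k * pairing f (y k))"
        unfolding fY R'_def using finR k1(1) by (simp add: sum.remove)
      \<comment> \<open>The errors are 1/16 from \<open>h\<close>, 1/16 from \<open>e\<close> and
        5/8 of 1/7 from the later blocks, less than 1 in units of \<open>eps k1\<close>.\<close>
      ultimately show ?thesis using split1 h(4) le E eps_pos[of k1] unfolding f_def by linarith
    qed
    ultimately show ?thesis unfolding dominated_def f_def[symmetric] err by blast
  qed
qed

lemma dominated_W: "f \<in> W n \<Longrightarrow> \<forall>S. finite S \<longrightarrow> dominated f S (err f S)"
proof (induction rule: W_induct)
  case (unit i)
  show ?case
  proof (intro allI impI)
    fix S :: "nat set" assume S: "finite S"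
    show "dominated (unit_vec i) S (err (unit_vec i) S)"
    proof (cases "touched (unit_vec i) S = {}")
      case True
      then show ?thesis using dominated_untouched[OF S] by (simp add: err_def)
    next
      case False
      then obtain k where k: "k \<in> touched (unit_vec i) S" by blast
      have "touched (unit_vec i) S = {k}"
        using k D_disjoint by (fastforce simp: touched_def supp_def unit_vec_def split: if_splits)
      then show ?thesis
        using dominated_mono[OF dominated_single[OF unit_vec_W[OF unit] S]] eps_pos[of k] by (simp add: err_def)
    qed
  qed
next
  case (neg_unit i)
  have W: "(\<lambda>j. - unit_vec i j) \<in> W n" using W_uminus[OF unit_vec_W[OF neg_unit]] .
  show ?case
  proof (intro allI impI)
    fix S :: "nat set" assume S: "finite S"
    show "dominated (\<lambda>j. - unit_vec i j) S (err (\<lambda>j. - unit_vec i j) S)"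
    proof (cases "touched (\<lambda>j. - unit_vec i j) S = {}")
      case True
      then show ?thesis using dominated_untouched[OF S] by (simp add: err_def)
    next
      case False
      then obtain k where k: "k \<in> touched (\<lambda>j. - unit_vec i j) S" by blast
      have "touched (\<lambda>j. - unit_vec i j) S = {k}"
        using k D_disjoint by (fastforce simp: touched_def supp_def unit_vec_def split: if_splits)
      then show ?thesis
        using dominated_mono[OF dominated_single[OF W S]] eps_pos[of k] by (simp add: err_def)
    qed
  qed
next
  case (average f l)
  have f: "f \<in> W n" by (rule averages_W, rule averages_mono[OF _ average]) blast
  show ?case
  proof (intro allI impI)
    fix S :: "nat set" assume S: "finite S"
    from dominated_average[OF average S] obtain g where g: "g = (\<lambda>_. 0) \<or> g \<in> averages (W n) l"
      "supp g \<subseteq> (\<Union>k\<in>S. D k)" "enclosed g f"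
      "pairing f (Y S) \<le> 2 / c * pairing g (Z S) + 9 / 16 * err f S" by blast
    moreover have "9 / 16 * err f S \<le> err f S" using eps_pos by (simp add: err_def less_imp_le)
    ultimately show "dominated f S (err f S)"
      unfolding dominated_def using averages_W by (intro exI[of _ g]) auto
  qed
next
  case (sum P)
  then show ?case using dominated_sum[of P] by (simp add: dominated_by_items_def)
qed

text \<open>The additive 1 is \<open>eps 0\<close>; it is absorbed later by means of
  \<open>coefficient_le\<close>.\<close>

lemma domination:
  assumes S: "finite S"
  shows "norm_W n (Y S) \<le> 2 / c * norm_W n (Z S) + 1"
proof (rule norm_W_leI)
  fix f assume "f \<in> W n"
  then have "dominated f S (err f S)" using dominated_W S by blast
  then obtain g where g: "g = (\<lambda>_. 0) \<or> g \<in> W n" "pairing f (Y S) \<le> 2 / c * pairing g (Z S) + err f S"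
    unfolding dominated_def by blast
  have "pairing g (Z S) \<le> norm_W n (Z S)" using g(1) pairing_le_norm norm_W_nonneg by auto
  then have "2 / c * pairing g (Z S) \<le> 2 / c * norm_W n (Z S)" using c by (intro mult_left_mono) auto
  moreover have "err f S \<le> 1" by (simp add: err_def eps_def power_le_one)
  ultimately show "pairing f (Y S) \<le> 2 / c * norm_W n (Z S) + 1" using g(2) by linarith
qed

end

section \<open>Isomorphic closed spans\<close>

lemma subspace_closure:
  fixes S :: "'a::real_normed_vector set"
  assumes S: "subspace S"
  shows "subspace (closure S)"
  unfolding subspace_def
proof (intro conjI ballI allI)
  show "0 \<in> closure S" using S closure_subset subspace_0 by blast
  fix x assume "x \<in> closure S"
  then obtain s where s: "\<And>r. s r \<in> S" "s \<longlonglongrightarrow> x" unfolding closure_sequential by blast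
  show "c *\<^sub>R x \<in> closure S" for c
    unfolding closure_sequential
    by (rule exI[of _ "\<lambda>r. c *\<^sub>R s r"]) (use s S in \<open>auto intro: subspace_scale tendsto_intros\<close>)
  fix y assume "y \<in> closure S"
  then obtain t where t: "\<And>r. t r \<in> S" "t \<longlonglongrightarrow> y" unfolding closure_sequential by blast
  show "x + y \<in> closure S"
    unfolding closure_sequential
    by (rule exI[of _ "\<lambda>r. s r + t r"]) (use s t S in \<open>auto intro: subspace_add tendsto_intros\<close>)
qed

lemma span_range_sum:
  fixes p :: "nat \<Rightarrow> 'a::real_vector"
  assumes "x \<in> span (range p)"
  obtains S a where "finite S" "x = (\<Sum>k\<in>S. a k *\<^sub>R p k)"
proof -
  have "\<exists>S a. finite S \<and> x = (\<Sum>k\<in>S. a k *\<^sub>R p k)" using assms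
  proof (induction rule: span_induct_alt)
    case base
    show ?case by (intro exI[of _ "{}"]) simp
  next
    case (step c u y)
    then obtain S a k where S: "finite S" "y = (\<Sum>k\<in>S. a k *\<^sub>R p k)" and k: "u = p k" by blast
    define a0 where "a0 i = (if i \<in> S then a i else 0)" for i
    have y: "y = (\<Sum>i\<in>insert k S. a0 i *\<^sub>R p i)"
      unfolding S(2) using S(1) by (intro sum.mono_neutral_cong_left) (auto simp: a0_def)
    have "c *\<^sub>R u = (\<Sum>i\<in>insert k S. (if i = k then c else 0) *\<^sub>R p i)"
      unfolding k using S(1)
      by (subst sum.mono_neutral_right[of _ "{k}"]) auto
    then have "c *\<^sub>R u + y = (\<Sum>i\<in>insert k S. ((if i = k then c else 0) + a0 i) *\<^sub>R p i)"
      unfolding y by (simp add: sum.distrib scaleR_add_left)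
    moreover have "finite (insert k S)" using S(1) by simp
    ultimately show ?case by (intro exI[of _ "insert k S"] exI[of _ "\<lambda>i. (if i = k then c else 0) + a0 i"] conjI)
  qed
  then show thesis using that by blast
qed

text \<open>Coefficients controlled by the norm vanish with the sum. This gives the closed spans
  infinite dimension and allows linear maps to be prescribed on the sequence.\<close>

lemma lower_bound_independent:
  fixes p :: "nat \<Rightarrow> 'a::real_normed_vector"
  assumes \<kappa>: "0 < \<kappa>" and lower: "\<And>S a k. finite S \<Longrightarrow> k \<in> S \<Longrightarrow> \<kappa> * \<bar>a k\<bar> \<le> norm (\<Sum>k\<in>S. a k *\<^sub>R p k)"
  shows "inj p" "independent (range p)"
proof -
  have zero: "a k = 0" if "finite S" "k \<in> S" "(\<Sum>k\<in>S. a k *\<^sub>R p k) = 0" for S a k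
    using lower[OF that(1,2), of a] that(3) \<kappa> by (simp add: mult_le_0_iff)
  show inj: "inj p"
  proof (rule injI, rule ccontr)
    fix k l assume "p k = p l" "k \<noteq> l"
    then have "(\<Sum>i\<in>{k, l}. (if i = k then 1 else - 1) *\<^sub>R p i) = 0" by simp
    from zero[OF _ _ this, of k] show False by simp
  qed
  show "independent (range p)"
    unfolding independent_explicit_module
  proof (intro allI impI)
    fix t u v assume t: "finite t" "t \<subseteq> range p" "(\<Sum>v\<in>t. u v *\<^sub>R v) = 0" "v \<in> t"
    then obtain S where S: "t = p ` S" by (auto simp: subset_image_iff)
    have injS: "inj_on p S" using inj by (rule inj_on_subset) simp
    then have "finite S" using t(1) S finite_imageD by blast
    moreover obtain k where "k \<in> S" "v = p k" using t(4) S by blast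
    moreover have "(\<Sum>k\<in>S. u (p k) *\<^sub>R p k) = 0" using t(3) unfolding S sum.reindex[OF injS] by simp
    ultimately show "u v = 0" using zero[of S k "\<lambda>k. u (p k)"] by simp
  qed
qed

lemma inf_dim_closed_span:
  fixes p :: "nat \<Rightarrow> 'a::real_normed_vector"
  assumes "inj p" "independent (range p)"
  shows "inf_dim_closed_subspace (closure (span (range p)))"
  unfolding inf_dim_closed_subspace_def
proof (intro conjI notI)
  assume "\<exists>B. finite B \<and> closure (span (range p)) \<subseteq> span B"
  then obtain B where B: "finite B" "closure (span (range p)) \<subseteq> span B" by blast
  have "range p \<subseteq> span B" using B(2) closure_subset span_superset by (meson order_trans)
  then have "finite (range p)" using independent_span_bound[OF B(1) assms(2)] by blast
  then show False using assms(1) finite_imageD by blast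
qed (auto intro: subspace_closure)

text \<open>Independence makes the map well defined on the algebraic span; the bound
  \<open>K\<close> makes it uniformly continuous there, hence extendable to the closure.\<close>

lemma linear_extension_on_closed_span:
  fixes p q :: "nat \<Rightarrow> 'a::banach"
  assumes ind: "inj p" "independent (range p)"
    and K: "\<And>S a. finite S \<Longrightarrow> norm (\<Sum>k\<in>S. a k *\<^sub>R q k) \<le> K * norm (\<Sum>k\<in>S. a k *\<^sub>R p k)"
  obtains T where "continuous_on (closure (span (range p))) T"
    "\<And>S a. finite S \<Longrightarrow> T (\<Sum>k\<in>S. a k *\<^sub>R p k) = (\<Sum>k\<in>S. a k *\<^sub>R q k)"
    "T ` closure (span (range p)) \<subseteq> closure (span (range q))"
proof -
  obtain g where g: "linear g" "\<And>k. g (p k) = q k"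
  proof -
    obtain g where "linear g" "\<And>x. x \<in> range p \<Longrightarrow> g x = q (the_inv p x)"
      using linear_independent_extend[OF ind(2), of "\<lambda>x. q (the_inv p x)"] by blast
    then show thesis using that[of g] ind(1) by (simp add: the_inv_f_f)
  qed
  have gS: "g (\<Sum>k\<in>S. a k *\<^sub>R p k) = (\<Sum>k\<in>S. a k *\<^sub>R q k)" for S a
    using g by (simp add: linear_sum linear_scale)
  have bound: "norm (g x) \<le> K * norm x" if x: "x \<in> span (range p)" for x
  proof -
    obtain S a where S: "finite S" "x = (\<Sum>k\<in>S. a k *\<^sub>R p k)" using x by (rule span_range_sum)
    show ?thesis unfolding S(2) gS by (rule K[OF S(1)])
  qed
  have "uniformly_continuous_on (span (range p)) g"
    unfolding uniformly_continuous_on_def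
  proof (intro allI impI)
    fix e :: real assume e: "0 < e"
    show "\<exists>d>0. \<forall>x\<in>span (range p). \<forall>x'\<in>span (range p). dist x' x < d \<longrightarrow> dist (g x') (g x) < e"
    proof (intro exI conjI ballI impI)
      show "0 < e / (\<bar>K\<bar> + 1)" using e by simp
      fix x x' assume x: "x \<in> span (range p)" "x' \<in> span (range p)" "dist x' x < e / (\<bar>K\<bar> + 1)"
      have "dist (g x') (g x) = norm (g (x' - x))" using g(1) by (simp add: dist_norm linear_diff)
      also have "\<dots> \<le> K * norm (x' - x)" using x by (intro bound span_diff)
      also have "\<dots> \<le> (\<bar>K\<bar> + 1) * dist x' x" unfolding dist_norm by (intro mult_right_mono) auto
      also have "\<dots> < e" using x(3) by (simp add: pos_less_divide_eq mult.commute)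
      finally show "dist (g x') (g x) < e" .
    qed
  qed
  then obtain T where T: "uniformly_continuous_on (closure (span (range p))) T"
    "\<And>x. x \<in> span (range p) \<Longrightarrow> g x = T x"
    by (rule uniformly_continuous_on_extension_on_closure) (rule that)
  have Tc: "continuous_on (closure (span (range p))) T"
    using T(1) by (rule uniformly_continuous_imp_continuous)
  have sp: "(\<Sum>k\<in>S. a k *\<^sub>R p k) \<in> span (range p)" for S a
    by (intro span_sum span_scale span_base) auto
  have TS: "T (\<Sum>k\<in>S. a k *\<^sub>R p k) = (\<Sum>k\<in>S. a k *\<^sub>R q k)" for S a
    using T(2)[OF sp] gS by metis
  show thesis
  proof (rule that[OF Tc TS])
    have "T x \<in> closure (span (range q))" if x: "x \<in> span (range p)" for x
    proof -
      obtain S a where S: "finite S" "x = (\<Sum>k\<in>S. a k *\<^sub>R p k)" using x by (rule span_range_sum)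
      have "T x \<in> span (range q)" unfolding S(2) TS by (intro span_sum span_scale span_base) auto
      then show ?thesis using closure_subset by blast
    qed
    then show "T ` closure (span (range p)) \<subseteq> closure (span (range q))"
      by (intro image_closure_subset[OF Tc]) auto
  qed
qed

text \<open>The two extensions are inverse to each other on the spans and, by continuity, on the
  closures. Linearity of \<open>T\<close> passes to limits in the same way.\<close>

lemma isomorphic_closed_spans:
  fixes p q :: "nat \<Rightarrow> 'a::banach"
  assumes p: "inj p" "independent (range p)" and q: "inj q" "independent (range q)"
    and pq: "\<And>S a. finite S \<Longrightarrow> norm (\<Sum>k\<in>S. a k *\<^sub>R q k) \<le> K * norm (\<Sum>k\<in>S. a k *\<^sub>R p k)"
    and qp: "\<And>S a. finite S \<Longrightarrow> norm (\<Sum>k\<in>S. a k *\<^sub>R p k) \<le> K * norm (\<Sum>k\<in>S. a k *\<^sub>R q k)"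
  shows "isomorphic_subspaces (closure (span (range p))) (closure (span (range q)))"
proof -
  let ?P = "span (range p)" and ?Q = "span (range q)"
  obtain T where T: "continuous_on (closure ?P) T"
    "\<And>S a. finite S \<Longrightarrow> T (\<Sum>k\<in>S. a k *\<^sub>R p k) = (\<Sum>k\<in>S. a k *\<^sub>R q k)" "T ` closure ?P \<subseteq> closure ?Q"
    by (rule linear_extension_on_closed_span[OF p pq]; (assumption | rule that))
  obtain U where U: "continuous_on (closure ?Q) U"
    "\<And>S a. finite S \<Longrightarrow> U (\<Sum>k\<in>S. a k *\<^sub>R q k) = (\<Sum>k\<in>S. a k *\<^sub>R p k)" "U ` closure ?Q \<subseteq> closure ?P"
    by (rule linear_extension_on_closed_span[OF q qp]; (assumption | rule that))
  have lim: "(\<lambda>r. f (x r)) \<longlonglongrightarrow> f l"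
    if "continuous_on (closure A) f" "\<And>r. x r \<in> A" "x \<longlonglongrightarrow> l" "l \<in> closure A"
    for f :: "'a \<Rightarrow> 'a" and A x l
    using that closure_subset[of A] unfolding continuous_on_sequentially by (auto simp: o_def)
  have UT: "U (T x) = x" if x: "x \<in> closure ?P" for x
  proof -
    obtain s where s: "\<And>r. s r \<in> ?P" "s \<longlonglongrightarrow> x" using x unfolding closure_sequential by blast
    have "U (T (s r)) = s r" for r
    proof -
      obtain S a where S: "finite S" "s r = (\<Sum>k\<in>S. a k *\<^sub>R p k)" using s(1) by (rule span_range_sum)
      show ?thesis unfolding S(2) T(2)[OF S(1)] U(2)[OF S(1)] ..
    qed
    moreover have "continuous_on (closure ?P) (\<lambda>x. U (T x))"
      by (rule continuous_on_compose2[OF U(1) T(1) T(3)])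
    ultimately have "s \<longlonglongrightarrow> U (T x)" using lim[OF _ s x, of "\<lambda>x. U (T x)"] by simp
    then show ?thesis using s(2) LIMSEQ_unique by blast
  qed
  have TU: "T (U x) = x" if x: "x \<in> closure ?Q" for x
  proof -
    obtain s where s: "\<And>r. s r \<in> ?Q" "s \<longlonglongrightarrow> x" using x unfolding closure_sequential by blast
    have "T (U (s r)) = s r" for r
    proof -
      obtain S a where S: "finite S" "s r = (\<Sum>k\<in>S. a k *\<^sub>R q k)" using s(1) by (rule span_range_sum)
      show ?thesis unfolding S(2) U(2)[OF S(1)] T(2)[OF S(1)] ..
    qed
    moreover have "continuous_on (closure ?Q) (\<lambda>x. T (U x))"
      by (rule continuous_on_compose2[OF T(1) U(1) U(3)])
    ultimately have "s \<longlonglongrightarrow> T (U x)" using lim[OF _ s x, of "\<lambda>x. T (U x)"] by simp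
    then show ?thesis using s(2) LIMSEQ_unique by blast
  qed
  obtain g where g: "linear g" "\<And>x. x \<in> ?P \<Longrightarrow> T x = g x"
  proof -
    obtain g where g: "linear g" "\<And>x. x \<in> range p \<Longrightarrow> g x = T x"
      using linear_independent_extend[OF p(2), of T] by blast
    have Tp: "T (p k) = q k" for k using T(2)[of "{k}" "\<lambda>_. 1"] by simp
    have "T x = g x" if x: "x \<in> ?P" for x
    proof -
      obtain S a where S: "finite S" "x = (\<Sum>k\<in>S. a k *\<^sub>R p k)" using x by (rule span_range_sum)
      show ?thesis unfolding S(2) T(2)[OF S(1)] using g Tp by (simp add: linear_sum linear_scale)
    qed
    then show thesis using that g(1) by blast
  qed
  have subP: "subspace (closure ?P)" by (intro subspace_closure subspace_span)
  have add: "T (x + y) = T x + T y" if x: "x \<in> closure ?P" and y: "y \<in> closure ?P" for x y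
  proof -
    obtain s where s: "\<And>r. s r \<in> ?P" "s \<longlonglongrightarrow> x" using x unfolding closure_sequential by blast
    obtain t where t: "\<And>r. t r \<in> ?P" "t \<longlonglongrightarrow> y" using y unfolding closure_sequential by blast
    have "(\<lambda>r. T (s r + t r)) \<longlonglongrightarrow> T (x + y)"
      by (rule lim[OF T(1)]) (use s t x y subP in \<open>auto intro: span_add tendsto_add subspace_add\<close>)
    moreover have "T (s r + t r) = T (s r) + T (t r)" for r
      using g s(1) t(1) by (simp add: span_add linear_add)
    moreover have "(\<lambda>r. T (s r) + T (t r)) \<longlonglongrightarrow> T x + T y"
      by (intro tendsto_add lim[OF T(1)] s t x y)
    ultimately show ?thesis using LIMSEQ_unique by fastforce
  qed
  have scale: "T (c *\<^sub>R x) = c *\<^sub>R T x" if x: "x \<in> closure ?P" for c x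
  proof -
    obtain s where s: "\<And>r. s r \<in> ?P" "s \<longlonglongrightarrow> x" using x unfolding closure_sequential by blast
    have "(\<lambda>r. T (c *\<^sub>R s r)) \<longlonglongrightarrow> T (c *\<^sub>R x)"
      by (rule lim[OF T(1)]) (use s x subP in \<open>auto intro: span_scale tendsto_scaleR subspace_scale\<close>)
    moreover have "T (c *\<^sub>R s r) = c *\<^sub>R T (s r)" for r
      using g s(1) by (simp add: span_scale linear_scale)
    moreover have "(\<lambda>r. c *\<^sub>R T (s r)) \<longlonglongrightarrow> c *\<^sub>R T x"
      by (intro tendsto_scaleR tendsto_const lim[OF T(1)] s x)
    ultimately show ?thesis using LIMSEQ_unique by fastforce
  qed
  have "homeomorphism (closure ?P) (closure ?Q) T U"
    by (rule homeomorphismI) (use T U UT TU in auto)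
  then show ?thesis unfolding isomorphic_subspaces_def using add scale by blast
qed

section \<open>Equivalent block sequences\<close>

lemma norm_W_lin_comb_scale:
  assumes "finite S" "\<And>k. k \<in> S \<Longrightarrow> x k \<in> c00" "0 \<le> t"
  shows "norm_W n (lin_comb S (\<lambda>k. t * a k) x) \<le> t * norm_W n (lin_comb S a x)"
proof (rule norm_W_leI)
  fix f assume f: "f \<in> W n"
  have "pairing f (lin_comb S (\<lambda>k. t * a k) x) = t * pairing f (lin_comb S a x)"
    using assms by (simp add: pairing_lin_comb sum_distrib_left mult.assoc)
  also have "\<dots> \<le> t * norm_W n (lin_comb S a x)" using pairing_le_norm[OF f] assms(3) by (rule mult_left_mono)
  finally show "pairing f (lin_comb S (\<lambda>k. t * a k) x) \<le> t * norm_W n (lin_comb S a x)" .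
qed

text \<open>The sum of all \<open>\<eta> k i\<close> over block \<open>k\<close> detects
  \<open>z k\<close> and vanishes on the other blocks.\<close>

lemma (in block_sequences) coefficient_le:
  assumes S: "finite S" and k: "k \<in> S"
  shows "c * \<bar>b k\<bar> \<le> norm_W n (lin_comb S b z)"
proof -
  define h where "h = (\<lambda>t. \<Sum>i\<in>{0..<N k}. \<eta> k i t)"
  have h: "h \<in> W n" unfolding h_def by (rule \<eta>_W) (use N_pos in auto)
  have hD: "supp h \<subseteq> D k"
    unfolding h_def by (rule order_trans[OF supp_sum_subset]) (use \<eta> cell_D in fastforce)
  have hz: "c \<le> pairing h (z k)"
    unfolding h_def z_def atLeast0LessThan
  proof (rule pairing_cross)
    fix i i' assume i: "i < N k" "i' < N k" "i \<noteq> i'"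
    show "pairing (\<eta> k i) (w k i') = 0"
      using \<eta>[OF i(1)] w[OF i(2)] cells_disjoint[OF i(1,2)] i(3) by (intro pairing_disjoint) blast
  qed (use N_pos[of k] w \<eta> in auto)
  have "pairing h (lin_comb S b z) = (\<Sum>i\<in>S. b i * pairing h (z i))"
    by (rule pairing_lin_comb) (use S z_c00 in auto)
  also have "\<dots> = b k * pairing h (z k)"
  proof -
    have "pairing h (z i) = 0" if "i \<noteq> k" for i
      by (rule pairing_z_0) (use hD D_disjoint that in blast)
    then show ?thesis using S k by (subst sum.remove[of _ k]) (auto intro!: sum.neutral)
  qed
  finally have "\<bar>b k\<bar> * pairing h (z k) \<le> norm_W n (lin_comb S b z)"
    using pairing_le_norm_W[OF h, of "lin_comb S b z"] hz c by (simp add: abs_mult)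
  moreover have "\<bar>b k\<bar> * c \<le> \<bar>b k\<bar> * pairing h (z k)" using hz by (intro mult_left_mono) auto
  ultimately show ?thesis by (simp add: mult.commute)
qed

text \<open>The coefficient bound is carried along because it later gives independence and stability
  under perturbation.\<close>

definition seq_dominated :: "nat \<Rightarrow> real \<Rightarrow> (nat \<Rightarrow> nat \<Rightarrow> real) \<Rightarrow> (nat \<Rightarrow> nat \<Rightarrow> real) \<Rightarrow> bool" where
  "seq_dominated n c y z \<longleftrightarrow> (\<forall>S a. finite S \<longrightarrow> norm_W n (lin_comb S a y) \<le> 3 / c * norm_W n (lin_comb S a z) \<and>
     (\<forall>k\<in>S. c * \<bar>a k\<bar> \<le> norm_W n (lin_comb S a z)))"

text \<open>Normalize by the largest coefficient \<open>M\<close> and apply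
  \<open>domination\<close>. The additive error becomes \<open>M\<close>, which the coefficient
  bound turns into 1 / c times the norm; with 2 / c this makes 3 / c.\<close>

lemma block_domination:
  fixes N :: "nat \<Rightarrow> nat"
  assumes bs: "\<And>a. (\<And>k. \<bar>a k\<bar> \<le> 1) \<Longrightarrow> block_sequences n c \<mu> N \<beta> v w \<eta> a"
  shows "seq_dominated n c (\<lambda>k. lin_comb {..<N k} (\<lambda>_. 1 / real (N k)) (v k)) (\<lambda>k. lin_comb {..<N k} (\<lambda>_. 1 / real (N k)) (w k))"
  unfolding seq_dominated_def
proof (intro allI impI)
  fix S :: "nat set" and a :: "nat \<Rightarrow> real" assume S: "finite S"
  let ?y = "\<lambda>k. lin_comb {..<N k} (\<lambda>_. 1 / real (N k)) (v k)" and ?z = "\<lambda>k. lin_comb {..<N k} (\<lambda>_. 1 / real (N k)) (w k)"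
  define M where "M = Max (insert 0 ((\<lambda>k. \<bar>a k\<bar>) ` S))"
  \<comment> \<open>Coefficients outside \<open>S\<close> are set to 0, since the locale asks for a
    bound on all of them.\<close>
  define b where "b k = (if k \<in> S then a k / M else 0)" for k
  have M: "\<bar>a k\<bar> \<le> M" if "k \<in> S" for k unfolding M_def using S that by (intro Max_ge) auto
  have M0: "0 \<le> M" unfolding M_def using S by (intro Max_ge) auto
  have "\<bar>b k\<bar> \<le> 1" for k
    using M[of k] M0 by (cases "M = 0") (auto simp: b_def abs_divide)
  then interpret block_sequences n c \<mu> N \<beta> v w \<eta> b by (rule bs)
  have yz: "y = ?y" "z = ?z" by (simp_all add: y_def z_def fun_eq_iff)
  have coef: "c * \<bar>a k\<bar> \<le> norm_W n (lin_comb S a z)" if "k \<in> S" for k using coefficient_le[OF S that] .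
  have Mc: "c * M \<le> norm_W n (lin_comb S a z)"
  proof -
    have "M \<in> insert 0 ((\<lambda>k. \<bar>a k\<bar>) ` S)" unfolding M_def using S by (intro Max_in) auto
    then show ?thesis using coef norm_W_nonneg by auto
  qed
  have "norm_W n (lin_comb S a y) \<le> 3 / c * norm_W n (lin_comb S a z)"
  proof (cases "M = 0")
    case True
    then have a0: "a k = 0" if "k \<in> S" for k using M[OF that] by simp
    have "norm_W n (lin_comb S a y) \<le> (\<Sum>k\<in>S. \<bar>a k\<bar> * norm_W n (y k))"
      by (rule norm_W_lin_comb) (use S y_c00 in auto)
    also have "\<dots> = 0" using a0 by simp
    finally show ?thesis using norm_W_nonneg[of n "lin_comb S a z"] c by (meson divide_nonneg_pos mult_nonneg_nonneg order_trans zero_le_numeral)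
  next
    case False
    then have Mp: "0 < M" using M0 by simp
    have e1: "lin_comb S a y = lin_comb S (\<lambda>k. M * b k) y" using Mp by (simp add: lin_comb_def b_def)
    have e2: "lin_comb S b z = lin_comb S (\<lambda>k. 1 / M * a k) z" by (simp add: lin_comb_def b_def)
    have "norm_W n (lin_comb S a y) \<le> M * norm_W n (lin_comb S b y)"
      unfolding e1 by (rule norm_W_lin_comb_scale) (use S y_c00 M0 in auto)
    also have "\<dots> \<le> M * (2 / c * norm_W n (lin_comb S b z) + 1)"
      using domination[OF S] M0 by (intro mult_left_mono)
    also have "norm_W n (lin_comb S b z) \<le> 1 / M * norm_W n (lin_comb S a z)"
      unfolding e2 by (rule norm_W_lin_comb_scale) (use S z_c00 M0 in auto)
    then have "M * (2 / c * norm_W n (lin_comb S b z) + 1) \<le> M * (2 / c * (1 / M * norm_W n (lin_comb S a z)) + 1)"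
      using M0 c by (intro mult_left_mono add_right_mono) auto
    also have "\<dots> = 2 / c * norm_W n (lin_comb S a z) + M" using Mp by (simp add: field_simps)
    also have "\<dots> \<le> 3 / c * norm_W n (lin_comb S a z)" using Mc c by (simp add: field_simps)
    finally show ?thesis .
  qed
  then show "norm_W n (lin_comb S a ?y) \<le> 3 / c * norm_W n (lin_comb S a ?z) \<and> (\<forall>k\<in>S. c * \<bar>a k\<bar> \<le> norm_W n (lin_comb S a ?z))"
    using coef unfolding yz by blast
qed

text \<open>The shared cells make the two spaces symmetric, so \<open>block_domination\<close>
  applies in both directions. \<open>L\<close> is left free for the perturbation, whose tolerance
  depends on \<open>c\<close>.\<close>

lemma equivalent_sequences:
  assumes A: "asymptotic n V" and B: "asymptotic n V'"
  shows "\<exists>c>0. \<forall>L :: nat \<Rightarrow> nat. \<exists>\<mu> y z. (\<forall>k. L k \<le> \<mu> k \<and> y k \<in> V (\<mu> k) \<and> z k \<in> V' (\<mu> k)) \<and>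
    seq_dominated n c y z \<and> seq_dominated n c z y"
proof -
  have n1: "1 \<le> n" using A by (rule asymptotic.n1)
  obtain c where c: "0 < c" and bl: "\<And>m. \<exists>N \<beta> v \<eta> w \<zeta>. block n c V m N \<beta> v \<eta> \<and> block n c V' m N \<beta> w \<zeta>"
    using common_blocks[OF A B] by blast
  have "\<exists>\<mu> y z. (\<forall>k. L k \<le> \<mu> k \<and> y k \<in> V (\<mu> k) \<and> z k \<in> V' (\<mu> k)) \<and>
    seq_dominated n c y z \<and> seq_dominated n c z y" for L :: "nat \<Rightarrow> nat"
  proof -
    obtain N \<beta> v \<eta> w \<zeta> where b: "\<And>m. block n c V m (N m) (\<beta> m) (v m) (\<eta> m) \<and> block n c V' m (N m) (\<beta> m) (w m) (\<zeta> m)"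
      using bl by metis
    \<comment> \<open>The next index passes 32 times 8^(k+1) times the end of the present block, as
      the locale requires, and also the prescribed value of \<open>L\<close>.\<close>
    define step where "step k m = 32 * 8 ^ Suc k * (\<beta> m (N m) + 1) + L (Suc k)" for k m
    define \<mu> where "\<mu> = rec_nat (32 + L 0) step"
    have mu0: "\<mu> 0 = 32 + L 0" and muS: "\<mu> (Suc k) = 32 * 8 ^ Suc k * (\<beta> (\<mu> k) (N (\<mu> k)) + 1) + L (Suc k)" for k
      by (simp_all add: \<mu>_def step_def)
    define e where "e k = \<beta> (\<mu> k) (N (\<mu> k))" for k
    have L: "L k \<le> \<mu> k" for k by (cases k) (simp_all add: mu0 muS)
    have big: "32 * 8 ^ k \<le> \<mu> k + 1" for k by (cases k) (simp_all add: mu0 muS)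
    have e_mono: "e k \<le> e (Suc k)" for k
    proof -
      have "\<beta> m 0 \<le> \<beta> m i" if "i \<le> N m" for m i
        using that
      proof (induction i)
        case (Suc i)
        have "\<beta> m i < \<beta> m (Suc i)" using b[of m] Suc.prems unfolding block_def by simp
        then show ?case using Suc by simp
      qed simp
      then have "\<beta> (\<mu> (Suc k)) 0 \<le> e (Suc k)" by (simp add: e_def)
      moreover have "\<mu> (Suc k) < \<beta> (\<mu> (Suc k)) 0" using b[of "\<mu> (Suc k)"] by (simp add: block_def)
      moreover have "1 * e k \<le> 32 * 8 ^ Suc k * (e k + 1)" by (intro mult_le_mono) auto
      then have "e k \<le> \<mu> (Suc k)" by (simp add: muS e_def)
      ultimately show ?thesis by linarith
    qed
    have e_le: "k' \<le> k \<Longrightarrow> e k' \<le> e k" for k' k using e_mono by (rule lift_Suc_mono_le)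
    have fast: "32 * 8 ^ k * e k' \<le> \<mu> k + 1" if k: "k' < k" for k k'
    proof -
      obtain l where l: "k = Suc l" using k by (cases k) auto
      have "e k' \<le> e l" using e_le k l by simp
      then have "32 * 8 ^ k * e k' \<le> 32 * 8 ^ k * (e l + 1)" by (intro mult_le_mono2) simp
      also have "\<dots> \<le> \<mu> k + 1" by (simp add: l muS e_def)
      finally show ?thesis .
    qed
    have "seq_dominated n c (\<lambda>k. lin_comb {..<N (\<mu> k)} (\<lambda>_. 1 / real (N (\<mu> k))) (v (\<mu> k)))
        (\<lambda>k. lin_comb {..<N (\<mu> k)} (\<lambda>_. 1 / real (N (\<mu> k))) (w (\<mu> k)))"
    proof (rule block_domination[where \<beta> = "\<lambda>k. \<beta> (\<mu> k)" and \<eta> = "\<lambda>k. \<zeta> (\<mu> k)" and \<mu> = \<mu>], unfold_locales)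
      show "good n (n - 1) (1 / real (\<mu> k + 1)) (lin_comb {..<N (\<mu> k)} (\<lambda>_. 1 / real (N (\<mu> k))) (v (\<mu> k)))" for k
        using b[of "\<mu> k"] unfolding block_def by blast
    qed (use n1 c big fast b in \<open>auto simp: block_def e_def subset_iff\<close>)
    moreover have "seq_dominated n c (\<lambda>k. lin_comb {..<N (\<mu> k)} (\<lambda>_. 1 / real (N (\<mu> k))) (w (\<mu> k)))
        (\<lambda>k. lin_comb {..<N (\<mu> k)} (\<lambda>_. 1 / real (N (\<mu> k))) (v (\<mu> k)))"
    proof (rule block_domination[where \<beta> = "\<lambda>k. \<beta> (\<mu> k)" and \<eta> = "\<lambda>k. \<eta> (\<mu> k)" and \<mu> = \<mu>], unfold_locales)
      show "good n (n - 1) (1 / real (\<mu> k + 1)) (lin_comb {..<N (\<mu> k)} (\<lambda>_. 1 / real (N (\<mu> k))) (w (\<mu> k)))" for k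
        using b[of "\<mu> k"] unfolding block_def by blast
    qed (use n1 c big fast b in \<open>auto simp: block_def e_def subset_iff\<close>)
    moreover have "lin_comb {..<N (\<mu> k)} (\<lambda>_. 1 / real (N (\<mu> k))) (v (\<mu> k)) \<in> V (\<mu> k)"
      "lin_comb {..<N (\<mu> k)} (\<lambda>_. 1 / real (N (\<mu> k))) (w (\<mu> k)) \<in> V' (\<mu> k)" for k
      using b[of "\<mu> k"] unfolding block_def by blast+
    ultimately show ?thesis using L
      by (intro exI[of _ \<mu>] exI[of _ "\<lambda>k. lin_comb {..<N (\<mu> k)} (\<lambda>_. 1 / real (N (\<mu> k))) (v (\<mu> k))"]
        exI[of _ "\<lambda>k. lin_comb {..<N (\<mu> k)} (\<lambda>_. 1 / real (N (\<mu> k))) (w (\<mu> k))"] conjI allI)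
  qed
  then show ?thesis using c by blast
qed

section \<open>Subspaces of the completion\<close>

text \<open>The kernel has codimension at most 1: a vector outside it, added to a finite set
  spanning the kernel, would span \<open>Y\<close>.\<close>

lemma not_finite_span_kernel:
  fixes \<phi> :: "'a::real_vector \<Rightarrow> real"
  assumes Y: "subspace Y" and inf: "\<not> (\<exists>B. finite B \<and> Y \<subseteq> span B)"
    and add: "\<And>u v. u \<in> Y \<Longrightarrow> v \<in> Y \<Longrightarrow> \<phi> (u + v) = \<phi> u + \<phi> v"
    and scale: "\<And>c u. u \<in> Y \<Longrightarrow> \<phi> (c *\<^sub>R u) = c * \<phi> u"
  shows "subspace {y \<in> Y. \<phi> y = 0}" "\<not> (\<exists>B. finite B \<and> {y \<in> Y. \<phi> y = 0} \<subseteq> span B)"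
proof -
  have "\<phi> 0 = 0" using scale[of 0 0] Y by (simp add: subspace_0)
  then show "subspace {y \<in> Y. \<phi> y = 0}"
    using Y add scale unfolding subspace_def by simp
  show "\<not> (\<exists>B. finite B \<and> {y \<in> Y. \<phi> y = 0} \<subseteq> span B)"
  proof
    assume "\<exists>B. finite B \<and> {y \<in> Y. \<phi> y = 0} \<subseteq> span B"
    then obtain B where B: "finite B" "{y \<in> Y. \<phi> y = 0} \<subseteq> span B" by blast
    show False
    proof (cases "\<exists>y0\<in>Y. \<phi> y0 \<noteq> 0")
      case False
      then show False using inf B by blast
    next
      case True
      then obtain y0 where y0: "y0 \<in> Y" "\<phi> y0 \<noteq> 0" by blast
      have "Y \<subseteq> span (insert y0 B)"
      proof
        fix u assume u: "u \<in> Y"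
        define t where "t = \<phi> u / \<phi> y0"
        have m: "(- t) *\<^sub>R y0 \<in> Y" using Y y0(1) by (rule subspace_scale)
        have "\<phi> (u + (- t) *\<^sub>R y0) = 0"
          unfolding add[OF u m] scale[OF y0(1)] using y0(2) by (simp add: t_def)
        moreover have "u + (- t) *\<^sub>R y0 \<in> Y" using Y u m by (rule subspace_add)
        ultimately have "u + (- t) *\<^sub>R y0 \<in> span B" using B(2) by blast
        then have "u + (- t) *\<^sub>R y0 \<in> span (insert y0 B)" using span_mono[of B "insert y0 B"] by blast
        moreover have "t *\<^sub>R y0 \<in> span (insert y0 B)" by (intro span_scale span_base) simp
        ultimately have "(u + (- t) *\<^sub>R y0) + t *\<^sub>R y0 \<in> span (insert y0 B)" by (rule span_add)
        then show "u \<in> span (insert y0 B)" by simp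
      qed
      then show False using inf B(1) by blast
    qed
  qed
qed

section \<open>Coordinates and approximation in the completion\<close>

locale completion =
  fixes n :: nat and X :: "'a::banach set" and J :: "(nat \<Rightarrow> real) \<Rightarrow> 'a"
  assumes n1: "1 \<le> n"
    and J_add: "x \<in> c00 \<Longrightarrow> y \<in> c00 \<Longrightarrow> J (\<lambda>i. x i + y i) = J x + J y"
    and J_scale: "x \<in> c00 \<Longrightarrow> J (\<lambda>i. c * x i) = c *\<^sub>R J x"
    and J_norm: "x \<in> c00 \<Longrightarrow> norm (J x) = norm_W n x"
    and X: "X = closure (J ` c00)"
begin

lemma c00_add: "x \<in> c00 \<Longrightarrow> y \<in> c00 \<Longrightarrow> (\<lambda>i. x i + y i) \<in> c00"
proof -
  assume "x \<in> c00" "y \<in> c00"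
  moreover have "supp (\<lambda>i. x i + y i) \<subseteq> supp x \<union> supp y" by (auto simp: supp_def)
  ultimately show ?thesis unfolding c00_def using finite_subset by fastforce
qed

lemma c00_scale: "x \<in> c00 \<Longrightarrow> (\<lambda>i. c * x i) \<in> c00"
proof -
  assume "x \<in> c00"
  moreover have "supp (\<lambda>i. c * x i) \<subseteq> supp x" by (auto simp: supp_def)
  ultimately show ?thesis unfolding c00_def using finite_subset by fastforce
qed

lemma J_diff:
  assumes "x \<in> c00" "y \<in> c00"
  shows "J x - J y = J (\<lambda>i. x i - y i)" "(\<lambda>i. x i - y i) \<in> c00"
proof -
  have "(\<lambda>i. x i - y i) = (\<lambda>i. x i + (- 1) * y i)" by simp
  then show "J x - J y = J (\<lambda>i. x i - y i)" "(\<lambda>i. x i - y i) \<in> c00"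
    using J_add[OF assms(1) c00_scale[OF assms(2)], of "- 1"] J_scale[OF assms(2), of "- 1"]
      c00_add[OF assms(1) c00_scale[OF assms(2)], of "- 1"] by simp_all
qed

lemma J_lin_comb:
  assumes "finite S" "\<And>k. k \<in> S \<Longrightarrow> x k \<in> c00"
  shows "J (lin_comb S a x) = (\<Sum>k\<in>S. a k *\<^sub>R J (x k))"
  using assms
proof (induction S rule: finite_induct)
  case empty
  have "(\<lambda>i. 0) \<in> c00" by (simp add: c00_def supp_def)
  from J_scale[OF this, of 0] show ?case by (simp add: lin_comb_def)
next
  case (insert k S)
  have "lin_comb (insert k S) a x = (\<lambda>i. a k * x k i + lin_comb S a x i)" using insert by (simp add: lin_comb_def)
  moreover have "lin_comb S a x \<in> c00" using insert by (intro lin_comb_c00) auto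
  ultimately show ?case using insert by (simp add: J_add J_scale c00_scale)
qed

text \<open>The continuous extension of the i-th coordinate functional. Elements of \<open>X\<close>
  are known only as limits of images under \<open>J\<close>, so the value is described through
  approximating sequences.\<close>

definition coord :: "nat \<Rightarrow> 'a \<Rightarrow> real" where
  "coord i y = (THE t. \<exists>x. (\<forall>r. x r \<in> c00) \<and> (\<lambda>r. J (x r)) \<longlonglongrightarrow> y \<and> (\<lambda>r. x r i) \<longlonglongrightarrow> t)"

lemma coord_diff_le:
  assumes "x \<in> c00" "y \<in> c00"
  shows "\<bar>x i - y i\<bar> \<le> norm (J x - J y)"
  using coord_le_norm_W[OF J_diff(2)[OF assms], of i n] J_norm[OF J_diff(2)[OF assms]]
  by (simp add: J_diff(1)[OF assms])

text \<open>Unit vectors belong to \<open>W\<close>, so coordinates are bounded by the norm; they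
  send Cauchy sequences to Cauchy sequences, and the limit does not depend on the sequence
  chosen.\<close>

lemma coord_lim:
  assumes x: "\<And>r. x r \<in> c00" and lim: "(\<lambda>r. J (x r)) \<longlonglongrightarrow> y"
  shows "(\<lambda>r. x r i) \<longlonglongrightarrow> coord i y"
proof -
  have uniq: "s = t" if s: "\<And>r. u r \<in> c00" "(\<lambda>r. J (u r)) \<longlonglongrightarrow> y" "(\<lambda>r. u r i) \<longlonglongrightarrow> s"
    and t: "\<And>r. v r \<in> c00" "(\<lambda>r. J (v r)) \<longlonglongrightarrow> y" "(\<lambda>r. v r i) \<longlonglongrightarrow> t" for u v s t
  proof -
    have "(\<lambda>r. J (u r) - J (v r)) \<longlonglongrightarrow> y - y" by (intro tendsto_diff s t)
    then have "(\<lambda>r. norm (J (u r) - J (v r))) \<longlonglongrightarrow> 0" by (simp add: tendsto_norm_zero_iff)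
    moreover have "norm (u r i - v r i) \<le> norm (J (u r) - J (v r))" for r
      using coord_diff_le[OF s(1) t(1)] by simp
    ultimately have "(\<lambda>r. u r i - v r i) \<longlonglongrightarrow> 0"
      by (intro Lim_null_comparison[of "\<lambda>r. u r i - v r i" "\<lambda>r. norm (J (u r) - J (v r))"]) auto
    moreover have "(\<lambda>r. u r i - v r i) \<longlonglongrightarrow> s - t" by (intro tendsto_diff s t)
    ultimately have "s - t = 0" using LIMSEQ_unique by blast
    then show ?thesis by simp
  qed
  have "Cauchy (\<lambda>r. x r i)"
  proof (rule metric_CauchyI)
    fix e :: real assume "0 < e"
    then obtain M where M: "\<And>r s. M \<le> r \<Longrightarrow> M \<le> s \<Longrightarrow> dist (J (x r)) (J (x s)) < e"
      using LIMSEQ_imp_Cauchy[OF lim] unfolding Cauchy_def by blast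
    have "dist (x r i) (x s i) < e" if "M \<le> r" "M \<le> s" for r s
      using coord_diff_le[OF x x, of r i s] M[OF that] by (simp add: dist_norm)
    then show "\<exists>M. \<forall>r\<ge>M. \<forall>s\<ge>M. dist (x r i) (x s i) < e" by blast
  qed
  then obtain t where t: "(\<lambda>r. x r i) \<longlonglongrightarrow> t" using Cauchy_convergent_iff unfolding convergent_def by blast
  have "coord i y = t" unfolding coord_def
  proof (rule the_equality)
    show "\<exists>x. (\<forall>r. x r \<in> c00) \<and> (\<lambda>r. J (x r)) \<longlonglongrightarrow> y \<and> (\<lambda>r. x r i) \<longlonglongrightarrow> t"
      using x lim t by blast
    fix s assume "\<exists>x. (\<forall>r. x r \<in> c00) \<and> (\<lambda>r. J (x r)) \<longlonglongrightarrow> y \<and> (\<lambda>r. x r i) \<longlonglongrightarrow> s"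
    then show "s = t" using uniq x lim t by blast
  qed
  then show ?thesis using t by simp
qed

lemma X_sequence:
  assumes "y \<in> X"
  obtains x where "\<And>r. x r \<in> c00" "(\<lambda>r. J (x r)) \<longlonglongrightarrow> y"
proof -
  obtain s where s: "\<And>r. s r \<in> J ` c00" "s \<longlonglongrightarrow> y" using assms unfolding X closure_sequential by blast
  then have "\<forall>r. \<exists>x\<in>c00. s r = J x" by blast
  then obtain x where "\<And>r. x r \<in> c00" "\<And>r. s r = J (x r)" by metis
  moreover from this have "s = (\<lambda>r. J (x r))" by blast
  ultimately show thesis using that s(2) by blast
qed

lemma coord_add:
  assumes "u \<in> X" "v \<in> X"
  shows "coord i (u + v) = coord i u + coord i v"
proof -
  obtain x where x: "\<And>r. x r \<in> c00" "(\<lambda>r. J (x r)) \<longlonglongrightarrow> u" using X_sequence[OF assms(1)] by blast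
  obtain z where z: "\<And>r. z r \<in> c00" "(\<lambda>r. J (z r)) \<longlonglongrightarrow> v" using X_sequence[OF assms(2)] by blast
  have "(\<lambda>r. J (\<lambda>i. x r i + z r i)) \<longlonglongrightarrow> u + v"
    unfolding J_add[OF x(1) z(1)] by (intro tendsto_add x z)
  from coord_lim[OF c00_add[OF x(1) z(1)] this, of i]
  have "(\<lambda>r. x r i + z r i) \<longlonglongrightarrow> coord i (u + v)" .
  moreover have "(\<lambda>r. x r i + z r i) \<longlonglongrightarrow> coord i u + coord i v"
    by (intro tendsto_add coord_lim x z)
  ultimately show ?thesis by (rule LIMSEQ_unique)
qed

lemma coord_scale:
  assumes "u \<in> X"
  shows "coord i (c *\<^sub>R u) = c * coord i u"
proof -
  obtain x where x: "\<And>r. x r \<in> c00" "(\<lambda>r. J (x r)) \<longlonglongrightarrow> u" using X_sequence[OF assms] by blast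
  have "(\<lambda>r. J (\<lambda>i. c * x r i)) \<longlonglongrightarrow> c *\<^sub>R u"
    unfolding J_scale[OF x(1)] by (intro tendsto_scaleR tendsto_const x)
  from coord_lim[OF c00_scale[OF x(1)] this, of i]
  have "(\<lambda>r. c * x r i) \<longlonglongrightarrow> coord i (c *\<^sub>R u)" .
  moreover have "(\<lambda>r. c * x r i) \<longlonglongrightarrow> c * coord i u"
    by (intro tendsto_mult tendsto_const coord_lim x)
  ultimately show ?thesis by (rule LIMSEQ_unique)
qed

text \<open>Finitely many functionals cut out a subspace that still has no finite spanning set,
  hence is nonzero.\<close>

lemma vanishing_coordinates:
  assumes Y: "subspace Y" "Y \<subseteq> X" and inf: "\<not> (\<exists>B. finite B \<and> Y \<subseteq> span B)"
  obtains y where "y \<in> Y" "norm y = 1" "\<And>i. i \<le> m \<Longrightarrow> coord i y = 0"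
proof -
  have "subspace {y \<in> Y. \<forall>i<k. coord i y = 0} \<and>
      \<not> (\<exists>B. finite B \<and> {y \<in> Y. \<forall>i<k. coord i y = 0} \<subseteq> span B)" for k
  proof (induction k)
    case 0
    show ?case using Y inf by simp
  next
    case (Suc k)
    let ?Z = "{y \<in> Y. \<forall>i<k. coord i y = 0}"
    have eq: "{y \<in> Y. \<forall>i<Suc k. coord i y = 0} = {y \<in> ?Z. coord k y = 0}"
      by (auto simp: less_Suc_eq)
    show ?case unfolding eq
      by (intro conjI not_finite_span_kernel) (use Suc Y in \<open>auto intro: coord_add coord_scale\<close>)
  qed
  then have no: "\<not> (finite B \<and> {y \<in> Y. \<forall>i<Suc m. coord i y = 0} \<subseteq> span B)" for B by blast
  have "\<not> {y \<in> Y. \<forall>i<Suc m. coord i y = 0} \<subseteq> {0}" using no[of "{}"] by simp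
  then obtain y where y: "y \<in> Y" "\<And>i. i \<le> m \<Longrightarrow> coord i y = 0" "y \<noteq> 0" by (auto simp: less_Suc_eq_le)
  show thesis
  proof (rule that[of "(1 / norm y) *\<^sub>R y"])
    show "(1 / norm y) *\<^sub>R y \<in> Y" using Y(1) y(1) by (rule subspace_scale)
    show "norm ((1 / norm y) *\<^sub>R y) = 1" using y(3) by simp
    show "coord i ((1 / norm y) *\<^sub>R y) = 0" if "i \<le> m" for i
      using coord_scale[of y i "1 / norm y"] y(2)[OF that] Y(2) y(1) by auto
  qed
qed

text \<open>A subspace need not contain finitely supported vectors. The tolerance shrinks as the
  support moves out, so that one index governs both.\<close>

definition near :: "'a set \<Rightarrow> nat \<Rightarrow> (nat \<Rightarrow> real) set" where
  "near Y m = {x \<in> c00. (\<forall>u\<in>supp x. m < u) \<and> (\<exists>y\<in>Y. norm (J x - y) < 1 / real (m + 1))}"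

text \<open>Take a unit vector of \<open>Y\<close> with vanishing first coordinates and cut off
  those coordinates from a finitely supported approximant. The part removed is small, and
  normalizing changes little.\<close>

lemma near_norm_one:
  assumes Y: "subspace Y" "Y \<subseteq> X" and inf: "\<not> (\<exists>B. finite B \<and> Y \<subseteq> span B)"
  shows "\<exists>x\<in>near Y m. norm_W n x = 1"
proof -
  obtain y where y: "y \<in> Y" "norm y = 1" "\<And>i. i \<le> m \<Longrightarrow> coord i y = 0"
    using vanishing_coordinates[OF Y inf, of m] by blast
  obtain s where s: "\<And>r. s r \<in> c00" "(\<lambda>r. J (s r)) \<longlonglongrightarrow> y" using X_sequence y(1) Y(2) by blast
  \<comment> \<open>Removing m + 1 coordinates, each below \<open>\<delta>\<close>, and one
    approximation error make m + 2 times \<open>\<delta>\<close>, a quarter of 1 / (m + 1). The rest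
    of the tolerance covers the normalization.\<close>
  define \<delta> where "\<delta> = 1 / (4 * real (m + 1) * real (m + 2))"
  have \<delta>: "0 < \<delta>" by (simp add: \<delta>_def)
  have "\<forall>\<^sub>F r in sequentially. norm (J (s r) - y) < \<delta>"
    using s(2) \<delta> unfolding tendsto_iff dist_norm by blast
  moreover have "\<forall>\<^sub>F r in sequentially. \<forall>i\<in>{..m}. \<bar>s r i\<bar> < \<delta>"
  proof (rule eventually_ball_finite, simp, intro ballI)
    fix i assume "i \<in> {..m}"
    then have "(\<lambda>r. s r i) \<longlonglongrightarrow> 0" using coord_lim[OF s, of i] y(3) by simp
    then show "\<forall>\<^sub>F r in sequentially. \<bar>s r i\<bar> < \<delta>"
      using \<delta> unfolding tendsto_iff dist_norm by (auto simp: eventually_mono)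
  qed
  ultimately have "\<forall>\<^sub>F r in sequentially. norm (J (s r) - y) < \<delta> \<and> (\<forall>i\<in>{..m}. \<bar>s r i\<bar> < \<delta>)"
    by (rule eventually_conj)
  then obtain r where r: "norm (J (s r) - y) < \<delta>" "\<And>i. i \<le> m \<Longrightarrow> \<bar>s r i\<bar> < \<delta>"
    unfolding eventually_sequentially by auto
  define z where "z i = (if i \<le> m then 0 else s r i)" for i
  define d where "d i = (if i \<le> m then s r i else 0)" for i
  have sr: "s r = (\<lambda>i. z i + d i)" by (auto simp: z_def d_def)
  have z: "z \<in> c00" and dc: "d \<in> c00"
  proof -
    have "supp z \<subseteq> supp (s r)" "supp d \<subseteq> supp (s r)" by (auto simp: supp_def z_def d_def split: if_splits)
    then have "finite (supp z)" "finite (supp d)" using s(1)[of r] finite_subset by (auto simp: c00_def)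
    then show "z \<in> c00" "d \<in> c00" using s(1)[of r] by (auto simp: c00_def z_def d_def)
  qed
  have nd: "norm (J d) \<le> real (m + 1) * \<delta>"
    unfolding J_norm[OF dc]
  proof (rule norm_W_leI)
    fix f assume "f \<in> W n"
    have "pairing f d \<le> (\<Sum>i\<in>supp d. \<bar>d i\<bar>)" using pairing_bound[OF \<open>f \<in> W n\<close>, of d] by simp
    also have "\<dots> \<le> (\<Sum>i\<in>{..m}. \<bar>d i\<bar>)" by (intro sum_mono2) (auto simp: supp_def d_def)
    also have "\<dots> \<le> (\<Sum>i\<in>{..m}. \<delta>)" using r(2) by (intro sum_mono) (auto simp: d_def intro: less_imp_le)
    finally show "pairing f d \<le> real (m + 1) * \<delta>" by simp
  qed
  define e where "e = 1 / (4 * real (m + 1))"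
  have e: "0 < e" "e \<le> 1 / 4" by (simp_all add: e_def field_simps)
  have zy: "norm (J z - y) < e"
  proof -
    have "J (s r) = J z + J d" unfolding sr by (rule J_add[OF z dc])
    then have "J z - y = (J (s r) - y) - J d" by simp
    then have "norm (J z - y) \<le> norm (J (s r) - y) + norm (J d)" by (metis norm_triangle_ineq4)
    also have "\<dots> < \<delta> + real (m + 1) * \<delta>" using r(1) nd by (rule add_less_le_mono)
    also have "\<dots> = real (m + 2) * \<delta>" by (simp add: algebra_simps)
    also have "\<dots> = e" by (simp add: \<delta>_def e_def)
    finally show ?thesis .
  qed
  define t where "t = norm (J z)"
  have t: "3 / 4 \<le> t"
    using norm_triangle_ineq3[of "J z" y] zy e(2) y(2) unfolding t_def by linarith
  define x where "x = (\<lambda>i. (1 / t) * z i)"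
  have x: "x \<in> c00" unfolding x_def by (rule c00_scale[OF z])
  have Jx: "J x = (1 / t) *\<^sub>R J z" unfolding x_def by (rule J_scale[OF z])
  have "norm_W n x = 1" unfolding J_norm[OF x, symmetric] Jx using t by (simp add: t_def[symmetric])
  moreover have "x \<in> near Y m"
    unfolding near_def mem_Collect_eq
  proof (intro conjI bexI[of _ "(1 / t) *\<^sub>R y"])
    show "\<forall>u\<in>supp x. m < u" by (auto simp: supp_def x_def z_def)
    show "(1 / t) *\<^sub>R y \<in> Y" using Y(1) y(1) by (rule subspace_scale)
    have "J x - (1 / t) *\<^sub>R y = (1 / t) *\<^sub>R (J z - y)" unfolding Jx by (simp add: scaleR_diff_right)
    then have "norm (J x - (1 / t) *\<^sub>R y) = (1 / t) * norm (J z - y)" using t by simp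
    also have "\<dots> < (1 / t) * e" using zy t by (intro mult_strict_left_mono) auto
    also have "\<dots> \<le> 4 * e" using t e(1) by (intro mult_right_mono) (auto simp: field_simps)
    also have "\<dots> = 1 / real (m + 1)" by (simp add: e_def field_simps)
    finally show "norm (J x - (1 / t) *\<^sub>R y) < 1 / real (m + 1)" .
  qed (rule x)
  ultimately show ?thesis by blast
qed

lemma asymptotic_near:
  assumes Y: "subspace Y" "Y \<subseteq> X" and inf: "\<not> (\<exists>B. finite B \<and> Y \<subseteq> span B)"
  shows "asymptotic n (near Y)"
proof
  show "1 \<le> n" by (rule n1)
  show "x \<in> near Y m \<Longrightarrow> x \<in> c00" for x m by (simp add: near_def)
  show "x \<in> near Y m \<Longrightarrow> u \<in> supp x \<Longrightarrow> m < u" for x m u by (simp add: near_def)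
  show "x \<in> near Y m" if "x \<in> near Y m'" "m \<le> m'" for x m m'
  proof -
    have "1 / real (m' + 1) \<le> 1 / real (m + 1)" using that(2) by (intro inverse_nat_mono) auto
    then show ?thesis using that unfolding near_def by fastforce
  qed
  show "(\<lambda>i. c * x i) \<in> near Y m" if xn: "x \<in> near Y m" and c: "\<bar>c\<bar> \<le> 1" for x m c
  proof -
    obtain y where y: "y \<in> Y" "norm (J x - y) < 1 / real (m + 1)" and x: "x \<in> c00" "\<forall>u\<in>supp x. m < u"
      using xn by (auto simp: near_def)
    have "J (\<lambda>i. c * x i) - c *\<^sub>R y = c *\<^sub>R (J x - y)" by (simp add: J_scale[OF x(1)] scaleR_diff_right)
    then have "norm (J (\<lambda>i. c * x i) - c *\<^sub>R y) = \<bar>c\<bar> * norm (J x - y)" by simp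
    also have "\<dots> \<le> 1 * norm (J x - y)" using c by (intro mult_right_mono) auto
    finally have "norm (J (\<lambda>i. c * x i) - c *\<^sub>R y) < 1 / real (m + 1)" using y(2) by simp
    moreover have "c *\<^sub>R y \<in> Y" using Y(1) y(1) by (rule subspace_scale)
    moreover have "\<forall>u\<in>supp (\<lambda>i. c * x i). m < u" using x(2) by (auto simp: supp_def)
    ultimately show ?thesis using c00_scale[OF x(1)] unfolding near_def by blast
  qed
  show "\<exists>m'. \<forall>x. (\<forall>i<N. x i \<in> near Y m') \<longrightarrow> lin_comb {..<N} (\<lambda>_. 1) x \<in> near Y m" for N m :: nat
  \<comment> \<open>With this index the \<open>N\<close> errors add up to less than 1 / (m +
    1).\<close>
  proof (intro exI[of _ "(N + 1) * (m + 1)"] allI impI)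
    fix x assume "\<forall>i<N. x i \<in> near Y ((N + 1) * (m + 1))"
    then have x: "\<And>i. i < N \<Longrightarrow> x i \<in> c00" "\<And>i u. i < N \<Longrightarrow> u \<in> supp (x i) \<Longrightarrow> (N + 1) * (m + 1) < u"
      and "\<forall>i\<in>{..<N}. \<exists>y\<in>Y. norm (J (x i) - y) < 1 / real ((N + 1) * (m + 1) + 1)"
      by (auto simp: near_def)
    then obtain y where y: "\<And>i. i < N \<Longrightarrow> y i \<in> Y" "\<And>i. i < N \<Longrightarrow> norm (J (x i) - y i) < 1 / real ((N + 1) * (m + 1) + 1)"
      by (metis lessThan_iff)
    have "J (lin_comb {..<N} (\<lambda>_. 1) x) - (\<Sum>i<N. y i) = (\<Sum>i<N. J (x i) - y i)"
      by (subst J_lin_comb) (use x in \<open>auto simp: sum_subtractf\<close>)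
    also have "norm \<dots> \<le> (\<Sum>i<N. 1 / real ((N + 1) * (m + 1) + 1))"
      using y(2) by (intro order_trans[OF norm_sum] sum_mono) (auto intro: less_imp_le)
    also have "\<dots> = real N / real ((N + 1) * (m + 1) + 1)" by simp
    also have "\<dots> < 1 / real (m + 1)"
    proof -
      have "N * (m + 1) < (N + 1) * (m + 1) + 1" by simp
      then have "real N * real (m + 1) < real ((N + 1) * (m + 1) + 1)"
        unfolding of_nat_mult[symmetric] by (simp only: of_nat_less_iff)
      then show ?thesis by (simp add: divide_less_eq pos_less_divide_eq del: of_nat_add of_nat_mult)
    qed
    finally have "norm (J (lin_comb {..<N} (\<lambda>_. 1) x) - (\<Sum>i<N. y i)) < 1 / real (m + 1)" .
    moreover have "(\<Sum>i<N. y i) \<in> Y" using Y(1) y(1) by (intro subspace_sum) auto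
    moreover have "m < u" if u: "u \<in> supp (lin_comb {..<N} (\<lambda>_. 1) x)" for u
    proof -
      obtain i where "i < N" "u \<in> supp (x i)" using u supp_lin_comb by blast
      then have "(N + 1) * (m + 1) < u" using x(2) by blast
      moreover have "m \<le> (N + 1) * (m + 1)" by (rule le_mult_add_one) simp
      ultimately show ?thesis by linarith
    qed
    moreover have "lin_comb {..<N} (\<lambda>_. 1) x \<in> c00" using x(1) by (intro lin_comb_c00) auto
    ultimately show "lin_comb {..<N} (\<lambda>_. 1) x \<in> near Y m" unfolding near_def by blast
  qed
  show "\<exists>x\<in>near Y m. norm_W n x = 1" for m by (rule near_norm_one[OF Y inf])
qed

text \<open>Each coefficient is at most the norm divided by \<open>c\<close>, so the perturbations
  sum to at most 1/4 times 8/7 of the norm, less than one half.\<close>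

lemma perturbed_norm:
  assumes c: "0 < c" and x: "\<And>k. x k \<in> c00" and lower: "\<And>k. k \<in> S \<Longrightarrow> c * \<bar>a k\<bar> \<le> norm_W n (lin_comb S a x)"
    and p: "\<And>k. norm (J (x k) - p k) \<le> c / 4 * (1 / 8) ^ k" and S: "finite S"
  shows "norm (\<Sum>k\<in>S. a k *\<^sub>R p k) \<le> 2 * norm_W n (lin_comb S a x)"
    "norm_W n (lin_comb S a x) \<le> 2 * norm (\<Sum>k\<in>S. a k *\<^sub>R p k)"
proof -
  define M where "M = norm_W n (lin_comb S a x)"
  have xc: "lin_comb S a x \<in> c00" using x S by (intro lin_comb_c00) auto
  have nM: "norm (J (lin_comb S a x)) = M" unfolding M_def by (rule J_norm[OF xc])
  have M0: "0 \<le> M" unfolding M_def by (rule norm_W_nonneg)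
  have "norm (J (lin_comb S a x) - (\<Sum>k\<in>S. a k *\<^sub>R p k)) = norm (\<Sum>k\<in>S. a k *\<^sub>R (J (x k) - p k))"
    by (subst J_lin_comb) (use S x in \<open>auto simp: scaleR_diff_right sum_subtractf\<close>)
  also have "\<dots> \<le> (\<Sum>k\<in>S. M / 4 * (1 / 8) ^ k)"
  proof (rule order_trans[OF norm_sum], rule sum_mono)
    fix k assume k: "k \<in> S"
    have "norm (a k *\<^sub>R (J (x k) - p k)) \<le> \<bar>a k\<bar> * (c / 4 * (1 / 8) ^ k)"
      unfolding norm_scaleR by (rule mult_left_mono[OF p]) simp
    also have "\<dots> = (c * \<bar>a k\<bar>) * ((1 / 8) ^ k / 4)" by simp
    also have "\<dots> \<le> M * ((1 / 8) ^ k / 4)"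
      using lower[OF k] unfolding M_def by (intro mult_right_mono) auto
    finally show "norm (a k *\<^sub>R (J (x k) - p k)) \<le> M / 4 * (1 / 8) ^ k" by simp
  qed
  also have "\<dots> = M / 4 * (\<Sum>k\<in>S. (1 / 8) ^ k)" by (simp add: sum_distrib_left)
  also have "\<dots> \<le> M / 4 * (8 / 7 * (1 / 8) ^ 0)"
    using M0 by (intro mult_left_mono sum_eighth_le[OF S]) auto
  also have "\<dots> \<le> M / 2" using M0 by simp
  finally have "norm (J (lin_comb S a x) - (\<Sum>k\<in>S. a k *\<^sub>R p k)) \<le> M / 2" .
  then have "\<bar>M - norm (\<Sum>k\<in>S. a k *\<^sub>R p k)\<bar> \<le> M / 2"
    using norm_triangle_ineq3[of "J (lin_comb S a x)" "\<Sum>k\<in>S. a k *\<^sub>R p k"] nM by linarith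
  then show "norm (\<Sum>k\<in>S. a k *\<^sub>R p k) \<le> 2 * norm_W n (lin_comb S a x)"
    "norm_W n (lin_comb S a x) \<le> 2 * norm (\<Sum>k\<in>S. a k *\<^sub>R p k)"
    unfolding M_def[symmetric] using M0 by linarith+
qed

lemma quasi_minimal_X: "quasi_minimal X"
  unfolding quasi_minimal_def
proof (intro allI impI)
  fix Y Z :: "'a set"
  assume YZ: "inf_dim_closed_subspace Y \<and> Y \<subseteq> X \<and> inf_dim_closed_subspace Z \<and> Z \<subseteq> X"
  then have Y: "subspace Y" "closed Y" "Y \<subseteq> X" "\<not> (\<exists>B. finite B \<and> Y \<subseteq> span B)"
    and Z: "subspace Z" "closed Z" "Z \<subseteq> X" "\<not> (\<exists>B. finite B \<and> Z \<subseteq> span B)"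
    unfolding inf_dim_closed_subspace_def by auto
  obtain c where c: "0 < c" and seqs: "\<And>L :: nat \<Rightarrow> nat. \<exists>\<mu> y z. (\<forall>k. L k \<le> \<mu> k \<and> y k \<in> near Y (\<mu> k) \<and> z k \<in> near Z (\<mu> k)) \<and>
    seq_dominated n c y z \<and> seq_dominated n c z y"
    using equivalent_sequences[OF asymptotic_near[OF Y(1,3,4)] asymptotic_near[OF Z(1,3,4)]] by blast
  \<comment> \<open>Brings the distances to the two subspaces below the tolerance of
    \<open>perturbed_norm\<close>.\<close>
  define L where "L k = nat \<lceil>4 / c * 8 ^ k\<rceil>" for k :: nat
  obtain \<mu> y z where \<mu>: "\<And>k. L k \<le> \<mu> k" and yz: "\<And>k. y k \<in> near Y (\<mu> k)" "\<And>k. z k \<in> near Z (\<mu> k)"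
    and dom: "seq_dominated n c y z" "seq_dominated n c z y" using seqs[of L] by blast
  have small: "1 / real (\<mu> k + 1) \<le> c / 4 * (1 / 8) ^ k" for k
  proof -
    have "4 / c * 8 ^ k \<le> real (L k)" unfolding L_def by (rule real_nat_ceiling_ge)
    also have "\<dots> \<le> real (\<mu> k + 1)" using \<mu>[of k] by simp
    finally have "1 / real (\<mu> k + 1) \<le> 1 / (4 / c * 8 ^ k)" using c by (intro divide_left_mono) auto
    then show ?thesis by (simp add: power_divide)
  qed
  have "\<exists>u\<in>Y. norm (J (y k) - u) \<le> c / 4 * (1 / 8) ^ k" for k
  proof -
    obtain u where "u \<in> Y" "norm (J (y k) - u) < 1 / real (\<mu> k + 1)"
      using yz(1)[of k] unfolding near_def by blast
    then show ?thesis using small[of k] by (intro bexI[of _ u]) auto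
  qed
  then obtain p where p: "\<And>k. p k \<in> Y" "\<And>k. norm (J (y k) - p k) \<le> c / 4 * (1 / 8) ^ k" by metis
  have "\<exists>u\<in>Z. norm (J (z k) - u) \<le> c / 4 * (1 / 8) ^ k" for k
  proof -
    obtain u where "u \<in> Z" "norm (J (z k) - u) < 1 / real (\<mu> k + 1)"
      using yz(2)[of k] unfolding near_def by blast
    then show ?thesis using small[of k] by (intro bexI[of _ u]) auto
  qed
  then obtain q where q: "\<And>k. q k \<in> Z" "\<And>k. norm (J (z k) - q k) \<le> c / 4 * (1 / 8) ^ k" by metis
  have yc: "y k \<in> c00" and zc: "z k \<in> c00" for k using yz by (auto simp: near_def)
  have yl: "c * \<bar>a k\<bar> \<le> norm_W n (lin_comb S a y)" and zl: "c * \<bar>a k\<bar> \<le> norm_W n (lin_comb S a z)" if "finite S" "k \<in> S" for S a k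
    using dom that unfolding seq_dominated_def by blast+
  have ydz: "norm_W n (lin_comb S a y) \<le> 3 / c * norm_W n (lin_comb S a z)"
    and zdy: "norm_W n (lin_comb S a z) \<le> 3 / c * norm_W n (lin_comb S a y)" if "finite S" for S a
    using dom that unfolding seq_dominated_def by blast+
  \<comment> \<open>The constant 12 / c is 3 / c with a factor 2 for each of the two
    perturbations.\<close>
  have pq: "norm (\<Sum>k\<in>S. a k *\<^sub>R q k) \<le> 12 / c * norm (\<Sum>k\<in>S. a k *\<^sub>R p k)"
    and qp: "norm (\<Sum>k\<in>S. a k *\<^sub>R p k) \<le> 12 / c * norm (\<Sum>k\<in>S. a k *\<^sub>R q k)"
    and pl: "\<And>k. k \<in> S \<Longrightarrow> c / 2 * \<bar>a k\<bar> \<le> norm (\<Sum>k\<in>S. a k *\<^sub>R p k)"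
    and ql: "\<And>k. k \<in> S \<Longrightarrow> c / 2 * \<bar>a k\<bar> \<le> norm (\<Sum>k\<in>S. a k *\<^sub>R q k)" if S: "finite S" for S a
  proof -
    have P1: "norm (\<Sum>k\<in>S. a k *\<^sub>R p k) \<le> 2 * norm_W n (lin_comb S a y)" "norm_W n (lin_comb S a y) \<le> 2 * norm (\<Sum>k\<in>S. a k *\<^sub>R p k)"
      by (rule perturbed_norm[OF c yc _ p(2) S], rule yl[OF S], assumption)+
    have Q1: "norm (\<Sum>k\<in>S. a k *\<^sub>R q k) \<le> 2 * norm_W n (lin_comb S a z)" "norm_W n (lin_comb S a z) \<le> 2 * norm (\<Sum>k\<in>S. a k *\<^sub>R q k)"
      by (rule perturbed_norm[OF c zc _ q(2) S], rule zl[OF S], assumption)+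
    have "3 / c * norm_W n (lin_comb S a y) \<le> 3 / c * (2 * norm (\<Sum>k\<in>S. a k *\<^sub>R p k))"
      using P1(2) c by (intro mult_left_mono) auto
    then show "norm (\<Sum>k\<in>S. a k *\<^sub>R q k) \<le> 12 / c * norm (\<Sum>k\<in>S. a k *\<^sub>R p k)"
      using Q1(1) zdy[OF S, of a] by simp
    have "3 / c * norm_W n (lin_comb S a z) \<le> 3 / c * (2 * norm (\<Sum>k\<in>S. a k *\<^sub>R q k))"
      using Q1(2) c by (intro mult_left_mono) auto
    then show "norm (\<Sum>k\<in>S. a k *\<^sub>R p k) \<le> 12 / c * norm (\<Sum>k\<in>S. a k *\<^sub>R q k)"
      using P1(1) ydz[OF S, of a] by simp
    show "c / 2 * \<bar>a k\<bar> \<le> norm (\<Sum>k\<in>S. a k *\<^sub>R p k)" if "k \<in> S" for k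
      using yl[OF S that, of a] P1(2) by simp
    show "c / 2 * \<bar>a k\<bar> \<le> norm (\<Sum>k\<in>S. a k *\<^sub>R q k)" if "k \<in> S" for k
      using zl[OF S that, of a] Q1(2) by simp
  qed
  have c2: "0 < c / 2" using c by simp
  have ip: "inj p" "independent (range p)" using lower_bound_independent[OF c2, of p] pl by blast+
  have iq: "inj q" "independent (range q)" using lower_bound_independent[OF c2, of q] ql by blast+
  have "isomorphic_subspaces (closure (span (range p))) (closure (span (range q)))"
    by (rule isomorphic_closed_spans[OF ip iq pq qp])
  moreover have "closure (span (range p)) \<subseteq> Y"
    by (intro closure_minimal span_minimal) (use p Y in auto)
  moreover have "closure (span (range q)) \<subseteq> Z"
    by (intro closure_minimal span_minimal) (use q Z in auto)
  ultimately show "\<exists>Y' Z'. inf_dim_closed_subspace Y' \<and> Y' \<subseteq> Y \<and>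
        inf_dim_closed_subspace Z' \<and> Z' \<subseteq> Z \<and> isomorphic_subspaces Y' Z'"
    using inf_dim_closed_span[OF ip] inf_dim_closed_span[OF iq] by blast
qed

end

theorem corollary4p12:
  fixes n :: nat and X :: "'a::banach set"
  assumes "n \<ge> 1" and "is_X01 n X"
  shows "quasi_minimal X"
proof -
  obtain J :: "(nat \<Rightarrow> real) \<Rightarrow> 'a" where
    "\<forall>x\<in>c00. \<forall>y\<in>c00. J (\<lambda>i. x i + y i) = J x + J y" "\<forall>c. \<forall>x\<in>c00. J (\<lambda>i. c * x i) = c *\<^sub>R J x"
    "\<forall>x\<in>c00. norm (J x) = norm_W n x" "X = closure (J ` c00)"
    using assms(2) unfolding is_X01_def by blast
  then interpret completion n X J
    using assms(1) by unfold_locales auto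
  show ?thesis by (rule quasi_minimal_X)
qed

end
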